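(* Let $m$ be even, let $\tau,\nu$ be permutations of $\{1,\ldots,m\}$ and let $H_1,\ldots,H_m$ be positive kernel operators on $L^2(X,\mu)$. For $j=1,\ldots,\frac m2$ denote $A_j=H_{\tau(2j-1)}^*H_{\tau(2j)}$ and $A_{\frac m2+j}=A_j^*=H_{\tau(2j)}^*H_{\tau(2j-1)}$. Let $P_i=A_{\nu(i)}\cdots A_{\nu(m)}A_{\nu(1)}\cdots A_{\nu(i-1)}$ for $i=1,\ldots,m$. (i) Then $$\|H_1^{(\frac1m)}\circ\cdots\circ H_m^{(\frac1m)}\|\le r\big(A_1^{(\frac1m)}\circ\cdots\circ A_m^{(\frac1m)}\big)^{\frac12}$$ $$\le r\big(P_1^{(\frac1m)}\circ P_2^{(\frac1m)}\circ\cdots\circ P_m^{(\frac1m)}\big)^{\frac1{2m}}\le r\big(A_{\nu(1)}\cdots A_{\nu(m)}\big)^{\frac1{2m}}.$$ (ii) If $H_1,\ldots,H_m$ are nonnegative matrices that define operators on $l^2(R)$ and if $\alpha\ge\frac1m$, then $$\|H_1^{(\alpha)}\circ\cdots\circ H_m^{(\alpha)}\|\le r\big(A_1^{(\alpha)}\circ\cdots\circ A_m^{(\alpha)}\big)^{\frac12}$$ $$\le r\big(P_1^{(\alpha)}\circ P_2^{(\alpha)}\circ\cdots\circ P_m^{(\alpha)}\big)^{\frac1{2m}}\le r\big(A_{\nu(1)}\cdots A_{\nu(m)}\big)^{\frac\alpha2}.$$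
   Context: $\mu$ is a $\sigma$-finite positive measure on a $\sigma$-algebra of subsets of a nonempty set $X$; $L^2(X,\mu)$ is the complex Hilbert space. A kernel operator $K$ on $L^2(X,\mu)$ is a linear operator $(Kf)(x)=\int_X k(x,y)f(y)\,d\mu(y)$ with $\mu\times\mu$-measurable kernel $k$ such that $\int_X|k(x,y)f(y)|\,d\mu(y)<\infty$ for all $f$ and almost all $x$. It is positive if it maps nonnegative functions to nonnegative functions (equivalently $k\ge0$ a.e.). $K^*$ is the adjoint, with kernel $k(y,x)$ at $(x,y)$; juxtaposition is composition. The Hadamard product $K\circ H$ has kernel $k(x,y)h(x,y)$, and the Hadamard power $K^{(t)}$ has kernel $k(x,y)^t$. $R$ is $\{1,\ldots,N\}$ for some $N\in\mathbb N$ or $R=\mathbb N$; a nonnegative matrix $K=[k(i,j)]_{i,j\in R}$ defines an operator on $l^2(R)$ if $Kx\in l^2(R)$ for all $x\in l^2(R)$, where $(Kx)_i=\sum_jk(i,j)x_j$; for matrices the Hadamard product and power are entrywise. $r$ is the spectral radius and $\|\cdot\|$ the operator norm. *)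

theory Defs
  imports "HOL-Analysis.Analysis"
begin

section \<open>The space $L^2$ and operators on it\<close>

text \<open>
  \<open>L2 M\<close> consists of functions, not of classes of functions. Elements of the Hilbert space
  $L^2$ are represented by members of \<open>L2 M\<close>, and equality in $L^2$ is equality almost
  everywhere; an operator on $L^2$ is represented by its action on functions.
\<close>

definition L2 :: "'a measure \<Rightarrow> ('a \<Rightarrow> complex) set" where
  "L2 M = {f \<in> borel_measurable M. integrable M (\<lambda>x. (norm (f x))\<^sup>2)}"

definition L2_norm :: "'a measure \<Rightarrow> ('a \<Rightarrow> complex) \<Rightarrow> real" where
  "L2_norm M f = sqrt (\<integral>x. (norm (f x))\<^sup>2 \<partial>M)"

definition operator_norm :: "'a measure \<Rightarrow> (('a \<Rightarrow> complex) \<Rightarrow> 'a \<Rightarrow> complex) \<Rightarrow> real" where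
  "operator_norm M T = (SUP f \<in> {f \<in> L2 M. L2_norm M f \<le> 1}. L2_norm M (T f))"

text \<open>Bijectivity on $L^2$ with bounded inverse, expressed on representatives.\<close>

definition invertible_on_L2 :: "'a measure \<Rightarrow> (('a \<Rightarrow> complex) \<Rightarrow> 'a \<Rightarrow> complex) \<Rightarrow> bool" where
  "invertible_on_L2 M T \<longleftrightarrow>
     (\<forall>f\<in>L2 M. \<forall>g\<in>L2 M. (AE x in M. T f x = T g x) \<longrightarrow> (AE x in M. f x = g x)) \<and>
     (\<exists>C. \<forall>g\<in>L2 M. \<exists>f\<in>L2 M. (AE x in M. T f x = g x) \<and> L2_norm M f \<le> C * L2_norm M g)"

definition spectrum :: "'a measure \<Rightarrow> (('a \<Rightarrow> complex) \<Rightarrow> 'a \<Rightarrow> complex) \<Rightarrow> complex set" where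
  "spectrum M T = {z. \<not> invertible_on_L2 M (\<lambda>f x. z * f x - T f x)}"

text \<open>
  The spectrum of a bounded operator is empty only if $L^2$ is the zero space, that is, if the
  measure is zero. Inserting \<open>0\<close> makes the spectral radius \<open>0\<close> in that case.
\<close>

definition spectral_radius :: "'a measure \<Rightarrow> (('a \<Rightarrow> complex) \<Rightarrow> 'a \<Rightarrow> complex) \<Rightarrow> real" where
  "spectral_radius M T = Sup (insert 0 (norm ` spectrum M T))"


section \<open>Positive kernel operators\<close>

text \<open>
  A positive kernel operator has an almost everywhere nonnegative kernel, so real-valued kernels
  suffice. Operators are handled through their kernels.
\<close>

definition kernel_op :: "'a measure \<Rightarrow> ('a \<Rightarrow> 'a \<Rightarrow> real) \<Rightarrow> ('a \<Rightarrow> complex) \<Rightarrow> 'a \<Rightarrow> complex" where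
  "kernel_op M k f x = (\<integral>y. complex_of_real (k x y) * f y \<partial>M)"

definition kernel_operator :: "'a measure \<Rightarrow> ('a \<Rightarrow> 'a \<Rightarrow> real) \<Rightarrow> bool" where
  "kernel_operator M k \<longleftrightarrow>
     case_prod k \<in> borel_measurable (M \<Otimes>\<^sub>M M) \<and>
     (\<forall>f\<in>L2 M. (AE x in M. integrable M (\<lambda>y. complex_of_real (k x y) * f y)) \<and>
                kernel_op M k f \<in> L2 M)"

definition positive_kernel_operator :: "'a measure \<Rightarrow> ('a \<Rightarrow> 'a \<Rightarrow> real) \<Rightarrow> bool" where
  "positive_kernel_operator M k \<longleftrightarrow>
     kernel_operator M k \<and> (AE (x, y) in M \<Otimes>\<^sub>M M. 0 \<le> k x y)"

definition kernel_norm :: "'a measure \<Rightarrow> ('a \<Rightarrow> 'a \<Rightarrow> real) \<Rightarrow> real" where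
  "kernel_norm M k = operator_norm M (kernel_op M k)"

definition kernel_radius :: "'a measure \<Rightarrow> ('a \<Rightarrow> 'a \<Rightarrow> real) \<Rightarrow> real" where
  "kernel_radius M k = spectral_radius M (kernel_op M k)"

definition kernel_adjoint :: "('a \<Rightarrow> 'a \<Rightarrow> real) \<Rightarrow> 'a \<Rightarrow> 'a \<Rightarrow> real" where
  "kernel_adjoint k x y = k y x"

text \<open>
  The kernel of the composition of two operators. For positive kernel operators the integral is
  finite for almost all \<open>(x, y)\<close>.
\<close>

definition kernel_comp ::
    "'a measure \<Rightarrow> ('a \<Rightarrow> 'a \<Rightarrow> real) \<Rightarrow> ('a \<Rightarrow> 'a \<Rightarrow> real) \<Rightarrow> 'a \<Rightarrow> 'a \<Rightarrow> real" where
  "kernel_comp M k h x y = (\<integral>z. k x z * h z y \<partial>M)"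

text \<open>
  Composition of a nonempty list of operators. The value for the empty list is irrelevant, since
  the identity is in general not a kernel operator.
\<close>

fun kernel_comp_list :: "'a measure \<Rightarrow> ('a \<Rightarrow> 'a \<Rightarrow> real) list \<Rightarrow> 'a \<Rightarrow> 'a \<Rightarrow> real" where
  "kernel_comp_list M [] = (\<lambda>x y. 0)"
| "kernel_comp_list M [k] = k"
| "kernel_comp_list M (k # h # ks) = kernel_comp M k (kernel_comp_list M (h # ks))"

definition hadamard_power :: "('a \<Rightarrow> 'a \<Rightarrow> real) \<Rightarrow> real \<Rightarrow> 'a \<Rightarrow> 'a \<Rightarrow> real" where
  "hadamard_power k t x y = k x y powr t"

definition hadamard_prod :: "nat \<Rightarrow> (nat \<Rightarrow> 'a \<Rightarrow> 'a \<Rightarrow> real) \<Rightarrow> 'a \<Rightarrow> 'a \<Rightarrow> real" where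
  "hadamard_prod m K x y = (\<Prod>i=1..m. K i x y)"


section \<open>Nonnegative matrices\<close>

text \<open>
  $l^2(R)$ is $L^2$ of the counting measure on \<open>R\<close>, and a matrix acts as the kernel operator with
  its entries as kernel, so that products and adjoints of matrices are instances of
  \<open>kernel_comp\<close> and \<open>kernel_adjoint\<close>. Integrability with respect to the counting measure is
  absolute summability. For nonnegative entries, absolute convergence for all square summable
  sequences is the same as convergence for all of them.
\<close>

definition nonneg_matrix_operator :: "nat set \<Rightarrow> (nat \<Rightarrow> nat \<Rightarrow> real) \<Rightarrow> bool" where
  "nonneg_matrix_operator R k \<longleftrightarrow>
     (\<forall>i\<in>R. \<forall>j\<in>R. 0 \<le> k i j) \<and> kernel_operator (count_space R) k"


section \<open>The operators $A_i$ and $P_i$\<close>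

definition A_ops ::
    "'a measure \<Rightarrow> nat \<Rightarrow> (nat \<Rightarrow> nat) \<Rightarrow> (nat \<Rightarrow> 'a \<Rightarrow> 'a \<Rightarrow> real) \<Rightarrow> nat \<Rightarrow> 'a \<Rightarrow> 'a \<Rightarrow> real" where
  "A_ops M m \<tau> H i =
     (if i \<le> m div 2
      then kernel_comp M (kernel_adjoint (H (\<tau> (2 * i - 1)))) (H (\<tau> (2 * i)))
      else let j = i - m div 2
           in kernel_comp M (kernel_adjoint (H (\<tau> (2 * j)))) (H (\<tau> (2 * j - 1))))"

definition P_ops ::
    "'a measure \<Rightarrow> nat \<Rightarrow> (nat \<Rightarrow> nat) \<Rightarrow> (nat \<Rightarrow> 'a \<Rightarrow> 'a \<Rightarrow> real) \<Rightarrow> nat \<Rightarrow> 'a \<Rightarrow> 'a \<Rightarrow> real" where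
  "P_ops M m \<nu> A i = kernel_comp_list M (map (\<lambda>l. A (\<nu> l)) ([i..<m+1] @ [1..<i]))"


section \<open>The kernels represent composition and adjoint\<close>

lemma L2_cmod: "f \<in> L2 M \<Longrightarrow> (\<lambda>x. complex_of_real (norm (f x))) \<in> L2 M"
  by (auto simp: L2_def)

lemma integrable_L2_mult:
  assumes "f \<in> L2 M" "g \<in> L2 M"
  shows "integrable M (\<lambda>x. f x * g x)"
proof (rule Bochner_Integration.integrable_bound)
  show "integrable M (\<lambda>x. (norm (f x))\<^sup>2 + (norm (g x))\<^sup>2)"
    using assms by (auto simp: L2_def)
  show "(\<lambda>x. f x * g x) \<in> borel_measurable M"
    using assms by (auto simp: L2_def)
  have "norm (f x * g x) \<le> norm ((norm (f x))\<^sup>2 + (norm (g x))\<^sup>2)" for x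
  proof -
    have "2 * norm (f x) * norm (g x) \<le> (norm (f x))\<^sup>2 + (norm (g x))\<^sup>2"
      by (rule sum_squares_bound)
    moreover have "0 \<le> norm (f x) * norm (g x)" by simp
    ultimately have "norm (f x) * norm (g x) \<le> (norm (f x))\<^sup>2 + (norm (g x))\<^sup>2" by linarith
    then show ?thesis by (simp add: norm_mult)
  qed
  then show "AE x in M. norm (f x * g x) \<le> norm ((norm (f x))\<^sup>2 + (norm (g x))\<^sup>2)" by simp
qed

lemma kernel_op_cmod:
  assumes "sigma_finite_measure M" "positive_kernel_operator M k" "f \<in> L2 M"
  shows "AE x in M. kernel_op M k (\<lambda>y. complex_of_real (norm (f y))) x =
           complex_of_real (\<integral>y. norm (complex_of_real (k x y) * f y) \<partial>M)"
proof -
  interpret sigma_finite_measure M by fact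
  interpret P: pair_sigma_finite M M ..
  have "AE x in M. AE y in M. 0 \<le> k x y"
    using P.AE_pair[of "\<lambda>(x, y). 0 \<le> k x y"] assms(2)
    by (simp add: positive_kernel_operator_def)
  with AE_space show ?thesis
  proof eventually_elim
    case (elim x)
    have [measurable]: "k x \<in> borel_measurable M"
      using assms(2) elim(1) measurable_Pair2[of "case_prod k" M M borel x]
      by (simp add: positive_kernel_operator_def kernel_operator_def)
    have [measurable]: "f \<in> borel_measurable M" using assms(3) by (simp add: L2_def)
    have "kernel_op M k (\<lambda>y. complex_of_real (norm (f y))) x =
        (\<integral>y. complex_of_real (norm (complex_of_real (k x y) * f y)) \<partial>M)"
      unfolding kernel_op_def
      by (rule integral_cong_AE) (use elim(2) in \<open>auto simp: norm_mult\<close>)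
    then show ?case by simp
  qed
qed

lemma kernel_op_kernel_comp:
  assumes "sigma_finite_measure M"
    and k: "positive_kernel_operator M k" and h: "positive_kernel_operator M h"
    and f: "f \<in> L2 M"
  shows "AE x in M. kernel_op M (kernel_comp M k h) f x = kernel_op M k (kernel_op M h f) x"
proof -
  interpret sigma_finite_measure M by fact
  interpret P: pair_sigma_finite M M ..
  define u where "u = kernel_op M h (\<lambda>y. complex_of_real (norm (f y)))"
  have u: "u \<in> L2 M"
    using h L2_cmod[OF f] by (simp add: u_def positive_kernel_operator_def kernel_operator_def)
  have [measurable]: "f \<in> borel_measurable M" using f by (simp add: L2_def)
  have [measurable]: "case_prod h \<in> borel_measurable (M \<Otimes>\<^sub>M M)"
      "case_prod k \<in> borel_measurable (M \<Otimes>\<^sub>M M)"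
    using h k by (auto simp: positive_kernel_operator_def kernel_operator_def)
  have int_h: "AE z in M. integrable M (\<lambda>y. complex_of_real (h z y) * f y)"
    using h f by (auto simp: positive_kernel_operator_def kernel_operator_def)
  have u_eq: "AE z in M. u z = complex_of_real (\<integral>y. norm (complex_of_real (h z y) * f y) \<partial>M)"
    unfolding u_def by (rule kernel_op_cmod) (use assms in auto)
  have int_k: "AE x in M. integrable M (\<lambda>z. complex_of_real (k x z) * u z)"
    using k u by (auto simp: positive_kernel_operator_def kernel_operator_def)
  from AE_space int_k show ?thesis
  proof eventually_elim
    case (elim x)
    note [measurable] = measurable_Pair2[of "case_prod k" M M borel x, OF _ elim(1), simplified]
    let ?F = "\<lambda>(z, y). complex_of_real (k x z) * (complex_of_real (h z y) * f y)"
    have F: "integrable (M \<Otimes>\<^sub>M M) ?F"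
    proof (rule P.Fubini_integrable)
      show "?F \<in> borel_measurable (M \<Otimes>\<^sub>M M)" by measurable
      have "integrable M (\<lambda>z. norm (complex_of_real (k x z) * u z))"
        using elim(2) by (rule integrable_norm)
      moreover have "AE z in M. norm (complex_of_real (k x z) * u z) =
          (\<integral>y. norm (?F (z, y)) \<partial>M)"
        using u_eq
      proof eventually_elim
        case (elim z)
        then show ?case by (simp add: norm_mult)
      qed
      moreover have "u \<in> borel_measurable M" using u by (simp add: L2_def)
      ultimately show "integrable M (\<lambda>z. \<integral>y. norm (?F (z, y)) \<partial>M)"
        by (subst (asm) integrable_cong_AE) auto
      show "AE z in M. integrable M (\<lambda>y. ?F (z, y))"
        using int_h by eventually_elim simp
    qed
    have "kernel_op M k (kernel_op M h f) x = (\<integral>z. (\<integral>y. ?F (z, y) \<partial>M) \<partial>M)"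
      by (simp add: kernel_op_def)
    also have "\<dots> = (\<integral>y. (\<integral>z. ?F (z, y) \<partial>M) \<partial>M)"
      using P.Fubini_integral[of "\<lambda>z y. ?F (z, y)"] F by simp
    also have "\<dots> = (\<integral>y. (\<integral>z. complex_of_real (k x z * h z y) * f y \<partial>M) \<partial>M)"
      by (simp add: mult.assoc)
    also have "\<dots> = (\<integral>y. complex_of_real (\<integral>z. k x z * h z y \<partial>M) * f y \<partial>M)"
    proof (rule Bochner_Integration.integral_cong[OF refl])
      fix y
      have "(\<integral>z. complex_of_real (k x z * h z y) * f y \<partial>M) =
          (\<integral>z. complex_of_real (k x z * h z y) \<partial>M) * f y"
        by (rule integral_mult_left_zero)
      then show "(\<integral>z. complex_of_real (k x z * h z y) * f y \<partial>M) =
          complex_of_real (\<integral>z. k x z * h z y \<partial>M) * f y"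
        by (simp only: integral_complex_of_real)
    qed
    also have "\<dots> = kernel_op M (kernel_comp M k h) f x"
      by (simp add: kernel_op_def kernel_comp_def)
    finally show ?case by simp
  qed
qed

lemma kernel_op_kernel_adjoint:
  assumes "sigma_finite_measure M"
    and k: "positive_kernel_operator M k" and f: "f \<in> L2 M" and g: "g \<in> L2 M"
  shows "(\<integral>x. kernel_op M k f x * cnj (g x) \<partial>M) =
         (\<integral>x. f x * cnj (kernel_op M (kernel_adjoint k) g x) \<partial>M)"
proof -
  interpret sigma_finite_measure M by fact
  interpret P: pair_sigma_finite M M ..
  define u where "u = kernel_op M k (\<lambda>y. complex_of_real (norm (f y)))"
  have u: "u \<in> L2 M"
    using k L2_cmod[OF f] by (simp add: u_def positive_kernel_operator_def kernel_operator_def)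
  have [measurable]: "f \<in> borel_measurable M" "g \<in> borel_measurable M"
    using f g by (auto simp: L2_def)
  have [measurable]: "cnj \<in> borel_measurable borel"
    by (intro borel_measurable_continuous_onI continuous_intros)
  have [measurable]: "case_prod k \<in> borel_measurable (M \<Otimes>\<^sub>M M)"
    using k by (auto simp: positive_kernel_operator_def kernel_operator_def)
  have int_k: "AE x in M. integrable M (\<lambda>y. complex_of_real (k x y) * f y)"
    using k f by (auto simp: positive_kernel_operator_def kernel_operator_def)
  have u_eq: "AE x in M. u x = complex_of_real (\<integral>y. norm (complex_of_real (k x y) * f y) \<partial>M)"
    unfolding u_def by (rule kernel_op_cmod) (use assms in auto)
  let ?F = "\<lambda>(x, y). complex_of_real (k x y) * f y * cnj (g x)"
  have F: "integrable (M \<Otimes>\<^sub>M M) ?F"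
  proof (rule P.Fubini_integrable)
    show "?F \<in> borel_measurable (M \<Otimes>\<^sub>M M)" by measurable
    have "integrable M (\<lambda>x. norm (u x * g x))"
      using integrable_L2_mult[OF u g] by (rule integrable_norm)
    moreover have "AE x in M. norm (u x * g x) = (\<integral>y. norm (?F (x, y)) \<partial>M)"
      using u_eq
    proof eventually_elim
      case (elim x)
      then show ?case by (simp add: norm_mult)
    qed
    moreover have "u \<in> borel_measurable M" using u by (simp add: L2_def)
    ultimately show "integrable M (\<lambda>x. \<integral>y. norm (?F (x, y)) \<partial>M)"
      by (subst (asm) integrable_cong_AE) auto
    show "AE x in M. integrable M (\<lambda>y. ?F (x, y))"
      using int_k by eventually_elim simp
  qed
  have "(\<integral>x. kernel_op M k f x * cnj (g x) \<partial>M) = (\<integral>x. (\<integral>y. ?F (x, y) \<partial>M) \<partial>M)"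
    by (simp add: kernel_op_def)
  also have "\<dots> = (\<integral>y. (\<integral>x. ?F (x, y) \<partial>M) \<partial>M)"
    using P.Fubini_integral[of "\<lambda>x y. ?F (x, y)"] F by simp
  also have "\<dots> = (\<integral>y. (\<integral>x. f y * cnj (complex_of_real (k x y) * g x) \<partial>M) \<partial>M)"
    by (simp add: mult_ac)
  also have "\<dots> = (\<integral>y. f y * cnj (kernel_op M (kernel_adjoint k) g y) \<partial>M)"
    by (simp only: kernel_op_def kernel_adjoint_def integral_mult_right_zero
        Bochner_Integration.integral_cnj)
  finally show ?thesis .
qed

end

theory Submission
  imports Defs
begin

text \<open>
  A positive kernel acts on functions with values in \<open>[0, \<infinity>]\<close> by an integral that always makes
  sense (\<open>nn_op\<close>), and \<open>\<bar>K f\<bar> \<le> K \<bar>f\<bar>\<close>. So norms of positive operators can be estimated by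
  comparing kernels pointwise, and every inequality of the theorem is obtained from a pointwise
  inequality between kernels. Two general facts make this work.

  The first is Gelfand's formula: the spectral radius is the exponential growth rate of the norms of
  the powers (\<open>kernel_radius_le_growth_rate\<close> and \<open>growth_above_kernel_radius\<close>). A growth rate is
  monotone in the kernel, it is invariant under cyclic exchange of factors, and if \<open>K\<^sup>m \<le> Q\<close>
  pointwise then \<open>r(K)\<^sup>m \<le> r(Q)\<close>. For \<open>K\<^sup>*K\<close> it is the square of the norm of \<open>K\<close>
  (\<open>L2_bound_sqrt_of_growth\<close>). Above the growth rate the Neumann series converges. For the converse,
  positivity replaces complex analysis: the growth rate itself lies in the spectrum
  (\<open>growth_rate_in_spectrum\<close>). Otherwise the truncated Neumann series at real points just above it
  would be bounded uniformly, and so would be their squares, in which the power \<open>K\<^sup>n\<close> occurs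
  \<open>n + 1\<close> times; this forces the powers to grow more slowly than they do.

  The second is Hoelder's inequality. Write \<open>hm K\<close> for the Hadamard geometric mean
  \<open>K 1\<^bsup>(1/m)\<^esup> \<circ> \<dots> \<circ> K m\<^bsup>(1/m)\<^esup>\<close>. A composition \<open>hm K hm L\<close> is at most the mean of the
  compositions \<open>K i L i\<close> (\<open>kernel_comp_hadamard_mean_le\<close>), and by induction the same holds for
  longer products.

  Now let \<open>K = hm H\<close>. Since \<open>hm\<close> does not depend on the order of the kernels, \<open>K\<^sup>*K\<close> is the
  product of \<open>hm (\<lambda>i. (H (p i))\<^sup>*)\<close> and \<open>hm (\<lambda>i. H (q i))\<close> for any permutations \<open>p\<close> and \<open>q\<close>. For
  the right choice of them the bound is \<open>hm A\<close>; hence \<open>\<parallel>K\<parallel>\<^sup>2 \<le> r(hm A)\<close>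
  (\<open>kernel_norm_hadamard_mean_le_A_ops\<close>). In the same way \<open>(hm A)\<^sup>m\<close> is a product of \<open>m\<close> differently
  ordered copies of \<open>hm A\<close>, and the cyclic shifts of the order \<open>\<nu>\<close> give the bound \<open>hm P\<close>; hence
  \<open>r(hm A)\<^sup>m \<le> r(hm P)\<close> (\<open>kernel_radius_hadamard_mean_power_le_P_ops\<close>). Finally the powers of \<open>hm P\<close>
  are at most the means of the powers of the \<open>P i\<close>, and the \<open>P i\<close> arise from each other by cyclic
  exchange; hence \<open>r(hm P) \<le> r(A (\<nu> 1) \<dots> A (\<nu> m))\<close> (\<open>kernel_radius_hadamard_mean_le\<close> and
  \<open>kernel_radius_P_ops_le\<close>). This is part (i).

  For matrices let \<open>s = \<alpha> m \<ge> 1\<close>. A Hadamard power with exponent \<open>\<alpha>\<close> is one with exponent \<open>1/m\<close> of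
  one with exponent \<open>s\<close>, so the previous argument applies to the matrices \<open>H i\<^bsup>(s)\<^esup>\<close>. Because
  a sum of numbers \<open>a\<^sup>s\<close> is at most the power \<open>s\<close> of the sum of the \<open>a\<close>, the power \<open>s\<close> can be taken
  out of products (\<open>kernel_comp_list_hadamard_power_le\<close>), and \<open>r(K\<^bsup>(s)\<^esup>) \<le> r(K)\<^sup>s\<close>.
\<close>

section \<open>Operators on nonnegative functions and the growth of their powers\<close>

text \<open>
  Functions with values in \<open>[0, \<infinity>]\<close> need no integrability conditions, so that compositions and
  Tonelli's theorem are unconditional. Negative values of the kernel count as \<open>0\<close>; they occur only
  on null sets.
\<close>

definition nn_op :: "'a measure \<Rightarrow> ('a \<Rightarrow> 'a \<Rightarrow> real) \<Rightarrow> ('a \<Rightarrow> ennreal) \<Rightarrow> 'a \<Rightarrow> ennreal" where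
  "nn_op M k f x = (\<integral>\<^sup>+y. ennreal (k x y) * f y \<partial>M)"

definition sq_norm :: "'a measure \<Rightarrow> ('a \<Rightarrow> ennreal) \<Rightarrow> ennreal" where
  "sq_norm M f = (\<integral>\<^sup>+x. (f x)\<^sup>2 \<partial>M)"

text \<open>
  The operator norm is at most \<open>\<bar>c\<bar>\<close>. Squared norms are integrals, so no roots of infinite values
  have to be considered, and the sign of \<open>c\<close> is irrelevant.
\<close>

definition L2_bound ::
    "'a measure \<Rightarrow> (('a \<Rightarrow> ennreal) \<Rightarrow> 'a \<Rightarrow> ennreal) \<Rightarrow> real \<Rightarrow> bool" where
  "L2_bound M F c \<longleftrightarrow>
     (\<forall>f\<in>borel_measurable M. sq_norm M (F f) \<le> ennreal (c\<^sup>2) * sq_norm M f)"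

text \<open>
  For \<open>c > 0\<close> this is slightly stronger than saying that the roots \<open>\<parallel>F\<^sup>n\<parallel>\<^bsup>1/n\<^esup>\<close> have limit at
  most \<open>c\<close>; the infimum of these \<open>c\<close> is that limit.
\<close>

definition growth ::
    "'a measure \<Rightarrow> (('a \<Rightarrow> ennreal) \<Rightarrow> 'a \<Rightarrow> ennreal) \<Rightarrow> real \<Rightarrow> bool" where
  "growth M F c \<longleftrightarrow> (\<exists>C. \<forall>n. L2_bound M (F ^^ n) (C * c ^ n))"

lemma L2_boundD:
  "L2_bound M F c \<Longrightarrow> f \<in> borel_measurable M \<Longrightarrow> sq_norm M (F f) \<le> ennreal (c\<^sup>2) * sq_norm M f"
  by (simp add: L2_bound_def)

lemma L2_bound_mono:
  assumes "L2_bound M F c" "\<bar>c\<bar> \<le> \<bar>d\<bar>"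
  shows "L2_bound M F d"
proof -
  have "c\<^sup>2 \<le> d\<^sup>2" using assms(2) by (simp add: abs_le_square_iff)
  then show ?thesis using assms(1) unfolding L2_bound_def
    by (meson ennreal_leI mult_right_mono order_trans zero_le)
qed

lemma L2_bound_comp:
  assumes "L2_bound M F c" "L2_bound M G d"
    and "\<And>f. f \<in> borel_measurable M \<Longrightarrow> G f \<in> borel_measurable M"
  shows "L2_bound M (F \<circ> G) (c * d)"
  unfolding L2_bound_def
proof
  fix f :: "'a \<Rightarrow> ennreal" assume f: "f \<in> borel_measurable M"
  have "sq_norm M (F (G f)) \<le> ennreal (c\<^sup>2) * sq_norm M (G f)"
    using assms f by (simp add: L2_bound_def)
  also have "\<dots> \<le> ennreal (c\<^sup>2) * (ennreal (d\<^sup>2) * sq_norm M f)"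
    using assms f by (intro mult_left_mono) (auto simp: L2_bound_def)
  also have "\<dots> = ennreal ((c * d)\<^sup>2) * sq_norm M f"
    by (simp add: power_mult_distrib ennreal_mult mult.assoc)
  finally show "sq_norm M ((F \<circ> G) f) \<le> ennreal ((c * d)\<^sup>2) * sq_norm M f" by simp
qed

lemma L2_bound_funpow:
  assumes "L2_bound M F c" "\<And>f. f \<in> borel_measurable M \<Longrightarrow> F f \<in> borel_measurable M"
  shows "L2_bound M (F ^^ n) (c ^ n)"
proof (induction n)
  case 0 show ?case by (simp add: L2_bound_def)
next
  case (Suc n)
  have "(F ^^ n) f \<in> borel_measurable M" if "f \<in> borel_measurable M" for f
    using that assms(2) by (induction n) auto
  with L2_bound_comp[OF assms(1) Suc.IH] show ?case by (simp add: o_def)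
qed

lemma sq_norm_mono_AE: "AE x in M. f x \<le> g x \<Longrightarrow> sq_norm M f \<le> sq_norm M g"
  unfolding sq_norm_def by (rule nn_integral_mono_AE, erule eventually_mono) (auto intro: power_mono)

lemma sq_norm_cong_AE: "AE x in M. f x = g x \<Longrightarrow> sq_norm M f = sq_norm M g"
  unfolding sq_norm_def by (rule nn_integral_cong_AE) auto

lemma sq_norm_cmult:
  assumes [measurable]: "f \<in> borel_measurable M"
  shows "sq_norm M (\<lambda>x. c * f x) = c\<^sup>2 * sq_norm M f"
  unfolding sq_norm_def by (simp add: power_mult_distrib nn_integral_cmult)

lemma sq_norm_finite_AE:
  assumes [measurable]: "f \<in> borel_measurable M" and "sq_norm M f < \<infinity>"
  shows "AE x in M. f x < \<infinity>"
proof -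
  have "AE x in M. (f x)\<^sup>2 \<noteq> \<infinity>"
    using assms(2) unfolding sq_norm_def by (intro nn_integral_PInf_AE) auto
  then show ?thesis by eventually_elim (auto simp: power_less_top_ennreal less_top[symmetric])
qed

text \<open>
  With this inequality the triangle inequality of $L^2$ can be avoided for finite sums: only
  constants get worse, and constants do not influence growth rates.
\<close>

lemma ennreal_sum_sq_le:
  fixes f :: "'i \<Rightarrow> ennreal"
  assumes "finite I"
  shows "(\<Sum>i\<in>I. f i)\<^sup>2 \<le> of_nat (card I) * (\<Sum>i\<in>I. (f i)\<^sup>2)"
proof -
  have "(\<Sum>i\<in>I. f i)\<^sup>2 = (\<integral>\<^sup>+i. f i * 1 \<partial>count_space I)\<^sup>2"
    using assms by (simp add: nn_integral_count_space_finite)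
  also have "\<dots> \<le> (\<integral>\<^sup>+i. (f i)\<^sup>2 \<partial>count_space I) * (\<integral>\<^sup>+i. 1\<^sup>2 \<partial>count_space I)"
    by (rule Cauchy_Schwarz_nn_integral) auto
  also have "\<dots> = of_nat (card I) * (\<Sum>i\<in>I. (f i)\<^sup>2)"
    using assms by (simp add: nn_integral_count_space_finite mult.commute)
  finally show ?thesis .
qed

lemma sq_norm_sum_le:
  assumes "finite I" and [measurable]: "\<And>i. i \<in> I \<Longrightarrow> f i \<in> borel_measurable M"
  shows "sq_norm M (\<lambda>x. \<Sum>i\<in>I. f i x) \<le> of_nat (card I) * (\<Sum>i\<in>I. sq_norm M (f i))"
proof -
  have "sq_norm M (\<lambda>x. \<Sum>i\<in>I. f i x) \<le> (\<integral>\<^sup>+x. of_nat (card I) * (\<Sum>i\<in>I. (f i x)\<^sup>2) \<partial>M)"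
    unfolding sq_norm_def by (intro nn_integral_mono ennreal_sum_sq_le assms)
  also have "\<dots> = of_nat (card I) * (\<Sum>i\<in>I. sq_norm M (f i))"
    unfolding sq_norm_def by (subst nn_integral_cmult) (auto simp: nn_integral_sum)
  finally show ?thesis .
qed

lemma L2_iff_sq_norm:
  "f \<in> L2 M \<longleftrightarrow> f \<in> borel_measurable M \<and> sq_norm M (\<lambda>x. ennreal (norm (f x))) < \<infinity>"
proof -
  have "integrable M (\<lambda>x. (norm (f x))\<^sup>2) \<longleftrightarrow> sq_norm M (\<lambda>x. ennreal (norm (f x))) < \<infinity>"
    if [measurable]: "f \<in> borel_measurable M"
    by (simp add: integrable_iff_bounded sq_norm_def ennreal_power)
  then show ?thesis by (auto simp: L2_def)
qed

lemma sq_norm_eq_L2_norm: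
  assumes "f \<in> L2 M"
  shows "sq_norm M (\<lambda>x. ennreal (norm (f x))) = ennreal ((L2_norm M f)\<^sup>2)"
proof -
  have "sq_norm M (\<lambda>x. ennreal (norm (f x))) = ennreal (\<integral>x. (norm (f x))\<^sup>2 \<partial>M)"
    unfolding sq_norm_def using assms
    by (subst nn_integral_eq_integral[symmetric]) (auto simp: L2_def ennreal_power)
  then show ?thesis by (simp add: L2_norm_def)
qed

lemma L2_norm_nonneg: "0 \<le> L2_norm M f"
  by (simp add: L2_norm_def)

lemma L2_norm_le_iff:
  assumes "f \<in> L2 M" "0 \<le> c"
  shows "L2_norm M f \<le> c \<longleftrightarrow> sq_norm M (\<lambda>x. ennreal (norm (f x))) \<le> ennreal (c\<^sup>2)"
  using assms(2) L2_norm_nonneg[of M f] by (simp add: sq_norm_eq_L2_norm[OF assms(1)] ennreal_le_iff)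

definition complex_rep :: "('a \<Rightarrow> ennreal) \<Rightarrow> 'a \<Rightarrow> complex" where
  "complex_rep u x = complex_of_real (enn2real (u x))"

lemma complex_rep_L2:
  assumes [measurable]: "u \<in> borel_measurable M" and "sq_norm M u < \<infinity>"
  shows "complex_rep u \<in> L2 M" "AE x in M. ennreal (norm (complex_rep u x)) = u x"
proof -
  show 1: "AE x in M. ennreal (norm (complex_rep u x)) = u x"
    using sq_norm_finite_AE[OF assms] by eventually_elim (simp add: complex_rep_def)
  have "complex_rep u \<in> borel_measurable M" unfolding complex_rep_def[abs_def] by measurable
  then show "complex_rep u \<in> L2 M"
    using sq_norm_cong_AE[OF 1] assms(2) by (simp add: L2_iff_sq_norm)
qed

lemma funpow_measurable:
  fixes F :: "('a \<Rightarrow> 'b::topological_space) \<Rightarrow> 'a \<Rightarrow> 'b"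
  assumes "\<And>f. f \<in> borel_measurable M \<Longrightarrow> F f \<in> borel_measurable M" "f \<in> borel_measurable M"
  shows "(F ^^ n) f \<in> borel_measurable M"
  using assms by (induction n) auto

lemma growth_mono:
  assumes "growth M F c" "0 \<le> c" "c \<le> d"
  shows "growth M F d"
proof -
  obtain C where C: "\<And>n. L2_bound M (F ^^ n) (C * c ^ n)" using assms(1) by (auto simp: growth_def)
  have "L2_bound M (F ^^ n) (C * d ^ n)" for n
    by (rule L2_bound_mono[OF C]) (use assms in \<open>auto simp: abs_mult intro!: mult_left_mono power_mono\<close>)
  then show ?thesis by (auto simp: growth_def)
qed

text \<open>
  A growth rate can be read off along the multiples of a fixed number, since the remaining fewer
  than \<open>N\<close> factors contribute a bounded factor.
\<close>

lemma growth_of_subsequence: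
  assumes meas: "\<And>f. f \<in> borel_measurable M \<Longrightarrow> F f \<in> borel_measurable M"
    and b: "L2_bound M F b" and N: "0 < N" and e: "0 < e"
    and sub: "\<And>q. L2_bound M (F ^^ (N * q)) (C * (e ^ N) ^ q)"
  shows "growth M F e"
proof -
  \<comment> \<open>Chosen so that \<open>\<bar>b\<bar> \<le> B e\<close> and \<open>1 \<le> B\<close>.\<close>
  define B where "B = max 1 (\<bar>b\<bar> / e)"
  have "L2_bound M (F ^^ n) (\<bar>C\<bar> * B ^ N * e ^ n)" for n
  proof -
    let ?q = "n div N" and ?r = "n mod N"
    have n: "?r + N * ?q = n" by simp
    have "L2_bound M (F ^^ ?r \<circ> F ^^ (N * ?q)) (b ^ ?r * (C * (e ^ N) ^ ?q))"
      by (rule L2_bound_comp[OF L2_bound_funpow[OF b meas] sub funpow_measurable[OF meas]])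
    then have *: "L2_bound M (F ^^ n) (b ^ ?r * (C * (e ^ N) ^ ?q))"
      by (simp only: funpow_add[symmetric] n)
    have "\<bar>b\<bar> ^ ?r \<le> (B * e) ^ ?r"
      using e by (intro power_mono) (auto simp: B_def max_def field_simps)
    also have "\<dots> \<le> B ^ N * e ^ ?r"
    proof -
      have "B ^ ?r \<le> B ^ N"
        using N by (intro power_increasing) (auto simp: B_def intro: less_imp_le)
      then show ?thesis using e by (simp add: power_mult_distrib mult_right_mono)
    qed
    finally have "\<bar>b\<bar> ^ ?r * (\<bar>C\<bar> * (e ^ N) ^ ?q) \<le> (B ^ N * e ^ ?r) * (\<bar>C\<bar> * (e ^ N) ^ ?q)"
      using e by (intro mult_right_mono) auto
    also have "\<dots> = \<bar>C\<bar> * B ^ N * e ^ (?r + N * ?q)" by (simp only: power_add power_mult mult_ac)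
    finally have "\<bar>b\<bar> ^ ?r * (\<bar>C\<bar> * (e ^ N) ^ ?q) \<le> \<bar>C\<bar> * B ^ N * e ^ n" by (simp only: n)
    then show ?thesis
      using e by (intro L2_bound_mono[OF *]) (auto simp: abs_mult power_abs B_def)
  qed
  then show ?thesis by (auto simp: growth_def)
qed

lemma growth_of_power_bound:
  assumes meas: "\<And>f. f \<in> borel_measurable M \<Longrightarrow> F f \<in> borel_measurable M"
    and b: "L2_bound M F b" and N: "0 < N" and e: "0 < e"
    and "L2_bound M (F ^^ N) (e ^ N)"
  shows "growth M F e"
proof (rule growth_of_subsequence[OF meas b N e, where C = 1])
  fix q
  show "L2_bound M (F ^^ (N * q)) (1 * (e ^ N) ^ q)"
  proof -
    have "L2_bound M ((F ^^ N) ^^ q) ((e ^ N) ^ q)"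
      by (rule L2_bound_funpow[OF assms(5)]) (rule funpow_measurable[OF meas])
    then show ?thesis by (simp add: funpow_mult)
  qed
qed

context sigma_finite_measure
begin

interpretation P: pair_sigma_finite M M ..

lemma nn_op_measurable [measurable (raw)]:
  assumes [measurable]: "case_prod k \<in> borel_measurable (M \<Otimes>\<^sub>M M)" "f \<in> borel_measurable M"
  shows "nn_op M k f \<in> borel_measurable M"
  unfolding nn_op_def[abs_def] by measurable

lemma nn_op_funpow_measurable:
  assumes "case_prod k \<in> borel_measurable (M \<Otimes>\<^sub>M M)" "f \<in> borel_measurable M"
  shows "(nn_op M k ^^ n) f \<in> borel_measurable M"
  using assms by (induction n) (auto intro: nn_op_measurable)

lemma nn_op_mono_AE: "AE y in M. f y \<le> g y \<Longrightarrow> nn_op M k f x \<le> nn_op M k g x"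
  unfolding nn_op_def by (rule nn_integral_mono_AE, erule eventually_mono) (auto intro: mult_left_mono)

lemma nn_op_cong_AE: "AE y in M. f y = g y \<Longrightarrow> nn_op M k f x = nn_op M k g x"
  unfolding nn_op_def by (rule nn_integral_cong_AE) auto

lemma nn_op_kernel_mono_AE:
  assumes "AE (x, y) in M \<Otimes>\<^sub>M M. k x y \<le> h x y"
  shows "AE x in M. nn_op M k f x \<le> nn_op M h f x"
proof -
  have "AE x in M. AE y in M. k x y \<le> h x y"
    using P.AE_pair[OF assms] by simp
  then show ?thesis
    unfolding nn_op_def
    by eventually_elim (auto intro!: nn_integral_mono_AE mult_right_mono ennreal_leI)
qed

lemma nn_op_funpow_mono_AE:
  assumes "AE (x, y) in M \<Otimes>\<^sub>M M. k x y \<le> h x y"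
  shows "AE x in M. (nn_op M k ^^ n) f x \<le> (nn_op M h ^^ n) f x"
proof (induction n)
  case (Suc n)
  have "AE x in M. nn_op M k ((nn_op M k ^^ n) f) x \<le> nn_op M h ((nn_op M k ^^ n) f) x"
    by (rule nn_op_kernel_mono_AE[OF assms])
  then show ?case
    by eventually_elim (auto intro: order_trans nn_op_mono_AE[OF Suc.IH])
qed simp

lemma growth_kernel_mono:
  assumes "AE (x, y) in M \<Otimes>\<^sub>M M. k x y \<le> h x y" "growth M (nn_op M h) c"
  shows "growth M (nn_op M k) c"
proof -
  obtain C where "\<And>n. L2_bound M (nn_op M h ^^ n) (C * c ^ n)"
    using assms(2) by (auto simp: growth_def)
  then have "L2_bound M (nn_op M k ^^ n) (C * c ^ n)" for n
    unfolding L2_bound_def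
    using sq_norm_mono_AE[OF nn_op_funpow_mono_AE[OF assms(1)]] order_trans by blast
  then show ?thesis by (auto simp: growth_def)
qed

lemma nn_op_cmult:
  assumes [measurable]: "case_prod k \<in> borel_measurable (M \<Otimes>\<^sub>M M)"
    "f \<in> borel_measurable M" and "x \<in> space M"
  shows "nn_op M k (\<lambda>y. c * f y) x = c * nn_op M k f x"
proof -
  have [measurable]: "k x \<in> borel_measurable M"
    using measurable_Pair2[OF assms(1,3)] by simp
  have "nn_op M k (\<lambda>y. c * f y) x = (\<integral>\<^sup>+y. c * (ennreal (k x y) * f y) \<partial>M)"
    unfolding nn_op_def by (simp add: mult_ac)
  then show ?thesis unfolding nn_op_def by (simp add: nn_integral_cmult)
qed

lemma nn_op_sum:
  assumes [measurable]: "case_prod k \<in> borel_measurable (M \<Otimes>\<^sub>M M)"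
    "\<And>i. i \<in> I \<Longrightarrow> f i \<in> borel_measurable M" and x: "x \<in> space M"
  shows "nn_op M k (\<lambda>y. \<Sum>i\<in>I. f i y) x = (\<Sum>i\<in>I. nn_op M k (f i) x)"
proof -
  have [measurable]: "k x \<in> borel_measurable M"
    using measurable_Pair2[OF assms(1) x] by simp
  show ?thesis unfolding nn_op_def by (simp add: sum_distrib_left nn_integral_sum)
qed

lemma nn_op_suminf:
  assumes [measurable]: "case_prod k \<in> borel_measurable (M \<Otimes>\<^sub>M M)"
    "\<And>i. f i \<in> borel_measurable M" and x: "x \<in> space M"
  shows "nn_op M k (\<lambda>y. \<Sum>i. f i y) x = (\<Sum>i. nn_op M k (f i) x)"
proof -
  have [measurable]: "k x \<in> borel_measurable M"
    using measurable_Pair2[OF assms(1) x] by simp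
  have "nn_op M k (\<lambda>y. \<Sum>i. f i y) x = (\<integral>\<^sup>+y. (\<Sum>i. ennreal (k x y) * f i y) \<partial>M)"
    unfolding nn_op_def by simp
  also have "\<dots> = (\<Sum>i. nn_op M k (f i) x)"
    unfolding nn_op_def by (rule nn_integral_suminf) measurable
  finally show ?thesis .
qed

text \<open>
  Tonelli's theorem.
\<close>

lemma nn_op_adjoint:
  assumes [measurable]: "case_prod k \<in> borel_measurable (M \<Otimes>\<^sub>M M)"
    "f \<in> borel_measurable M" "g \<in> borel_measurable M"
  shows "(\<integral>\<^sup>+x. nn_op M k f x * g x \<partial>M) = (\<integral>\<^sup>+y. f y * nn_op M (kernel_adjoint k) g y \<partial>M)"
proof -
  have "(\<integral>\<^sup>+x. nn_op M k f x * g x \<partial>M) = (\<integral>\<^sup>+x. \<integral>\<^sup>+y. ennreal (k x y) * f y * g x \<partial>M \<partial>M)"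
    unfolding nn_op_def
  proof (intro nn_integral_cong)
    fix x assume x: "x \<in> space M"
    have [measurable]: "k x \<in> borel_measurable M"
      using measurable_Pair2[OF assms(1) x] by simp
    show "(\<integral>\<^sup>+y. ennreal (k x y) * f y \<partial>M) * g x = (\<integral>\<^sup>+y. ennreal (k x y) * f y * g x \<partial>M)"
      by (simp add: nn_integral_multc)
  qed
  also have "\<dots> = (\<integral>\<^sup>+y. \<integral>\<^sup>+x. ennreal (k x y) * f y * g x \<partial>M \<partial>M)"
    by (rule P.Fubini'[symmetric]) measurable
  also have "\<dots> = (\<integral>\<^sup>+y. f y * nn_op M (kernel_adjoint k) g y \<partial>M)"
    unfolding nn_op_def kernel_adjoint_def
  proof (intro nn_integral_cong)
    fix y assume y: "y \<in> space M"
    have [measurable]: "(\<lambda>x. k x y) \<in> borel_measurable M"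
      using measurable_Pair1[OF assms(1) y] by simp
    have "(\<integral>\<^sup>+x. ennreal (k x y) * f y * g x \<partial>M) = (\<integral>\<^sup>+x. f y * (ennreal (k x y) * g x) \<partial>M)"
      by (simp add: mult_ac)
    then show "(\<integral>\<^sup>+x. ennreal (k x y) * f y * g x \<partial>M) = f y * (\<integral>\<^sup>+x. ennreal (k x y) * g x \<partial>M)"
      by (simp add: nn_integral_cmult)
  qed
  finally show ?thesis .
qed

end

section \<open>Automatic boundedness of positive kernel operators\<close>

context sigma_finite_measure
begin

interpretation P: pair_sigma_finite M M ..

lemma AE_kernel_slice:
  assumes "AE (x, y) in M \<Otimes>\<^sub>M M. 0 \<le> k x y"
  shows "AE x in M. AE y in M. 0 \<le> k x y"
  using P.AE_pair[OF assms] by simp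

lemma nn_op_norm_eq:
  assumes "AE y in M. 0 \<le> k x y"
  shows "nn_op M k (\<lambda>y. ennreal (norm (f y))) x =
    (\<integral>\<^sup>+y. ennreal (norm (complex_of_real (k x y) * f y)) \<partial>M)"
  unfolding nn_op_def
proof (rule nn_integral_cong_AE)
  show "AE y in M. ennreal (k x y) * ennreal (norm (f y)) =
      ennreal (norm (complex_of_real (k x y) * f y))"
    using assms by eventually_elim (simp add: norm_mult ennreal_mult)
qed

text \<open>
  The inequality \<open>\<bar>K f\<bar> \<le> K \<bar>f\<bar>\<close> links the complex operator to the operator on nonnegative
  functions.
\<close>

lemma norm_kernel_op_le:
  assumes k: "AE (x, y) in M \<Otimes>\<^sub>M M. 0 \<le> k x y"
  shows "AE x in M. ennreal (norm (kernel_op M k f x)) \<le> nn_op M k (\<lambda>y. ennreal (norm (f y))) x"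
  using AE_kernel_slice[OF k]
proof eventually_elim
  case (elim x)
  show ?case
  proof (cases "integrable M (\<lambda>y. complex_of_real (k x y) * f y)")
    case True
    then show ?thesis
      unfolding nn_op_norm_eq[of k x, OF elim] kernel_op_def by (rule integral_norm_bound_ennreal)
  next
    case False
    then show ?thesis by (simp add: kernel_op_def not_integrable_integral_eq)
  qed
qed

lemma kernel_op_complex_rep:
  assumes [measurable]: "case_prod k \<in> borel_measurable (M \<Otimes>\<^sub>M M)"
    and k: "AE (x, y) in M \<Otimes>\<^sub>M M. 0 \<le> k x y"
    and u[measurable]: "u \<in> borel_measurable M" and "sq_norm M u < \<infinity>"
  shows "AE x in M. kernel_op M k (complex_rep u) x = complex_of_real (enn2real (nn_op M k u x))"
  using AE_kernel_slice[OF k] AE_space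
proof eventually_elim
  case (elim x)
  have [measurable]: "k x \<in> borel_measurable M"
    using measurable_Pair2[OF assms(1) elim(2)] by simp
  have "kernel_op M k (complex_rep u) x = complex_of_real (\<integral>y. k x y * enn2real (u y) \<partial>M)"
    unfolding kernel_op_def complex_rep_def by (simp flip: integral_complex_of_real)
  also have "(\<integral>y. k x y * enn2real (u y) \<partial>M) = enn2real (\<integral>\<^sup>+y. ennreal (k x y * enn2real (u y)) \<partial>M)"
    using elim(1) by (intro integral_eq_nn_integral) (measurable, auto)
  also have "(\<integral>\<^sup>+y. ennreal (k x y * enn2real (u y)) \<partial>M) = nn_op M k u x"
    unfolding nn_op_def
  proof (rule nn_integral_cong_AE)
    show "AE y in M. ennreal (k x y * enn2real (u y)) = ennreal (k x y) * u y"
      using elim(1) sq_norm_finite_AE[OF assms(3,4)]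
      by eventually_elim (simp add: ennreal_mult)
  qed
  finally show ?case .
qed

lemma nn_op_finite_sq_norm:
  assumes k: "positive_kernel_operator M k"
    and u[measurable]: "u \<in> borel_measurable M" "sq_norm M u < \<infinity>"
  shows "sq_norm M (nn_op M k u) < \<infinity>"
proof -
  have m[measurable]: "case_prod k \<in> borel_measurable (M \<Otimes>\<^sub>M M)"
    and nn: "AE (x, y) in M \<Otimes>\<^sub>M M. 0 \<le> k x y"
    using k by (auto simp: positive_kernel_operator_def kernel_operator_def)
  note rep = complex_rep_L2[OF u]
  have L2: "kernel_op M k (complex_rep u) \<in> L2 M"
    and int: "AE x in M. integrable M (\<lambda>y. complex_of_real (k x y) * complex_rep u y)"
    using k rep by (auto simp: positive_kernel_operator_def kernel_operator_def)
  have "AE x in M. nn_op M k u x = ennreal (norm (kernel_op M k (complex_rep u) x))"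
    using int AE_kernel_slice[OF nn] kernel_op_complex_rep[OF m nn u]
  proof eventually_elim
    case (elim x)
    have "nn_op M k u x = nn_op M k (\<lambda>y. ennreal (norm (complex_rep u y))) x"
      by (rule nn_op_cong_AE) (use rep(2) in auto)
    also have "\<dots> < \<infinity>"
      using elim(1) unfolding nn_op_norm_eq[of k x, OF elim(2)] by (simp add: integrable_iff_bounded)
    finally show ?case using elim(3) by simp
  qed
  then have "sq_norm M (nn_op M k u) = sq_norm M (\<lambda>x. ennreal (norm (kernel_op M k (complex_rep u) x)))"
    by (rule sq_norm_cong_AE)
  then show ?thesis using L2 by (simp add: L2_iff_sq_norm)
qed

text \<open>
  Otherwise there are unit vectors \<open>f n\<close> whose images have squared norm at least \<open>8\<^sup>n\<close>. A
  function that dominates \<open>2\<^bsup>-n\<^esup> f n\<close> for all \<open>n\<close> is then mapped, by positivity, to a function of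
  infinite norm. Such a dominating function exists in $L^2$, which contradicts that the operator is
  defined there.
\<close>

lemma positive_kernel_operator_bounded:
  assumes k: "positive_kernel_operator M k"
  shows "\<exists>c. L2_bound M (nn_op M k) c"
proof (rule ccontr)
  assume unb: "\<nexists>c. L2_bound M (nn_op M k) c"
  have m[measurable]: "case_prod k \<in> borel_measurable (M \<Otimes>\<^sub>M M)"
    using k by (auto simp: positive_kernel_operator_def kernel_operator_def)
  have "\<exists>f\<in>borel_measurable M. sq_norm M f \<le> 1 \<and> sq_norm M (nn_op M k f) \<ge> ennreal (8 ^ n)" for n :: nat
  proof -
    have "\<not> L2_bound M (nn_op M k) (sqrt (8 ^ n))" using unb by blast
    then obtain f where f[measurable]: "f \<in> borel_measurable M"
      and gt: "sq_norm M (nn_op M k f) > ennreal (8 ^ n) * sq_norm M f"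
      by (auto simp: L2_bound_def not_le)
    have fin: "sq_norm M f < \<infinity>"
    proof (rule ccontr)
      assume "\<not> sq_norm M f < \<infinity>"
      then have "ennreal (8 ^ n) * sq_norm M f = \<infinity>"
        by (simp add: ennreal_mult_top less_top[symmetric])
      then show False using gt by simp
    qed
    have fin2: "sq_norm M (nn_op M k f) < \<infinity>" by (rule nn_op_finite_sq_norm[OF k f fin])
    have scale: "sq_norm M (nn_op M k (\<lambda>y. c * f y)) = c\<^sup>2 * sq_norm M (nn_op M k f)" for c
    proof -
      have "sq_norm M (nn_op M k (\<lambda>y. c * f y)) = sq_norm M (\<lambda>x. c * nn_op M k f x)"
        by (rule sq_norm_cong_AE, rule AE_I2) (simp add: nn_op_cmult)
      then show ?thesis by (simp add: sq_norm_cmult)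
    qed
    define a where "a = enn2real (sq_norm M f)"
    define b where "b = enn2real (sq_norm M (nn_op M k f))"
    have a: "sq_norm M f = ennreal a" "0 \<le> a" using fin by (auto simp: a_def)
    have b: "sq_norm M (nn_op M k f) = ennreal b" "0 \<le> b" using fin2 by (auto simp: b_def)
    have "ennreal (8 ^ n * a) < ennreal b" using gt a b by (simp add: ennreal_mult)
    then have ab: "8 ^ n * a < b" using a by (simp add: ennreal_less_iff)
    \<comment> \<open>The factor that normalises \<open>f\<close>, or, if \<open>f\<close> vanishes, makes the image large enough.\<close>
    define c where "c = (if a = 0 then sqrt (8 ^ n / b) else 1 / sqrt a)"
    have b0: "0 < b" using ab a(2) by (smt (verit) mult_nonneg_nonneg zero_le_power)
    have c2: "c\<^sup>2 = (if a = 0 then 8 ^ n / b else 1 / a)" and c0: "0 \<le> c"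
      using a(2) b0 by (auto simp: c_def power_divide)
    show ?thesis
    proof (intro bexI conjI)
      show "(\<lambda>y. ennreal c * f y) \<in> borel_measurable M" by measurable
      have "sq_norm M (\<lambda>y. ennreal c * f y) = ennreal (c\<^sup>2 * a)"
        using a c0 by (simp add: sq_norm_cmult ennreal_power ennreal_mult)
      also have "\<dots> \<le> ennreal 1" using c2 by (intro ennreal_leI) auto
      finally show "sq_norm M (\<lambda>y. ennreal c * f y) \<le> 1" by simp
      have "sq_norm M (nn_op M k (\<lambda>y. ennreal c * f y)) = ennreal (c\<^sup>2 * b)"
        using b c0 by (simp add: scale ennreal_power ennreal_mult)
      moreover have "8 ^ n \<le> c\<^sup>2 * b" using c2 ab a(2) b0 by (auto simp: field_simps)
      ultimately show "ennreal (8 ^ n) \<le> sq_norm M (nn_op M k (\<lambda>y. ennreal c * f y))"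
        by (simp add: ennreal_leI)
    qed
  qed
  then obtain f where f[measurable]: "\<And>n. f n \<in> borel_measurable M"
    and f1: "\<And>n. sq_norm M (f n) \<le> 1" and f2: "\<And>n. sq_norm M (nn_op M k (f n)) \<ge> ennreal (8 ^ n)"
    by metis
  define q :: "nat \<Rightarrow> ennreal" where "q n = ennreal ((1 / 2) ^ n)" for n
  \<comment> \<open>With a supremum instead of a sum, \<open>g\<^sup>2\<close> is at most the sum of the squares.\<close>
  define g where "g x = (SUP n. q n * f n x)" for x
  have g[measurable]: "g \<in> borel_measurable M" unfolding g_def[abs_def] by measurable
  have q2: "(q n)\<^sup>2 = ennreal ((1 / 4) ^ n)" for n
  proof -
    have "((1 / 2) ^ n)\<^sup>2 = ((1 / 4) ^ n :: real)"
      by (simp add: power2_eq_square flip: power_mult_distrib)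
    then show ?thesis by (simp add: q_def ennreal_power)
  qed
  have gsq: "(g x)\<^sup>2 \<le> (\<Sum>n. (q n * f n x)\<^sup>2)" for x
  proof -
    have "(g x)\<^sup>2 = (SUP n. SUP l. (q l * f l x) * (q n * f n x))"
      by (simp add: g_def power2_eq_square SUP_mult_left_ennreal SUP_mult_right_ennreal)
    also have "\<dots> \<le> (\<Sum>n. (q n * f n x)\<^sup>2)"
    proof (intro SUP_least)
      fix n l
      have le: "(q i * f i x)\<^sup>2 \<le> (\<Sum>n. (q n * f n x)\<^sup>2)" for i
        using sum_le_suminf[of "\<lambda>n. (q n * f n x)\<^sup>2" "{i}"] by simp
      show "(q l * f l x) * (q n * f n x) \<le> (\<Sum>n. (q n * f n x)\<^sup>2)"
      proof (cases "q l * f l x \<le> q n * f n x")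
        case True
        then have "(q l * f l x) * (q n * f n x) \<le> (q n * f n x)\<^sup>2"
          by (simp add: power2_eq_square mult_right_mono)
        then show ?thesis using le order_trans by blast
      next
        case False
        then have "(q l * f l x) * (q n * f n x) \<le> (q l * f l x)\<^sup>2"
          by (simp add: power2_eq_square mult_left_mono)
        then show ?thesis using le order_trans by blast
      qed
    qed
    finally show ?thesis .
  qed
  have "sq_norm M g \<le> (\<integral>\<^sup>+x. (\<Sum>n. (q n * f n x)\<^sup>2) \<partial>M)"
    unfolding sq_norm_def by (intro nn_integral_mono gsq)
  also have "\<dots> = (\<Sum>n. sq_norm M (\<lambda>x. q n * f n x))"
    unfolding sq_norm_def by (rule nn_integral_suminf) measurable
  also have "\<dots> \<le> (\<Sum>n. ennreal ((1 / 4) ^ n))"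
    by (intro suminf_le) (use f1 in \<open>auto simp: sq_norm_cmult q2 intro: mult_left_le\<close>)
  also have "\<dots> < \<infinity>"
    by (subst suminf_ennreal2) (auto intro: summable_geometric)
  finally have "sq_norm M (nn_op M k g) < \<infinity>"
    by (intro nn_op_finite_sq_norm[OF k g])
  moreover have "ennreal (2 ^ n) \<le> sq_norm M (nn_op M k g)" for n
  proof -
    have "ennreal (2 ^ n) = (q n)\<^sup>2 * ennreal (8 ^ n)"
      by (simp add: q2 ennreal_mult'[symmetric] flip: power_mult_distrib)
    also have "\<dots> \<le> (q n)\<^sup>2 * sq_norm M (nn_op M k (f n))"
      by (intro mult_left_mono f2) auto
    also have "\<dots> = sq_norm M (\<lambda>x. q n * nn_op M k (f n) x)"
      by (simp add: sq_norm_cmult)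
    also have "\<dots> \<le> sq_norm M (nn_op M k g)"
    proof (rule sq_norm_mono_AE, rule AE_I2)
      fix x assume x: "x \<in> space M"
      have "q n * nn_op M k (f n) x = nn_op M k (\<lambda>y. q n * f n y) x" using x by (simp add: nn_op_cmult)
      also have "\<dots> \<le> nn_op M k g x"
        by (rule nn_op_mono_AE, rule AE_I2) (auto simp: g_def intro: SUP_upper)
      finally show "q n * nn_op M k (f n) x \<le> nn_op M k g x" .
    qed
    finally show ?thesis .
  qed
  moreover obtain n where "enn2real (sq_norm M (nn_op M k g)) < 2 ^ n"
    using real_arch_pow[of 2] by auto
  ultimately show False
    by (metis enn2real_nonneg ennreal_enn2real ennreal_less_iff infinity_ennreal_def not_le)
qed

text \<open>
  Being defined on all of $L^2$ is hard to verify for a new kernel, while a bound is inherited by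
  sums, products and smaller kernels.
\<close>

lemma positive_kernel_operator_iff:
  "positive_kernel_operator M k \<longleftrightarrow>
     case_prod k \<in> borel_measurable (M \<Otimes>\<^sub>M M) \<and> (AE (x, y) in M \<Otimes>\<^sub>M M. 0 \<le> k x y) \<and>
     (\<exists>c. L2_bound M (nn_op M k) c)" (is "_ \<longleftrightarrow> ?rhs")
proof
  assume "positive_kernel_operator M k"
  then show ?rhs
    using positive_kernel_operator_bounded
    by (simp add: positive_kernel_operator_def kernel_operator_def)
next
  assume ?rhs
  then obtain c where m[measurable]: "case_prod k \<in> borel_measurable (M \<Otimes>\<^sub>M M)"
    and nn: "AE (x, y) in M \<Otimes>\<^sub>M M. 0 \<le> k x y" and c: "L2_bound M (nn_op M k) c"
    by blast
  have "(AE x in M. integrable M (\<lambda>y. complex_of_real (k x y) * f y)) \<and> kernel_op M k f \<in> L2 M"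
    if f: "f \<in> L2 M" for f
  proof -
    have [measurable]: "f \<in> borel_measurable M" using f by (simp add: L2_def)
    let ?u = "\<lambda>y. ennreal (norm (f y))"
    have "sq_norm M (nn_op M k ?u) \<le> ennreal (c\<^sup>2) * sq_norm M ?u"
      using c by (rule L2_boundD) simp
    also have "\<dots> < \<infinity>" using f by (simp add: L2_iff_sq_norm ennreal_mult_less_top)
    finally have fin: "sq_norm M (nn_op M k ?u) < \<infinity>" .
    have "AE x in M. nn_op M k ?u x < \<infinity>"
      by (rule sq_norm_finite_AE[OF _ fin]) measurable
    from AE_kernel_slice[OF nn] this AE_space
    have "AE x in M. integrable M (\<lambda>y. complex_of_real (k x y) * f y)"
    proof eventually_elim
      case (elim x)
      have [measurable]: "k x \<in> borel_measurable M"
        using measurable_Pair2[OF m elim(3)] by simp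
      show ?case
        using elim(2) unfolding integrable_iff_bounded nn_op_norm_eq[of k x, OF elim(1)] by simp
    qed
    moreover have "kernel_op M k f \<in> borel_measurable M"
      unfolding kernel_op_def[abs_def] by measurable
    ultimately show ?thesis
      using sq_norm_mono_AE[OF norm_kernel_op_le[OF nn, of f]] fin
      by (auto simp: L2_iff_sq_norm intro: le_less_trans)
  qed
  then show "positive_kernel_operator M k"
    using m nn by (simp add: positive_kernel_operator_def kernel_operator_def)
qed

lemma kernel_norm_le:
  assumes k: "positive_kernel_operator M k" and b: "L2_bound M (nn_op M k) c" and "0 \<le> c"
  shows "kernel_norm M k \<le> c"
  unfolding kernel_norm_def operator_norm_def
proof (rule cSUP_least)
  have "(\<lambda>x. 0) \<in> {f \<in> L2 M. L2_norm M f \<le> 1}" by (simp add: L2_def L2_norm_def)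
  then show "{f \<in> L2 M. L2_norm M f \<le> 1} \<noteq> {}" by blast
next
  fix f assume f: "f \<in> {f \<in> L2 M. L2_norm M f \<le> 1}"
  have nn: "AE (x, y) in M \<Otimes>\<^sub>M M. 0 \<le> k x y" and "kernel_op M k f \<in> L2 M"
    using k f by (auto simp: positive_kernel_operator_def kernel_operator_def)
  moreover have "sq_norm M (\<lambda>x. ennreal (norm (kernel_op M k f x))) \<le>
      ennreal (c\<^sup>2) * sq_norm M (\<lambda>x. ennreal (norm (f x)))"
    using sq_norm_mono_AE[OF norm_kernel_op_le[OF nn, of f]] f
    by (auto intro!: order_trans[OF _ L2_boundD[OF b]] simp: L2_def)
  moreover have "ennreal (c\<^sup>2) * sq_norm M (\<lambda>x. ennreal (norm (f x))) \<le> ennreal (c\<^sup>2)"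
    using f L2_norm_le_iff[of f M 1] by (auto intro: mult_left_le)
  ultimately show "L2_norm M (kernel_op M k f) \<le> c"
    using \<open>0 \<le> c\<close> by (simp add: L2_norm_le_iff)
qed

end

section \<open>The spectrum lies below the growth rate of the powers\<close>

text \<open>
  A substitute for Minkowski's inequality for series whose terms decay like \<open>q\<^sup>n\<close>: the
  Cauchy-Schwarz inequality is applied to the sum of \<open>q\<^bsup>n/2\<^esup> \<cdot> q\<^bsup>-n/2\<^esup> f n\<close>.
\<close>

lemma sq_norm_suminf_le:
  assumes q: "0 < q" "q < 1" and [measurable]: "\<And>n. f n \<in> borel_measurable M"
    and le: "\<And>n. sq_norm M (f n) \<le> ennreal ((q ^ n)\<^sup>2) * D"
  shows "sq_norm M (\<lambda>x. \<Sum>n. f n x) \<le> ennreal ((1 / (1 - q))\<^sup>2) * D"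
proof -
  have S: "(\<Sum>n. ennreal (q ^ n)) = ennreal (1 / (1 - q))"
    using q by (subst suminf_ennreal2) (auto simp: suminf_geometric summable_geometric)
  have pt: "(\<Sum>n. f n x)\<^sup>2 \<le> ennreal (1 / (1 - q)) * (\<Sum>n. ennreal (1 / q ^ n) * (f n x)\<^sup>2)" for x
  proof -
    have sq: "(sqrt q ^ n)\<^sup>2 = q ^ n" for n
      using q by (simp add: power2_eq_square flip: power_mult_distrib)
    have one: "ennreal (sqrt q ^ n) * (ennreal (1 / sqrt q ^ n) * f n x) = f n x" for n
      using q by (simp add: ennreal_mult[symmetric] flip: mult.assoc)
    have "(\<Sum>n. f n x)\<^sup>2 =
        (\<integral>\<^sup>+n. ennreal (sqrt q ^ n) * (ennreal (1 / sqrt q ^ n) * f n x) \<partial>count_space UNIV)\<^sup>2"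
      by (simp only: one nn_integral_count_space_nat)
    also have "\<dots> \<le> (\<integral>\<^sup>+n. (ennreal (sqrt q ^ n))\<^sup>2 \<partial>count_space UNIV) *
        (\<integral>\<^sup>+n. (ennreal (1 / sqrt q ^ n) * f n x)\<^sup>2 \<partial>count_space UNIV)"
      by (rule Cauchy_Schwarz_nn_integral) auto
    also have "(\<integral>\<^sup>+n. (ennreal (sqrt q ^ n))\<^sup>2 \<partial>count_space UNIV) = (\<Sum>n. ennreal (q ^ n))"
      using q by (simp add: nn_integral_count_space_nat ennreal_power sq)
    also have "(\<integral>\<^sup>+n. (ennreal (1 / sqrt q ^ n) * f n x)\<^sup>2 \<partial>count_space UNIV) =
        (\<Sum>n. ennreal (1 / q ^ n) * (f n x)\<^sup>2)"
      using q by (simp add: nn_integral_count_space_nat power_mult_distrib[of "ennreal _"] ennreal_power power_divide sq)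
    finally show ?thesis by (simp only: S)
  qed
  have "sq_norm M (\<lambda>x. \<Sum>n. f n x) \<le>
      (\<integral>\<^sup>+x. ennreal (1 / (1 - q)) * (\<Sum>n. ennreal (1 / q ^ n) * (f n x)\<^sup>2) \<partial>M)"
    unfolding sq_norm_def by (intro nn_integral_mono pt)
  also have "\<dots> = ennreal (1 / (1 - q)) * (\<Sum>n. ennreal (1 / q ^ n) * sq_norm M (f n))"
    unfolding sq_norm_def by (simp add: nn_integral_cmult nn_integral_suminf)
  also have "\<dots> \<le> ennreal (1 / (1 - q)) * (\<Sum>n. ennreal (q ^ n) * D)"
  proof (intro mult_left_mono suminf_le)
    fix n
    have "ennreal (1 / q ^ n) * sq_norm M (f n) \<le> ennreal (1 / q ^ n) * (ennreal ((q ^ n)\<^sup>2) * D)"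
      by (intro mult_left_mono le) auto
    also have "\<dots> = ennreal (q ^ n) * D"
      using q by (simp add: ennreal_mult[symmetric] power2_eq_square flip: mult.assoc)
    finally show "ennreal (1 / q ^ n) * sq_norm M (f n) \<le> ennreal (q ^ n) * D" .
  qed auto
  also have "\<dots> = ennreal ((1 / (1 - q))\<^sup>2) * D"
    using q by (simp add: ennreal_suminf_multc S ennreal_mult[symmetric] power2_eq_square flip: mult.assoc)
  finally show ?thesis .
qed

lemma L2_cmult: "f \<in> L2 M \<Longrightarrow> (\<lambda>x. c * f x) \<in> L2 M"
  by (auto simp: L2_def norm_mult power_mult_distrib)

context sigma_finite_measure
begin

interpretation P: pair_sigma_finite M M ..

lemma kernel_op_L2: "positive_kernel_operator M k \<Longrightarrow> f \<in> L2 M \<Longrightarrow> kernel_op M k f \<in> L2 M"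
  by (simp add: positive_kernel_operator_def kernel_operator_def)

lemma kernel_op_integrable:
  "positive_kernel_operator M k \<Longrightarrow> f \<in> L2 M \<Longrightarrow>
     AE x in M. integrable M (\<lambda>y. complex_of_real (k x y) * f y)"
  by (simp add: positive_kernel_operator_def kernel_operator_def)

lemma L2_diff:
  assumes "f \<in> L2 M" "g \<in> L2 M"
  shows "(\<lambda>x. f x - g x) \<in> L2 M"
proof -
  have [measurable]: "f \<in> borel_measurable M" "g \<in> borel_measurable M"
    using assms by (auto simp: L2_def)
  let ?F = "\<lambda>b x. ennreal (norm (if b then f x else g x))"
  have "sq_norm M (\<lambda>x. ennreal (norm (f x - g x))) \<le> sq_norm M (\<lambda>x. \<Sum>b\<in>UNIV. ?F b x)"
    by (intro sq_norm_mono_AE AE_I2)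
      (simp add: UNIV_bool ennreal_plus[symmetric] ennreal_leI norm_triangle_ineq4 add.commute del: ennreal_plus)
  also have "\<dots> \<le> of_nat (card (UNIV :: bool set)) * (\<Sum>b\<in>UNIV. sq_norm M (?F b))"
    by (rule sq_norm_sum_le) auto
  also have "\<dots> < \<infinity>"
    using assms by (auto simp: UNIV_bool L2_iff_sq_norm ennreal_mult_less_top)
  finally show ?thesis by (simp add: L2_iff_sq_norm)
qed

lemma kernel_op_diff:
  assumes k: "positive_kernel_operator M k" and fg: "f \<in> L2 M" "g \<in> L2 M"
  shows "AE x in M. kernel_op M k (\<lambda>y. f y - g y) x = kernel_op M k f x - kernel_op M k g x"
  using kernel_op_integrable[OF k fg(1)] kernel_op_integrable[OF k fg(2)]
  by eventually_elim (simp add: kernel_op_def right_diff_distrib)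

text \<open>
  Iterating \<open>a u \<le> K u\<close> gives \<open>a\<^sup>n u \<le> K\<^sup>n u\<close>, which is impossible for \<open>u \<noteq> 0\<close> if \<open>a\<close> is larger
  than the growth rate of the powers.
\<close>

lemma subeigenfunction_zero:
  assumes [measurable]: "case_prod k \<in> borel_measurable (M \<Otimes>\<^sub>M M)"
    and gr: "growth M (nn_op M k) c" and c: "0 < c" "c < a"
    and [measurable]: "u \<in> borel_measurable M" and fin: "sq_norm M u < \<infinity>"
    and le: "AE x in M. ennreal a * u x \<le> nn_op M k u x"
  shows "AE x in M. u x = 0"
proof -
  obtain C where C: "\<And>n. L2_bound M (nn_op M k ^^ n) (C * c ^ n)"
    using gr by (auto simp: growth_def)
  have a: "0 < a" using c by simp
  have iter: "AE x in M. ennreal (a ^ n) * u x \<le> (nn_op M k ^^ n) u x" for n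
  proof (induction n)
    case (Suc n)
    from le AE_space show ?case
    proof eventually_elim
      case (elim x)
      have "ennreal (a ^ Suc n) * u x = ennreal (a ^ n) * (ennreal a * u x)"
        using a by (simp add: ennreal_mult mult_ac)
      also have "\<dots> \<le> ennreal (a ^ n) * nn_op M k u x"
        using elim(1) by (rule mult_left_mono) simp
      also have "\<dots> = nn_op M k (\<lambda>y. ennreal (a ^ n) * u y) x"
        using elim(2) by (simp add: nn_op_cmult)
      also have "\<dots> \<le> (nn_op M k ^^ Suc n) u x"
        using Suc.IH by (simp add: nn_op_mono_AE)
      finally show ?case .
    qed
  qed simp
  define s where "s = enn2real (sq_norm M u)"
  have s: "sq_norm M u = ennreal s" "0 \<le> s" using fin by (auto simp: s_def)
  have "s = 0"
  proof (rule ccontr)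
    assume "s \<noteq> 0"
    then have s0: "0 < s" using s by simp
    have "((a / c)\<^sup>2) ^ n \<le> C\<^sup>2" for n
    proof -
      have "ennreal ((a ^ n)\<^sup>2 * s) = sq_norm M (\<lambda>x. ennreal (a ^ n) * u x)"
        using s a by (simp add: sq_norm_cmult ennreal_power ennreal_mult)
      also have "\<dots> \<le> sq_norm M ((nn_op M k ^^ n) u)" by (rule sq_norm_mono_AE[OF iter])
      also have "\<dots> \<le> ennreal ((C * c ^ n)\<^sup>2) * sq_norm M u" by (rule L2_boundD[OF C]) simp
      also have "\<dots> = ennreal ((C * c ^ n)\<^sup>2 * s)" using s by (simp add: ennreal_mult)
      finally have "(a ^ n)\<^sup>2 * s \<le> (C * c ^ n)\<^sup>2 * s" using s by (simp add: ennreal_le_iff)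
      then have "(a ^ n)\<^sup>2 \<le> C\<^sup>2 * (c ^ n)\<^sup>2" using s0 by (simp add: power_mult_distrib)
      then show ?thesis using c by (simp add: power_divide field_simps flip: power_mult)
    qed
    moreover have "1 < (a / c)\<^sup>2" using c by (simp add: power_strict_increasing one_less_power)
    ultimately show False using real_arch_pow[of "(a / c)\<^sup>2" "C\<^sup>2"] by (auto simp: not_less[symmetric])
  qed
  then have "sq_norm M u = 0" using s by simp
  then have "AE x in M. (u x)\<^sup>2 = 0" unfolding sq_norm_def by (subst (asm) nn_integral_0_iff_AE) auto
  then show ?thesis by eventually_elim simp
qed

lemma kernel_op_funpow_L2:
  "positive_kernel_operator M k \<Longrightarrow> g \<in> L2 M \<Longrightarrow> (kernel_op M k ^^ n) g \<in> L2 M"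
  by (induction n) (auto intro: kernel_op_L2)

lemma norm_kernel_op_funpow_le:
  assumes "positive_kernel_operator M k"
  shows "AE x in M. ennreal (norm ((kernel_op M k ^^ n) g x)) \<le>
    (nn_op M k ^^ n) (\<lambda>y. ennreal (norm (g y))) x"
proof (induction n)
  case (Suc n)
  have nn: "AE (x, y) in M \<Otimes>\<^sub>M M. 0 \<le> k x y"
    using assms by (simp add: positive_kernel_operator_def)
  show ?case
    using norm_kernel_op_le[OF nn, of "(kernel_op M k ^^ n) g"]
    by eventually_elim (auto intro: order_trans nn_op_mono_AE[OF Suc.IH])
qed simp

text \<open>
  The solution is the Neumann series \<open>\<Sum> K\<^sup>n g / z\<^bsup>n+1\<^esup>\<close>. It converges absolutely almost everywhere,
  because it is dominated by the same series for \<open>\<bar>g\<bar>\<close> and \<open>\<bar>z\<bar>\<close>, which is in $L^2$; by dominated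
  convergence \<open>K\<close> can be applied to it term by term.
\<close>

lemma Neumann_series_solves:
  assumes k: "positive_kernel_operator M k"
    and gr: "growth M (nn_op M k) c" and c: "0 < c" "c < norm z"
  shows "\<exists>D. \<forall>g\<in>L2 M. \<exists>f\<in>L2 M.
    (AE x in M. z * f x - kernel_op M k f x = g x) \<and> L2_norm M f \<le> D * L2_norm M g"
proof -
  obtain C where C: "\<And>n. L2_bound M (nn_op M k ^^ n) (C * c ^ n)"
    using gr by (auto simp: growth_def)
  have m[measurable]: "case_prod k \<in> borel_measurable (M \<Otimes>\<^sub>M M)"
    and nn: "AE (x, y) in M \<Otimes>\<^sub>M M. 0 \<le> k x y"
    using k by (auto simp: positive_kernel_operator_iff)
  define a where "a = norm z"
  define q where "q = c / a"
  have a: "0 < a" "c < a" "z \<noteq> 0" using c by (auto simp: a_def)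
  have q: "0 < q" "q < 1" using a c by (auto simp: q_def)
  define D where "D = 1 / (1 - q) * (\<bar>C\<bar> / a)"
  have D: "0 \<le> D" using q a by (simp add: D_def)
  show ?thesis
  proof (intro exI ballI)
    fix g assume g: "g \<in> L2 M"
    define g0 where "g0 = (\<lambda>y. ennreal (norm (g y)))"
    have [measurable]: "g \<in> borel_measurable M" using g by (simp add: L2_def)
    have [measurable]: "g0 \<in> borel_measurable M" unfolding g0_def by measurable
    \<comment> \<open>The terms of the series are \<open>u n\<close>, and \<open>p n\<close> are the terms of the dominating series \<open>G\<close>.\<close>
    define v where "v n = (kernel_op M k ^^ n) g" for n
    define w where "w n = (nn_op M k ^^ n) g0" for n
    have vL2: "v n \<in> L2 M" for n unfolding v_def by (rule kernel_op_funpow_L2[OF k g])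
    have [measurable]: "v n \<in> borel_measurable M" for n using vL2 by (simp add: L2_def)
    have [measurable]: "w n \<in> borel_measurable M" for n
      unfolding w_def by (rule nn_op_funpow_measurable) measurable
    have vw: "AE x in M. \<forall>n. ennreal (norm (v n x)) \<le> w n x"
      unfolding v_def w_def g0_def AE_all_countable using norm_kernel_op_funpow_le[OF k] by blast
    define u where "u n x = v n x / z ^ Suc n" for n x
    define p where "p n x = ennreal (1 / a ^ Suc n) * w n x" for n x
    have [measurable]: "u n \<in> borel_measurable M" for n unfolding u_def[abs_def] by measurable
    have [measurable]: "p n \<in> borel_measurable M" for n unfolding p_def[abs_def] by measurable
    have up: "AE x in M. \<forall>n. ennreal (norm (u n x)) \<le> p n x"
      using vw
    proof eventually_elim
      case (elim x)
      show ?case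
      proof
        fix n
        have "ennreal (norm (u n x)) = ennreal (1 / a ^ Suc n) * ennreal (norm (v n x))"
          using a by (simp add: u_def a_def norm_divide norm_mult norm_power ennreal_mult[symmetric])
        also have "\<dots> \<le> p n x" unfolding p_def using elim by (intro mult_left_mono) auto
        finally show "ennreal (norm (u n x)) \<le> p n x" .
      qed
    qed
    define G where "G x = (\<Sum>n. p n x)" for x
    have [measurable]: "G \<in> borel_measurable M" unfolding G_def[abs_def] by measurable
    have "sq_norm M (p n) \<le> ennreal ((q ^ n)\<^sup>2) * (ennreal ((C / a)\<^sup>2) * sq_norm M g0)" for n
    proof -
      have "sq_norm M (p n) = ennreal ((1 / a ^ Suc n)\<^sup>2) * sq_norm M (w n)"
        unfolding p_def using a by (simp add: sq_norm_cmult ennreal_power)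
      also have "\<dots> \<le> ennreal ((1 / a ^ Suc n)\<^sup>2) * (ennreal ((C * c ^ n)\<^sup>2) * sq_norm M g0)"
        unfolding w_def by (intro mult_left_mono L2_boundD[OF C]) auto
      also have "\<dots> = ennreal (((1 / a ^ Suc n)\<^sup>2) * (C * c ^ n)\<^sup>2) * sq_norm M g0"
        by (simp only: ennreal_mult zero_le_power2 mult.assoc)
      also have "((1 / a ^ Suc n)\<^sup>2) * (C * c ^ n)\<^sup>2 = (q ^ n)\<^sup>2 * (C / a)\<^sup>2"
        unfolding power_mult_distrib[symmetric] q_def by (simp add: power_divide mult_ac)
      also have "ennreal ((q ^ n)\<^sup>2 * (C / a)\<^sup>2) * sq_norm M g0 =
          ennreal ((q ^ n)\<^sup>2) * (ennreal ((C / a)\<^sup>2) * sq_norm M g0)"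
        by (simp only: ennreal_mult zero_le_power2 mult.assoc)
      finally show ?thesis .
    qed
    then have "sq_norm M G \<le> ennreal ((1 / (1 - q))\<^sup>2) * (ennreal ((C / a)\<^sup>2) * sq_norm M g0)"
      unfolding G_def using q by (intro sq_norm_suminf_le) auto
    also have "\<dots> = ennreal (D\<^sup>2 * (L2_norm M g)\<^sup>2)"
      unfolding g0_def sq_norm_eq_L2_norm[OF g] D_def
      by (simp add: ennreal_mult[symmetric] power_mult_distrib power_divide mult_ac)
    finally have sqG: "sq_norm M G \<le> ennreal ((D * L2_norm M g)\<^sup>2)" by (simp add: power_mult_distrib)
    then have Gfin: "sq_norm M G < \<infinity>" by (auto intro: le_less_trans)
    have G_AE: "AE x in M. G x < \<infinity>" by (rule sq_norm_finite_AE[OF _ Gfin]) measurable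
    have KG_AE: "AE x in M. nn_op M k G x < \<infinity>"
      by (rule sq_norm_finite_AE[OF _ nn_op_finite_sq_norm[OF k _ Gfin]]) measurable
    have sums: "summable (\<lambda>n. norm (u n x)) \<and> ennreal (\<Sum>n. norm (u n x)) \<le> G x"
      if "\<forall>n. ennreal (norm (u n x)) \<le> p n x" "G x < \<infinity>" for x
    proof -
      have le: "(\<Sum>n. ennreal (norm (u n x))) \<le> G x"
        unfolding G_def using that by (intro suminf_le) auto
      then have "summable (\<lambda>n. norm (u n x))"
        using that by (intro summable_suminf_not_top) (auto simp: top_unique)
      with le show ?thesis by (simp add: suminf_ennreal2)
    qed
    define f where "f x = (\<Sum>n. u n x)" for x
    have fm[measurable]: "f \<in> borel_measurable M" unfolding f_def[abs_def] by measurable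
    have fG: "AE x in M. ennreal (norm (f x)) \<le> G x"
      using up G_AE
    proof eventually_elim
      case (elim x)
      have "norm (f x) \<le> (\<Sum>n. norm (u n x))"
        unfolding f_def using sums[OF elim] by (intro summable_norm) auto
      then show ?case using sums[OF elim] by (meson ennreal_leI order_trans)
    qed
    have sqf: "sq_norm M (\<lambda>x. ennreal (norm (f x))) \<le> ennreal ((D * L2_norm M g)\<^sup>2)"
      using sq_norm_mono_AE[OF fG] sqG by (rule order_trans)
    then have fL2: "f \<in> L2 M" by (auto simp: L2_iff_sq_norm intro: le_less_trans)
    have "L2_norm M f \<le> D * L2_norm M g"
      using sqf D L2_norm_nonneg[of M g] by (subst L2_norm_le_iff[OF fL2]) auto
    moreover have "AE x in M. z * f x - kernel_op M k f x = g x"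
    proof -
      have int_v: "AE x in M. \<forall>n. integrable M (\<lambda>y. complex_of_real (k x y) * v n y)"
        unfolding AE_all_countable using kernel_op_integrable[OF k vL2] by blast
      from up G_AE KG_AE int_v AE_kernel_slice[OF nn] AE_space
      show ?thesis
      proof eventually_elim
        case (elim x)
        have [measurable]: "k x \<in> borel_measurable M"
          using measurable_Pair2[OF m elim(6)] by simp
        let ?h = "\<lambda>n y. complex_of_real (k x y) * u n y"
        have int_u: "integrable M (?h n)" for n
          using elim(4) by (simp add: u_def)
        have sum1: "AE y in M. summable (\<lambda>n. norm (?h n y))"
          using up G_AE
        proof eventually_elim
          case (elim y)
          then have "summable (\<lambda>n. norm (complex_of_real (k x y)) * norm (u n y))"
            using sums[of y] by (intro summable_mult) blast
          then show ?case by (simp only: norm_mult)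
        qed
        have hn: "ennreal (\<integral>y. norm (?h n y) \<partial>M) \<le> nn_op M k (p n) x" for n
        proof -
          have "ennreal (\<integral>y. norm (?h n y) \<partial>M) = (\<integral>\<^sup>+y. ennreal (norm (?h n y)) \<partial>M)"
            using int_u by (subst nn_integral_eq_integral) auto
          also have "\<dots> = nn_op M k (\<lambda>y. ennreal (norm (u n y))) x"
            by (rule nn_op_norm_eq[of k x, OF elim(5), symmetric])
          also have "\<dots> \<le> nn_op M k (p n) x"
            by (rule nn_op_mono_AE) (use up in eventually_elim, auto)
          finally show ?thesis .
        qed
        have "(\<Sum>n. ennreal (\<integral>y. norm (?h n y) \<partial>M)) \<le> (\<Sum>n. nn_op M k (p n) x)"
          using hn by (intro suminf_le) auto
        also have "\<dots> = nn_op M k G x"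
          unfolding G_def[abs_def] using elim(6) by (simp add: nn_op_suminf)
        finally have sum2: "summable (\<lambda>n. \<integral>y. norm (?h n y) \<partial>M)"
          using elim(3) by (intro summable_suminf_not_top) (auto simp: top_unique)
        have "kernel_op M k f x = (\<integral>y. (\<Sum>n. ?h n y) \<partial>M)"
          unfolding kernel_op_def
        proof (rule integral_cong_AE)
          show "AE y in M. complex_of_real (k x y) * f y = (\<Sum>n. ?h n y)"
            using up G_AE
          proof eventually_elim
            case (elim y)
            have "summable (\<lambda>n. u n y)"
              by (rule summable_norm_cancel) (rule sums[OF elim, THEN conjunct1])
            then show ?case unfolding f_def by (rule suminf_mult[symmetric])
          qed
        qed measurable
        also have "\<dots> = (\<Sum>n. \<integral>y. ?h n y \<partial>M)"
          by (rule integral_suminf[OF int_u sum1 sum2])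
        also have "\<dots> = (\<Sum>n. v (Suc n) x / z ^ Suc n)"
          by (simp add: u_def v_def kernel_op_def)
        finally have Kf: "kernel_op M k f x = (\<Sum>n. v (Suc n) x / z ^ Suc n)" .
        have su: "summable (\<lambda>n. u n x)"
          using sums[OF elim(1,2)] by (auto intro: summable_norm_cancel)
        have zu: "z * u n x = v n x / z ^ n" for n using a by (simp add: u_def)
        have sv: "summable (\<lambda>n. v n x / z ^ n)"
          using summable_mult[OF su, of z] by (simp add: zu)
        have "z * f x = (\<Sum>n. v n x / z ^ n)"
          unfolding f_def using suminf_mult[OF su, of z] by (simp add: zu)
        also have "\<dots> = g x + (\<Sum>n. v (Suc n) x / z ^ Suc n)"
          using suminf_split_head[OF sv] by (simp add: v_def)
        finally show ?case using Kf by simp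
      qed
    qed
    ultimately show "\<exists>f\<in>L2 M. (AE x in M. z * f x - kernel_op M k f x = g x) \<and>
        L2_norm M f \<le> D * L2_norm M g"
      using fL2 by blast
  qed
qed

text \<open>
  If \<open>c < \<bar>z\<bar>\<close> then \<open>z - K\<close> is injective, since \<open>K h = z h\<close> implies \<open>\<bar>z\<bar> \<bar>h\<bar> \<le> K \<bar>h\<bar>\<close>, and the
  Neumann series gives bounded solutions.
\<close>

lemma spectrum_norm_le:
  assumes k: "positive_kernel_operator M k"
    and gr: "growth M (nn_op M k) c" and c: "0 < c" and z: "z \<in> spectrum M (kernel_op M k)"
  shows "norm z \<le> c"
proof (rule ccontr)
  assume "\<not> norm z \<le> c"
  then have cz: "c < norm z" by simp
  have m[measurable]: "case_prod k \<in> borel_measurable (M \<Otimes>\<^sub>M M)"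
    and nn: "AE (x, y) in M \<Otimes>\<^sub>M M. 0 \<le> k x y"
    using k by (auto simp: positive_kernel_operator_iff)
  have "AE x in M. f x = g x"
    if f: "f \<in> L2 M" and g: "g \<in> L2 M"
      and eq: "AE x in M. z * f x - kernel_op M k f x = z * g x - kernel_op M k g x" for f g
  proof -
    define h where "h = (\<lambda>x. f x - g x)"
    have h: "h \<in> L2 M" unfolding h_def by (rule L2_diff[OF f g])
    have "AE x in M. z * h x = kernel_op M k h x"
      using eq kernel_op_diff[OF k f g] unfolding h_def
    proof eventually_elim
      case (elim x)
      have "z * f x - z * g x = kernel_op M k f x - kernel_op M k g x"
        using elim(1) by (simp add: algebra_simps)
      then show ?case using elim(2) by (simp add: right_diff_distrib)
    qed
    then have "AE x in M. ennreal (norm z) * ennreal (norm (h x)) \<le> nn_op M k (\<lambda>y. ennreal (norm (h y))) x"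
      using norm_kernel_op_le[OF nn, of h]
      by eventually_elim (simp add: ennreal_mult[symmetric] norm_mult[symmetric])
    then have "AE x in M. ennreal (norm (h x)) = 0"
      using h by (intro subeigenfunction_zero[OF m gr c cz]) (auto simp: L2_iff_sq_norm)
    then show ?thesis by eventually_elim (simp add: h_def)
  qed
  then have "invertible_on_L2 M (\<lambda>f x. z * f x - kernel_op M k f x)"
    using Neumann_series_solves[OF k gr c cz] unfolding invertible_on_L2_def by blast
  then show False using z by (simp add: spectrum_def)
qed

lemma kernel_radius_nonneg_if_growth:
  assumes "positive_kernel_operator M k" "growth M (nn_op M k) c" "0 < c"
  shows "0 \<le> kernel_radius M k"
proof -
  have "bdd_above (insert 0 (norm ` spectrum M (kernel_op M k)))"
    using spectrum_norm_le[OF assms] assms(3) by (intro bdd_aboveI[of _ c]) auto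
  then show ?thesis unfolding kernel_radius_def spectral_radius_def by (intro cSup_upper) auto
qed

text \<open>
  One half of Gelfand's formula.
\<close>

lemma kernel_radius_le_growth_rate:
  assumes "positive_kernel_operator M k" "growth M (nn_op M k) c" "0 < c"
  shows "kernel_radius M k \<le> c"
  unfolding kernel_radius_def spectral_radius_def
  using spectrum_norm_le[OF assms] assms(3) by (intro cSup_least) auto

end

section \<open>The growth rate of the powers lies in the spectrum\<close>

text \<open>
  The Neumann series of \<open>(l - K)\<^sup>-\<^sup>1\<close>, truncated after \<open>N\<close> terms.
\<close>

definition nn_resolvent ::
    "'a measure \<Rightarrow> ('a \<Rightarrow> 'a \<Rightarrow> real) \<Rightarrow> real \<Rightarrow> nat \<Rightarrow> ('a \<Rightarrow> ennreal) \<Rightarrow> 'a \<Rightarrow> ennreal" where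
  "nn_resolvent M k l N f x = (\<Sum>n<N. ennreal (1 / l ^ Suc n) * (nn_op M k ^^ n) f x)"

context sigma_finite_measure
begin

interpretation P: pair_sigma_finite M M ..

lemma nn_resolvent_measurable:
  assumes "case_prod k \<in> borel_measurable (M \<Otimes>\<^sub>M M)" "f \<in> borel_measurable M"
  shows "nn_resolvent M k l N f \<in> borel_measurable M"
proof -
  note [measurable] = nn_op_funpow_measurable[OF assms]
  show ?thesis unfolding nn_resolvent_def[abs_def] by measurable
qed

lemma nn_resolvent_telescope:
  assumes k: "case_prod k \<in> borel_measurable (M \<Otimes>\<^sub>M M)" and f: "f \<in> borel_measurable M"
    and l: "0 < l" and x: "x \<in> space M"
  shows "ennreal l * nn_resolvent M k l N f x + ennreal (1 / l ^ N) * (nn_op M k ^^ N) f x =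
    f x + nn_op M k (nn_resolvent M k l N f) x"
proof -
  note [measurable] = k f nn_op_funpow_measurable[OF k f]
  let ?t = "\<lambda>n. ennreal (1 / l ^ n) * (nn_op M k ^^ n) f x"
  have "ennreal l * nn_resolvent M k l N f x = (\<Sum>n<N. ?t n)"
    unfolding nn_resolvent_def sum_distrib_left using l
    by (intro sum.cong) (auto simp: ennreal_mult[symmetric] simp flip: mult.assoc)
  moreover have "nn_op M k (nn_resolvent M k l N f) x = (\<Sum>n<N. ?t (Suc n))"
    unfolding nn_resolvent_def[abs_def] using x
    by (subst nn_op_sum) (auto simp: nn_op_cmult intro!: sum.cong)
  moreover have "(\<Sum>n<N. ?t n) + ?t N = ?t 0 + (\<Sum>n<N. ?t (Suc n))"
    using sum.lessThan_Suc[of ?t N] sum.lessThan_Suc_shift[of ?t N] by (simp only:)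
  ultimately show ?thesis by simp
qed

lemma nn_op_funpow_mono:
  assumes "\<And>x. x \<in> space M \<Longrightarrow> f x \<le> g x" "x \<in> space M"
  shows "(nn_op M k ^^ n) f x \<le> (nn_op M k ^^ n) g x"
  using assms(2)
proof (induction n arbitrary: x)
  case (Suc n)
  then show ?case by (auto intro!: nn_op_mono_AE AE_I2)
qed (simp add: assms)

lemma nn_op_funpow_cmult:
  assumes k: "case_prod k \<in> borel_measurable (M \<Otimes>\<^sub>M M)" and f: "f \<in> borel_measurable M"
    and x: "x \<in> space M"
  shows "(nn_op M k ^^ n) (\<lambda>y. c * f y) x = c * (nn_op M k ^^ n) f x"
  using x
proof (induction n arbitrary: x)
  case (Suc n)
  have "(nn_op M k ^^ Suc n) (\<lambda>y. c * f y) x = nn_op M k (\<lambda>y. c * (nn_op M k ^^ n) f y) x"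
    using Suc.IH by (simp, intro nn_op_cong_AE AE_I2)
  also have "\<dots> = c * (nn_op M k ^^ Suc n) f x"
    using nn_op_cmult[OF k nn_op_funpow_measurable[OF k f] Suc.prems] by simp
  finally show ?case .
qed simp

text \<open>
  There are \<open>n + 1\<close> ways to write \<open>K\<^sup>n\<close> as \<open>K\<^sup>i K\<^sup>j\<close>, and each pair occurs in the square of the
  truncated series.
\<close>

lemma nn_resolvent_square_ge:
  assumes k: "case_prod k \<in> borel_measurable (M \<Otimes>\<^sub>M M)" and f: "f \<in> borel_measurable M"
    and l: "0 < l" and x: "x \<in> space M" and "n < N"
  shows "ennreal (real (Suc n) / l ^ (n + 2)) * (nn_op M k ^^ n) f x \<le>
    nn_resolvent M k l N (nn_resolvent M k l N f) x"
proof -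
  let ?R = "nn_resolvent M k l N"
  have "ennreal (1 / l ^ (n + 2)) * (nn_op M k ^^ n) f x \<le>
      ennreal (1 / l ^ Suc i) * (nn_op M k ^^ i) (?R f) x" if "i \<le> n" for i
  proof -
    define j where "j = n - i"
    have n: "n = i + j" using that by (simp add: j_def)
    have "ennreal (1 / l ^ (n + 2)) * (nn_op M k ^^ n) f x =
        ennreal (1 / l ^ Suc i) * (ennreal (1 / l ^ Suc j) * (nn_op M k ^^ i) ((nn_op M k ^^ j) f) x)"
    proof -
      have "1 / l ^ (n + 2) = 1 / l ^ Suc i * (1 / l ^ Suc j)" by (simp add: n power_add)
      then have "ennreal (1 / l ^ (n + 2)) = ennreal (1 / l ^ Suc i) * ennreal (1 / l ^ Suc j)"
        using l by (simp only:) (rule ennreal_mult, auto)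
      then show ?thesis by (simp only: n funpow_add o_apply mult.assoc)
    qed
    also have "\<dots> = ennreal (1 / l ^ Suc i) *
        (nn_op M k ^^ i) (\<lambda>y. ennreal (1 / l ^ Suc j) * (nn_op M k ^^ j) f y) x"
      by (subst nn_op_funpow_cmult[OF k nn_op_funpow_measurable[OF k f] x]) simp
    also have "\<dots> \<le> ennreal (1 / l ^ Suc i) * (nn_op M k ^^ i) (?R f) x"
    proof (intro mult_left_mono nn_op_funpow_mono x)
      fix y
      show "ennreal (1 / l ^ Suc j) * (nn_op M k ^^ j) f y \<le> ?R f y"
        unfolding nn_resolvent_def using assms(5) n by (intro member_le_sum) auto
    qed simp
    finally show ?thesis .
  qed
  then have "(\<Sum>i\<le>n. ennreal (1 / l ^ (n + 2)) * (nn_op M k ^^ n) f x) \<le>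
      (\<Sum>i\<le>n. ennreal (1 / l ^ Suc i) * (nn_op M k ^^ i) (?R f) x)"
    by (intro sum_mono) auto
  also have "\<dots> \<le> ?R (?R f) x"
    unfolding nn_resolvent_def[of M k l N "?R f"] using assms(5) by (intro sum_mono2) auto
  also have "(\<Sum>i\<le>n. ennreal (1 / l ^ (n + 2)) * (nn_op M k ^^ n) f x) =
      ennreal (real (Suc n) / l ^ (n + 2)) * (nn_op M k ^^ n) f x"
  proof -
    have "ennreal (real (Suc n) / l ^ (n + 2)) = of_nat (Suc n) * ennreal (1 / l ^ (n + 2))"
      using l by (simp add: ennreal_of_nat_eq_real_of_nat ennreal_mult[symmetric] del: of_nat_Suc)
    then show ?thesis by (simp add: mult.assoc del: of_nat_Suc)
  qed
  finally show ?thesis .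
qed

text \<open>
  For the truncated series \<open>S\<close> one has \<open>(r - K) S f = f - l\<^bsup>-N\<^esup> K\<^sup>N f - (l - r) S f\<close>. The second
  term is at most \<open>\<parallel>f\<parallel>\<close> for large \<open>N\<close>, and the third one can be absorbed into the left-hand side if
  \<open>l\<close> is close to \<open>r\<close>, because \<open>r - K\<close> is bounded below by \<open>1/C\<close>. The bound for large \<open>N\<close> implies
  the one for all \<open>N\<close>, since the terms of the series are nonnegative. What matters is that the bound
  \<open>4 C\<close> does not depend on \<open>l\<close> and \<open>N\<close>.
\<close>

lemma nn_resolvent_bound:
  assumes k: "positive_kernel_operator M k"
    and r: "0 < r" and gr: "growth M (nn_op M k) c" and c: "0 < c" "c < l" and l: "r < l"
    and C: "0 < C" "\<And>h. h \<in> L2 M \<Longrightarrow>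
      L2_norm M h \<le> C * L2_norm M (\<lambda>x. complex_of_real r * h x - kernel_op M k h x)"
    and near: "6 * C\<^sup>2 * (l - r)\<^sup>2 \<le> 1"
  shows "L2_bound M (nn_resolvent M k l N) (4 * C)"
  unfolding L2_bound_def
proof
  fix f :: "'a \<Rightarrow> ennreal" assume f[measurable]: "f \<in> borel_measurable M"
  have m[measurable]: "case_prod k \<in> borel_measurable (M \<Otimes>\<^sub>M M)"
    and nn: "AE (x, y) in M \<Otimes>\<^sub>M M. 0 \<le> k x y"
    using k by (auto simp: positive_kernel_operator_iff)
  note [measurable] = nn_op_funpow_measurable[OF m f]
  obtain A where A: "\<And>n. L2_bound M (nn_op M k ^^ n) (A * c ^ n)"
    using gr by (auto simp: growth_def)
  have l0: "0 < l" using r l by simp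
  show "sq_norm M (nn_resolvent M k l N f) \<le> ennreal ((4 * C)\<^sup>2) * sq_norm M f"
  proof (cases "sq_norm M f < \<infinity>")
    case False
    then have "sq_norm M f = top" by (simp add: less_top[symmetric])
    then show ?thesis using C by (simp add: ennreal_mult_top)
  next
    case fin: True
    have "(\<lambda>n. \<bar>A\<bar> * (c / l) ^ n) \<longlonglongrightarrow> \<bar>A\<bar> * 0"
      using c by (intro tendsto_intros LIMSEQ_realpow_zero) auto
    then have "eventually (\<lambda>n. \<bar>A\<bar> * (c / l) ^ n < 1) sequentially"
      by (rule order_tendstoD) simp
    \<comment> \<open>From here on the truncation error \<open>l\<^bsup>-N'\<^esup> K\<^bsup>N'\<^esup> f\<close> has norm at most \<open>\<parallel>f\<parallel>\<close>.\<close>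
    then obtain N' where N': "N \<le> N'" "\<bar>A\<bar> * (c / l) ^ N' < 1"
      unfolding eventually_sequentially by (meson nat_le_linear order_refl le_trans)
    let ?S = "nn_resolvent M k l N' f"
    let ?r = "\<lambda>x. ennreal (1 / l ^ N') * (nn_op M k ^^ N') f x"
    have Sm[measurable]: "?S \<in> borel_measurable M" by (rule nn_resolvent_measurable[OF m f])
    have pow_fin: "sq_norm M ((nn_op M k ^^ n) f) < \<infinity>" for n
      using L2_boundD[OF A f, of n] fin by (auto intro: le_less_trans simp: ennreal_mult_less_top)
    have r_le: "sq_norm M ?r \<le> sq_norm M f"
    proof -
      have "sq_norm M ?r = ennreal ((1 / l ^ N')\<^sup>2) * sq_norm M ((nn_op M k ^^ N') f)"
        using l0 by (simp add: sq_norm_cmult ennreal_power)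
      also have "\<dots> \<le> ennreal ((1 / l ^ N')\<^sup>2) * (ennreal ((A * c ^ N')\<^sup>2) * sq_norm M f)"
        by (intro mult_left_mono L2_boundD[OF A]) auto
      also have "\<dots> = ennreal ((A * (c / l) ^ N')\<^sup>2) * sq_norm M f"
        unfolding mult.assoc[symmetric] ennreal_mult[OF zero_le_power2 zero_le_power2, symmetric]
          power_mult_distrib[symmetric] by (simp add: power_divide)
      also have "\<dots> \<le> ennreal 1 * sq_norm M f"
      proof (intro mult_right_mono ennreal_leI)
        have "\<bar>A * (c / l) ^ N'\<bar> \<le> 1" using N' c l0 by (simp add: abs_mult power_abs)
        then show "(A * (c / l) ^ N')\<^sup>2 \<le> 1" by (simp add: abs_square_le_1)
      qed simp
      finally show ?thesis by simp
    qed
    have S_fin: "sq_norm M ?S < \<infinity>"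
    proof -
      have "sq_norm M ?S \<le> of_nat (card {..<N'}) *
          (\<Sum>n<N'. sq_norm M (\<lambda>x. ennreal (1 / l ^ Suc n) * (nn_op M k ^^ n) f x))"
        unfolding nn_resolvent_def[abs_def] by (rule sq_norm_sum_le) auto
      also have "\<dots> < \<infinity>"
        using pow_fin
        by (simp add: sq_norm_cmult ennreal_mult_less_top power_less_top_ennreal of_nat_less_top)
      finally show ?thesis .
    qed
    define h where "h = complex_rep ?S"
    have h: "h \<in> L2 M" and hS: "AE x in M. ennreal (norm (h x)) = ?S x"
      unfolding h_def using complex_rep_L2[OF Sm S_fin] by auto
    define d where "d x = complex_of_real r * h x - kernel_op M k h x" for x
    let ?F = "\<lambda>i::nat. if i = 0 then f else if i = 1 then ?r else (\<lambda>x. ennreal (l - r) * ?S x)"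
    have pow_AE: "AE x in M. (nn_op M k ^^ N') f x < \<infinity>"
      by (rule sq_norm_finite_AE[OF _ pow_fin]) measurable
    have KS_AE: "AE x in M. nn_op M k ?S x < \<infinity>"
      by (rule sq_norm_finite_AE[OF _ nn_op_finite_sq_norm[OF k Sm S_fin]]) measurable
    \<comment> \<open>All quantities are finite almost everywhere, so the telescoping identity can be solved
      for \<open>(r - K) S f\<close> in the reals.\<close>
    have "AE x in M. ennreal (norm (d x)) \<le> (\<Sum>i<3. ?F i x)"
      using sq_norm_finite_AE[OF f fin] pow_AE sq_norm_finite_AE[OF Sm S_fin] KS_AE
        kernel_op_complex_rep[OF m nn Sm S_fin] AE_space
    proof (eventually_elim)
      case (elim x)
      define s where "s = enn2real (?S x)"
      define t where "t = enn2real (nn_op M k ?S x)"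
      define p where "p = enn2real (f x)"
      define w where "w = enn2real ((nn_op M k ^^ N') f x)"
      have eq: "?S x = ennreal s" "nn_op M k ?S x = ennreal t" "f x = ennreal p"
          "(nn_op M k ^^ N') f x = ennreal w" and pos: "0 \<le> s" "0 \<le> t" "0 \<le> p" "0 \<le> w"
        using elim by (auto simp: s_def t_def p_def w_def)
      have "ennreal (l * s + 1 / l ^ N' * w) = ennreal (p + t)"
        using nn_resolvent_telescope[OF m f l0 elim(6), of N'] pos l0
        unfolding eq by (simp add: ennreal_mult[symmetric])
      then have tel: "l * s + 1 / l ^ N' * w = p + t" using pos l0 by (subst (asm) ennreal_inj) auto
      have "d x = complex_of_real (r * s - t)"
        using elim(5) by (simp add: d_def h_def complex_rep_def s_def t_def)
      then have "norm (d x) = \<bar>r * s - t\<bar>" by (simp only: norm_of_real)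
      also have "\<dots> \<le> p + 1 / l ^ N' * w + (l - r) * s"
      proof -
        have "r * s - t = p - 1 / l ^ N' * w - (l - r) * s" using tel by (simp add: algebra_simps)
        moreover have "0 \<le> 1 / l ^ N' * w" "0 \<le> (l - r) * s" using pos l0 l by auto
        ultimately show ?thesis using pos by linarith
      qed
      finally have "ennreal (norm (d x)) \<le> ennreal (p + 1 / l ^ N' * w + (l - r) * s)"
        by (rule ennreal_leI)
      also have "\<dots> = (\<Sum>i<3. ?F i x)"
        using pos l l0 by (simp add: numeral_3_eq_3 eq ennreal_mult[symmetric] ennreal_plus[symmetric] del: ennreal_plus)
      finally show ?case .
    qed
    then have "sq_norm M (\<lambda>x. ennreal (norm (d x))) \<le> sq_norm M (\<lambda>x. \<Sum>i<3. ?F i x)"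
      by (rule sq_norm_mono_AE)
    also have "\<dots> \<le> of_nat (card {..<3::nat}) * (\<Sum>i<3. sq_norm M (?F i))"
      by (rule sq_norm_sum_le) auto
    also have "\<dots> = 3 * (sq_norm M f + sq_norm M ?r + ennreal ((l - r)\<^sup>2) * sq_norm M ?S)"
      using l sq_norm_cmult[OF Sm, of "ennreal (l - r)"]
      by (simp add: numeral_3_eq_3 ennreal_power add.assoc)
    also have "\<dots> \<le> 3 * (sq_norm M f + sq_norm M f + ennreal ((l - r)\<^sup>2) * sq_norm M ?S)"
      by (intro mult_left_mono add_right_mono add_left_mono r_le) simp
    finally have sqd: "sq_norm M (\<lambda>x. ennreal (norm (d x))) \<le>
        3 * (sq_norm M f + sq_norm M f + ennreal ((l - r)\<^sup>2) * sq_norm M ?S)" .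
    define X where "X = enn2real (sq_norm M ?S)"
    define Y where "Y = enn2real (sq_norm M f)"
    have XY: "sq_norm M ?S = ennreal X" "sq_norm M f = ennreal Y" "0 \<le> X" "0 \<le> Y"
      using S_fin fin by (auto simp: X_def Y_def)
    have dL2: "d \<in> L2 M"
      unfolding d_def[abs_def] by (intro L2_diff L2_cmult kernel_op_L2[OF k] h)
    have "ennreal ((L2_norm M d)\<^sup>2) \<le> ennreal (3 * (Y + Y + (l - r)\<^sup>2 * X))"
    proof -
      have "ennreal (3 * (Y + Y + (l - r)\<^sup>2 * X)) = ennreal 3 * ennreal (Y + Y + (l - r)\<^sup>2 * X)"
        using XY by (intro ennreal_mult) auto
      also have "ennreal (Y + Y + (l - r)\<^sup>2 * X) = ennreal Y + ennreal Y + ennreal ((l - r)\<^sup>2) * ennreal X"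
        using XY by (simp only: ennreal_plus ennreal_mult zero_le_power2 add_nonneg_nonneg mult_nonneg_nonneg)
      finally show ?thesis using sqd XY unfolding sq_norm_eq_L2_norm[OF dL2] by simp
    qed
    then have nd: "(L2_norm M d)\<^sup>2 \<le> 3 * (Y + Y + (l - r)\<^sup>2 * X)"
      using XY by (subst (asm) ennreal_le_iff) auto
    have "ennreal X = ennreal ((L2_norm M h)\<^sup>2)"
      using sq_norm_eq_L2_norm[OF h] sq_norm_cong_AE[OF hS] XY by simp
    then have "X = (L2_norm M h)\<^sup>2" using XY by simp
    also have "\<dots> \<le> (C * L2_norm M d)\<^sup>2"
      using C(2)[OF h] L2_norm_nonneg by (intro power_mono) (auto simp: d_def[abs_def])
    also have "\<dots> \<le> C\<^sup>2 * (3 * (Y + Y + (l - r)\<^sup>2 * X))"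
      unfolding power_mult_distrib using nd by (intro mult_left_mono) auto
    also have "\<dots> = 6 * C\<^sup>2 * Y + (6 * C\<^sup>2 * (l - r)\<^sup>2) * X / 2" by (simp add: algebra_simps)
    also have "\<dots> \<le> 6 * C\<^sup>2 * Y + 1 * X / 2"
      using near XY by (intro add_left_mono divide_right_mono mult_right_mono) auto
    finally have "X \<le> 12 * C\<^sup>2 * Y" by simp
    also have "\<dots> \<le> (4 * C)\<^sup>2 * Y" using XY by (simp add: power_mult_distrib mult_right_mono)
    finally have "sq_norm M ?S \<le> ennreal ((4 * C)\<^sup>2) * sq_norm M f"
      using XY by (simp add: ennreal_mult[symmetric] ennreal_leI)
    moreover have "sq_norm M (nn_resolvent M k l N f) \<le> sq_norm M ?S"
      by (intro sq_norm_mono_AE AE_I2) (auto simp: nn_resolvent_def N' intro!: sum_mono2)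
    ultimately show ?thesis by (rule order_trans[rotated])
  qed
qed

text \<open>
  If \<open>r - K\<close> were invertible, with an inverse bounded by \<open>C\<close>, the squares of the truncated Neumann
  series at points \<open>l\<close> just above \<open>r\<close> would be bounded by \<open>16 C\<^sup>2\<close>, so that \<open>(n + 1) \<parallel>K\<^sup>n\<parallel> \<le> 16 C\<^sup>2 l\<^bsup>n+2\<^esup>\<close> for all \<open>l\<close> close to \<open>r\<close>. For large \<open>n\<close> this
  gives \<open>\<parallel>K\<^sup>n\<parallel> \<le> r\<^sup>n / 2\<close>, and then the powers grow at a rate smaller than \<open>r\<close>.
\<close>

lemma growth_rate_in_spectrum:
  assumes k: "positive_kernel_operator M k" and r: "0 < r"
    and above: "\<And>c. r < c \<Longrightarrow> growth M (nn_op M k) c"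
    and below: "\<And>c. 0 < c \<Longrightarrow> c < r \<Longrightarrow> \<not> growth M (nn_op M k) c"
  shows "complex_of_real r \<in> spectrum M (kernel_op M k)"
proof (rule ccontr)
  have m[measurable]: "case_prod k \<in> borel_measurable (M \<Otimes>\<^sub>M M)"
    using k by (auto simp: positive_kernel_operator_iff)
  assume "complex_of_real r \<notin> spectrum M (kernel_op M k)"
  then have inv: "invertible_on_L2 M (\<lambda>f x. complex_of_real r * f x - kernel_op M k f x)"
    by (simp add: spectrum_def)
  let ?T = "\<lambda>f x. complex_of_real r * f x - kernel_op M k f x"
  obtain C0 where inj: "\<And>f g. f \<in> L2 M \<Longrightarrow> g \<in> L2 M \<Longrightarrow> AE x in M. ?T f x = ?T g x \<Longrightarrow> AE x in M. f x = g x"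
    and C0: "\<And>g. g \<in> L2 M \<Longrightarrow> \<exists>f\<in>L2 M. (AE x in M. ?T f x = g x) \<and> L2_norm M f \<le> C0 * L2_norm M g"
    using inv unfolding invertible_on_L2_def by blast
  define C where "C = max 1 C0"
  have C: "L2_norm M h \<le> C * L2_norm M (?T h)" if h: "h \<in> L2 M" for h
  proof -
    have "?T h \<in> L2 M" by (intro L2_diff L2_cmult kernel_op_L2[OF k] h)
    then obtain f where f: "f \<in> L2 M" "AE x in M. ?T f x = ?T h x"
        "L2_norm M f \<le> C0 * L2_norm M (?T h)"
      using C0 by blast
    have "AE x in M. f x = h x" by (rule inj) fact+
    then have "L2_norm M f = L2_norm M h"
      using f(1) h unfolding L2_norm_def by (intro arg_cong[of _ _ sqrt] integral_cong_AE) (auto simp: L2_def)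
    moreover have "C0 * L2_norm M (?T h) \<le> C * L2_norm M (?T h)"
      by (intro mult_right_mono L2_norm_nonneg) (simp add: C_def)
    ultimately show ?thesis using f(3) by simp
  qed
  have C1: "1 \<le> C" by (simp add: C_def)
  obtain n :: nat where n: "4 * (16 * C\<^sup>2) * r\<^sup>2 < real n" using reals_Archimedean2 by blast
  moreover have "0 \<le> 4 * (16 * C\<^sup>2) * r\<^sup>2" by simp
  ultimately have n0: "0 < n" by linarith
  \<comment> \<open>The first bound keeps \<open>l\<close> in the range of the uniform estimate, the second one ensures
    \<open>l\<^bsup>n+2\<^esup> \<le> 2 r\<^bsup>n+2\<^esup>\<close>.\<close>
  define l where "l = min (r + 1 / (3 * C)) (root (n + 2) 2 * r)"
  have rl: "r < l" using r C1 by (simp add: l_def)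
  have ln: "l ^ (n + 2) \<le> 2 * r ^ (n + 2)"
  proof -
    have "l ^ (n + 2) \<le> (root (n + 2) 2 * r) ^ (n + 2)"
      using r rl by (intro power_mono) (auto simp: l_def)
    also have "\<dots> = root (n + 2) 2 ^ (n + 2) * r ^ (n + 2)" by (rule power_mult_distrib)
    also have "root (n + 2) 2 ^ (n + 2) = (2::real)" by (rule real_root_pow_pos2) auto
    finally show ?thesis .
  qed
  have near: "6 * C\<^sup>2 * (l - r)\<^sup>2 \<le> 1"
  proof -
    have "(l - r)\<^sup>2 \<le> (1 / (3 * C))\<^sup>2"
      using rl by (intro power_mono) (auto simp: l_def)
    then have "6 * C\<^sup>2 * (l - r)\<^sup>2 \<le> 6 * C\<^sup>2 * (1 / (3 * C))\<^sup>2" by (intro mult_left_mono) auto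
    also have "\<dots> \<le> 1" using C1 by (simp add: power_divide power_mult_distrib)
    finally show ?thesis .
  qed
  define c where "c = (r + l) / 2"
  have c: "r < c" "c < l" "0 < c" using rl r by (auto simp: c_def)
  have l0: "0 < l" using r rl by simp
  have "L2_bound M (nn_resolvent M k l (Suc n)) (4 * C)"
    using C1 by (intro nn_resolvent_bound[OF k r above[OF c(1)] c(3) c(2) rl _ C near]) auto
  then have RR: "L2_bound M (nn_resolvent M k l (Suc n) \<circ> nn_resolvent M k l (Suc n)) ((4 * C) * (4 * C))"
    using nn_resolvent_measurable[OF m] by (intro L2_bound_comp)
  have half: "L2_bound M (nn_op M k ^^ n) (r ^ n / 2)"
    unfolding L2_bound_def
  proof
    fix f :: "'a \<Rightarrow> ennreal" assume f[measurable]: "f \<in> borel_measurable M"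
    note [measurable] = nn_op_funpow_measurable[OF m f]
    define a where "a = real (Suc n) / l ^ (n + 2)"
    have a: "0 < a" using l0 by (simp add: a_def)
    have "ennreal (a\<^sup>2) * sq_norm M ((nn_op M k ^^ n) f) = sq_norm M (\<lambda>x. ennreal a * (nn_op M k ^^ n) f x)"
      using a by (simp add: sq_norm_cmult ennreal_power)
    also have "\<dots> \<le> sq_norm M (nn_resolvent M k l (Suc n) (nn_resolvent M k l (Suc n) f))"
      unfolding a_def by (intro sq_norm_mono_AE AE_I2 nn_resolvent_square_ge[OF m f l0]) auto
    also have "\<dots> \<le> ennreal (((4 * C) * (4 * C))\<^sup>2) * sq_norm M f"
      using L2_boundD[OF RR f] by simp
    finally have *: "ennreal (a\<^sup>2) * sq_norm M ((nn_op M k ^^ n) f) \<le>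
        ennreal (((4 * C) * (4 * C))\<^sup>2) * sq_norm M f" .
    have "sq_norm M ((nn_op M k ^^ n) f) = ennreal (1 / a\<^sup>2) * (ennreal (a\<^sup>2) * sq_norm M ((nn_op M k ^^ n) f))"
      using a by (simp add: ennreal_mult[symmetric] flip: mult.assoc)
    also have "\<dots> \<le> ennreal (1 / a\<^sup>2) * (ennreal (((4 * C) * (4 * C))\<^sup>2) * sq_norm M f)"
      by (intro mult_left_mono *) auto
    also have "\<dots> = ennreal (1 / a\<^sup>2 * ((4 * C) * (4 * C))\<^sup>2) * sq_norm M f"
      by (subst ennreal_mult) (auto simp: mult.assoc)
    also have "1 / a\<^sup>2 * ((4 * C) * (4 * C))\<^sup>2 = (16 * C\<^sup>2 / a)\<^sup>2"
      by (simp add: power_divide power2_eq_square)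
    also have "ennreal ((16 * C\<^sup>2 / a)\<^sup>2) * sq_norm M f \<le> ennreal ((r ^ n / 2)\<^sup>2) * sq_norm M f"
    proof (intro mult_right_mono ennreal_leI power_mono)
      have "16 * C\<^sup>2 / a = 16 * C\<^sup>2 * l ^ (n + 2) / real (Suc n)" by (simp add: a_def)
      also have "\<dots> \<le> 16 * C\<^sup>2 * (2 * r ^ (n + 2)) / real (Suc n)"
        by (intro divide_right_mono mult_left_mono ln) auto
      also have "\<dots> = (4 * (16 * C\<^sup>2) * r\<^sup>2) / real (Suc n) * (r ^ n / 2)"
        by (simp add: power_add field_simps power2_eq_square)
      also have "\<dots> \<le> 1 * (r ^ n / 2)"
        using n r by (intro mult_right_mono) auto
      finally show "16 * C\<^sup>2 / a \<le> r ^ n / 2" by simp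
    qed (use a in auto)
    finally show "sq_norm M ((nn_op M k ^^ n) f) \<le> ennreal ((r ^ n / 2)\<^sup>2) * sq_norm M f" .
  qed
  define e where "e = root n (1 / 2) * r"
  have "root n (1 / 2) < (1::real)" using n0 by simp
  then have e: "0 < e" "e < r" using n0 r by (auto simp: e_def)
  have "root n (1 / 2) ^ n = (1 / 2 :: real)" using n0 by (intro real_root_pow_pos2) auto
  then have "e ^ n = r ^ n / 2" by (simp add: e_def power_mult_distrib)
  then have en: "L2_bound M (nn_op M k ^^ n) (e ^ n)" using half by (simp only:)
  obtain b where "L2_bound M (nn_op M k) b"
    using k by (auto simp: positive_kernel_operator_iff)
  then have "growth M (nn_op M k) e"
    by (intro growth_of_power_bound[where N = n and b = b] nn_op_measurable m n0 e(1) en)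
  then show False using below e by blast
qed

text \<open>
  The other half of Gelfand's formula. It is applied through \<open>dense_ge\<close>: to bound a radius by
  \<open>kernel_radius M k\<close>, it is enough to bound it by every larger number.
\<close>

lemma growth_above_kernel_radius:
  assumes k: "positive_kernel_operator M k" and c: "kernel_radius M k < c"
  shows "0 < c" "growth M (nn_op M k) c"
proof -
  have m: "case_prod k \<in> borel_measurable (M \<Otimes>\<^sub>M M)"
    using k by (auto simp: positive_kernel_operator_iff)
  define G where "G = {c. 0 < c \<and> growth M (nn_op M k) c}"
  obtain b where b: "L2_bound M (nn_op M k) b"
    using k by (auto simp: positive_kernel_operator_iff)
  define b' where "b' = max 1 \<bar>b\<bar>"
  have "L2_bound M (nn_op M k ^^ n) (1 * b' ^ n)" for n
  proof (rule L2_bound_mono[OF L2_bound_funpow[OF b nn_op_measurable[OF m]]])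
    have "\<bar>b\<bar> ^ n \<le> \<bar>b'\<bar> ^ n" by (intro power_mono) (auto simp: b'_def)
    then show "\<bar>b ^ n\<bar> \<le> \<bar>1 * b' ^ n\<bar>" by (simp add: power_abs)
  qed
  then have "growth M (nn_op M k) b'" unfolding growth_def by blast
  then have b': "b' \<in> G" by (auto simp: G_def b'_def)
  then show "0 < c" using kernel_radius_nonneg_if_growth[OF k, of b'] c by (auto simp: G_def)
  define r where "r = Inf G"
  have bdd: "bdd_below G" by (intro bdd_belowI[of _ 0]) (auto simp: G_def)
  have above: "growth M (nn_op M k) c" if "r < c" for c
  proof -
    obtain d where "d \<in> G" "d < c"
      using cInf_lessD[of G c] b' \<open>r < c\<close> unfolding r_def by blast
    then show ?thesis using growth_mono[of M "nn_op M k" d c] by (auto simp: G_def)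
  qed
  have "r \<le> kernel_radius M k"
  proof (cases "0 < r")
    case True
    have "complex_of_real r \<in> spectrum M (kernel_op M k)"
    proof (rule growth_rate_in_spectrum[OF k True above])
      fix c :: real assume "0 < c" "c < r"
      then show "\<not> growth M (nn_op M k) c"
        using cInf_lower[OF _ bdd, of c] unfolding r_def by (auto simp: G_def)
    qed
    moreover have "bdd_above (insert 0 (norm ` spectrum M (kernel_op M k)))"
      using spectrum_norm_le[OF k, of b'] b' by (intro bdd_aboveI[of _ b']) (auto simp: G_def)
    ultimately have "norm (complex_of_real r) \<le> kernel_radius M k"
      unfolding kernel_radius_def spectral_radius_def by (intro cSup_upper insertI2 imageI)
    then show ?thesis using True by simp
  next
    case False
    then show ?thesis using kernel_radius_nonneg_if_growth[OF k, of b'] b' by (auto simp: G_def)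
  qed
  then show "growth M (nn_op M k) c" using above c by simp
qed

lemma kernel_radius_nonneg: "positive_kernel_operator M k \<Longrightarrow> 0 \<le> kernel_radius M k"
  using growth_above_kernel_radius[of k] by (meson dense_le less_imp_le not_less)

end

section \<open>Composition and adjoint of kernels\<close>

context sigma_finite_measure
begin

interpretation P: pair_sigma_finite M M ..

lemma AE_pair_fst:
  assumes "AE x in M. R x"
  shows "AE (x, y) in M \<Otimes>\<^sub>M M. R x"
proof -
  obtain N where N: "{x \<in> space M. \<not> R x} \<subseteq> N" "emeasure M N = 0" "N \<in> sets M"
    using assms by (rule AE_E)
  show ?thesis
  proof (rule AE_I)
    show "{p \<in> space (M \<Otimes>\<^sub>M M). \<not> (case p of (x, y) \<Rightarrow> R x)} \<subseteq> N \<times> space M"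
      using N by (auto simp: space_pair_measure)
    show "emeasure (M \<Otimes>\<^sub>M M) (N \<times> space M) = 0"
      using N by (simp add: emeasure_pair_measure_Times)
    show "N \<times> space M \<in> sets (M \<Otimes>\<^sub>M M)" using N by simp
  qed
qed

lemma AE_pair_swap:
  assumes "AE p in M \<Otimes>\<^sub>M M. Q p"
  shows "AE (x, y) in M \<Otimes>\<^sub>M M. Q (y, x)"
proof -
  let ?s = "\<lambda>(x, y). (y, x)"
  obtain N where N: "{p \<in> space (M \<Otimes>\<^sub>M M). \<not> Q p} \<subseteq> N" "emeasure (M \<Otimes>\<^sub>M M) N = 0"
      "N \<in> sets (M \<Otimes>\<^sub>M M)"
    using assms by (rule AE_E)
  have s: "?s \<in> measurable (M \<Otimes>\<^sub>M M) (M \<Otimes>\<^sub>M M)" by measurable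
  show ?thesis
  proof (rule AE_I)
    show "{p \<in> space (M \<Otimes>\<^sub>M M). \<not> (case p of (x, y) \<Rightarrow> Q (y, x))} \<subseteq> ?s -` N \<inter> space (M \<Otimes>\<^sub>M M)"
      using N(1) by (auto simp: space_pair_measure)
    have "emeasure (M \<Otimes>\<^sub>M M) (?s -` N \<inter> space (M \<Otimes>\<^sub>M M)) = emeasure (distr (M \<Otimes>\<^sub>M M) (M \<Otimes>\<^sub>M M) ?s) N"
      by (rule emeasure_distr[OF s N(3), symmetric])
    also have "\<dots> = 0" using P.distr_pair_swap N(2) by simp
    finally show "emeasure (M \<Otimes>\<^sub>M M) (?s -` N \<inter> space (M \<Otimes>\<^sub>M M)) = 0" .
    show "?s -` N \<inter> space (M \<Otimes>\<^sub>M M) \<in> sets (M \<Otimes>\<^sub>M M)" by (rule measurable_sets[OF s N(3)])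
  qed
qed

lemma AE_pair_snd:
  assumes "AE x in M. R x"
  shows "AE (x, y) in M \<Otimes>\<^sub>M M. R y"
  using AE_pair_swap[OF AE_pair_fst[OF assms]] by simp

text \<open>
  A composition \<open>\<integral> k x z h z y dz\<close> at the point \<open>(x, y)\<close> involves the row of \<open>k\<close> at \<open>x\<close> and the column
  of \<open>h\<close> at \<open>y\<close>. Statements that hold almost everywhere for the kernels are used there in this form.
\<close>

lemma AE_pair_rows:
  assumes "AE (x, y) in M \<Otimes>\<^sub>M M. Q x y"
  shows "AE (x, y) in M \<Otimes>\<^sub>M M. AE z in M. Q x z"
  by (rule AE_pair_fst) (use P.AE_pair[OF assms] in simp)

lemma AE_pair_columns:
  assumes "AE (x, y) in M \<Otimes>\<^sub>M M. Q x y"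
  shows "AE (x, y) in M \<Otimes>\<^sub>M M. AE z in M. Q z y"
proof (rule AE_pair_snd)
  have "AE (x, y) in M \<Otimes>\<^sub>M M. Q y x" using AE_pair_swap[OF assms] by simp
  then show "AE y in M. AE z in M. Q z y" using P.AE_pair by fastforce
qed

lemma nn_op_nn_op:
  assumes [measurable]: "case_prod k \<in> borel_measurable (M \<Otimes>\<^sub>M M)"
    "case_prod h \<in> borel_measurable (M \<Otimes>\<^sub>M M)" "f \<in> borel_measurable M"
    and x: "x \<in> space M"
  shows "nn_op M k (nn_op M h f) x =
    (\<integral>\<^sup>+y. (\<integral>\<^sup>+z. ennreal (k x z) * ennreal (h z y) \<partial>M) * f y \<partial>M)"
proof -
  have [measurable]: "k x \<in> borel_measurable M"
    using measurable_Pair2[OF assms(1) x] by simp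
  have "nn_op M k (nn_op M h f) x = (\<integral>\<^sup>+z. \<integral>\<^sup>+y. ennreal (k x z) * ennreal (h z y) * f y \<partial>M \<partial>M)"
    unfolding nn_op_def
  proof (intro nn_integral_cong)
    fix z assume z: "z \<in> space M"
    have [measurable]: "h z \<in> borel_measurable M"
      using measurable_Pair2[OF assms(2) z] by simp
    show "ennreal (k x z) * (\<integral>\<^sup>+y. ennreal (h z y) * f y \<partial>M) =
        (\<integral>\<^sup>+y. ennreal (k x z) * ennreal (h z y) * f y \<partial>M)"
      by (simp add: nn_integral_cmult mult.assoc)
  qed
  also have "\<dots> = (\<integral>\<^sup>+y. \<integral>\<^sup>+z. ennreal (k x z) * ennreal (h z y) * f y \<partial>M \<partial>M)"
    by (rule P.Fubini'[symmetric]) measurable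
  also have "\<dots> = (\<integral>\<^sup>+y. (\<integral>\<^sup>+z. ennreal (k x z) * ennreal (h z y) \<partial>M) * f y \<partial>M)"
  proof (intro nn_integral_cong)
    fix y assume y: "y \<in> space M"
    have [measurable]: "(\<lambda>z. h z y) \<in> borel_measurable M"
      using measurable_Pair1[OF assms(2) y] by simp
    show "(\<integral>\<^sup>+z. ennreal (k x z) * ennreal (h z y) * f y \<partial>M) =
        (\<integral>\<^sup>+z. ennreal (k x z) * ennreal (h z y) \<partial>M) * f y"
      by (rule nn_integral_multc) measurable
  qed
  finally show ?thesis .
qed

lemma obtain_positive_L2_function:
  obtains \<phi> :: "'a \<Rightarrow> real" where "\<phi> \<in> borel_measurable M" "\<And>x. 0 < \<phi> x"
    "sq_norm M (\<lambda>x. ennreal (\<phi> x)) < \<infinity>"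
proof -
  obtain \<phi> :: "'a \<Rightarrow> real" where p: "\<phi> \<in> borel_measurable M" "\<And>x. 0 < \<phi> x"
      "\<And>x. \<phi> x \<le> 1" "integrable M \<phi>"
    using obtain_positive_integrable_function by blast
  have "sq_norm M (\<lambda>x. ennreal (\<phi> x)) \<le> (\<integral>\<^sup>+x. ennreal (norm (\<phi> x)) \<partial>M)"
    unfolding sq_norm_def
    using p(2,3) by (intro nn_integral_mono)
      (auto simp: ennreal_power less_imp_le power2_eq_square intro!: ennreal_leI mult_left_le)
  also have "\<dots> < \<infinity>" using p(4) by (simp add: integrable_iff_bounded)
  finally show ?thesis using that p by blast
qed

text \<open>
  The composition applied to a strictly positive function \<open>\<phi>\<close> in $L^2$ is finite almost everywhere,
  so the composed kernel times \<open>\<phi> y\<close> has a finite integral in \<open>y\<close>.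
\<close>

lemma kernel_comp_finite:
  assumes k: "positive_kernel_operator M k" and h: "positive_kernel_operator M h"
  shows "AE (x, y) in M \<Otimes>\<^sub>M M. (\<integral>\<^sup>+z. ennreal (k x z) * ennreal (h z y) \<partial>M) < \<infinity>"
proof -
  have [measurable]: "case_prod k \<in> borel_measurable (M \<Otimes>\<^sub>M M)"
    "case_prod h \<in> borel_measurable (M \<Otimes>\<^sub>M M)"
    using k h by (auto simp: positive_kernel_operator_iff)
  obtain \<phi> :: "'a \<Rightarrow> real" where p[measurable]: "\<phi> \<in> borel_measurable M" and pos: "\<And>x. 0 < \<phi> x"
    and fin: "sq_norm M (\<lambda>x. ennreal (\<phi> x)) < \<infinity>"
    by (rule obtain_positive_L2_function) blast
  let ?f = "\<lambda>x. ennreal (\<phi> x)"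
  have "sq_norm M (nn_op M k (nn_op M h ?f)) < \<infinity>"
    by (intro nn_op_finite_sq_norm k h fin nn_op_measurable) measurable
  then have "AE x in M. nn_op M k (nn_op M h ?f) x < \<infinity>"
    by (intro sq_norm_finite_AE) measurable
  then have "AE x in M. AE y in M. (\<integral>\<^sup>+z. ennreal (k x z) * ennreal (h z y) \<partial>M) < \<infinity>"
    using AE_space
  proof eventually_elim
    case (elim x)
    have [measurable]: "k x \<in> borel_measurable M"
      using measurable_Pair2[of "case_prod k" M M borel x] elim(2) by simp
    have "AE y in M. (\<integral>\<^sup>+z. ennreal (k x z) * ennreal (h z y) \<partial>M) * ?f y \<noteq> \<infinity>"
      using elim by (intro nn_integral_PInf_AE) (auto simp: nn_op_nn_op)
    then show ?case
    proof eventually_elim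
      case (elim y)
      then show ?case using pos[of y]
        by (auto simp: ennreal_mult_eq_top_iff less_top[symmetric])
    qed
  qed
  then show ?thesis by (intro P.AE_pair_measure) (auto simp: case_prod_beta')
qed

lemma kernel_comp_eq:
  assumes k: "positive_kernel_operator M k" and h: "positive_kernel_operator M h"
  shows "AE (x, y) in M \<Otimes>\<^sub>M M. integrable M (\<lambda>z. k x z * h z y) \<and> 0 \<le> kernel_comp M k h x y \<and>
    ennreal (kernel_comp M k h x y) = (\<integral>\<^sup>+z. ennreal (k x z) * ennreal (h z y) \<partial>M)"
proof -
  have m: "case_prod k \<in> borel_measurable (M \<Otimes>\<^sub>M M)" "case_prod h \<in> borel_measurable (M \<Otimes>\<^sub>M M)"
    and nn: "AE (x, y) in M \<Otimes>\<^sub>M M. 0 \<le> k x y" "AE (x, y) in M \<Otimes>\<^sub>M M. 0 \<le> h x y"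
    using k h by (auto simp: positive_kernel_operator_iff)
  from kernel_comp_finite[OF k h] AE_pair_rows[OF nn(1)] AE_pair_columns[OF nn(2)] AE_space
  show ?thesis
  proof eventually_elim
    case (elim p)
    obtain x y where p: "p = (x, y)" by force
    have x: "x \<in> space M" and y: "y \<in> space M" using elim(4) by (auto simp: p space_pair_measure)
    have [measurable]: "k x \<in> borel_measurable M" "(\<lambda>z. h z y) \<in> borel_measurable M"
      using measurable_Pair2[OF m(1) x] measurable_Pair1[OF m(2) y] by auto
    have k0: "AE z in M. 0 \<le> k x z" and h0: "AE z in M. 0 \<le> h z y" using elim(2,3) by (auto simp: p)
    then have nn: "AE z in M. 0 \<le> k x z * h z y" by eventually_elim simp
    have eq: "(\<integral>\<^sup>+z. ennreal (k x z * h z y) \<partial>M) = (\<integral>\<^sup>+z. ennreal (k x z) * ennreal (h z y) \<partial>M)"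
    proof (rule nn_integral_cong_AE)
      show "AE z in M. ennreal (k x z * h z y) = ennreal (k x z) * ennreal (h z y)"
        using k0 h0 by eventually_elim (simp add: ennreal_mult)
    qed
    have int: "integrable M (\<lambda>z. k x z * h z y)"
      using elim(1) nn by (intro integrableI_nonneg) (auto simp: p eq)
    moreover have "ennreal (kernel_comp M k h x y) = (\<integral>\<^sup>+z. ennreal (k x z * h z y) \<partial>M)"
      unfolding kernel_comp_def by (rule nn_integral_eq_integral[OF int nn, symmetric])
    moreover have "0 \<le> kernel_comp M k h x y"
      unfolding kernel_comp_def by (rule integral_nonneg_AE[OF nn])
    ultimately show ?case by (simp add: p eq)
  qed
qed

lemma nn_op_kernel_comp:
  assumes k: "positive_kernel_operator M k" and h: "positive_kernel_operator M h"
    and f: "f \<in> borel_measurable M"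
  shows "AE x in M. nn_op M (kernel_comp M k h) f x = nn_op M k (nn_op M h f) x"
proof -
  have m: "case_prod k \<in> borel_measurable (M \<Otimes>\<^sub>M M)" "case_prod h \<in> borel_measurable (M \<Otimes>\<^sub>M M)"
    using k h by (auto simp: positive_kernel_operator_iff)
  have "AE x in M. AE y in M. ennreal (kernel_comp M k h x y) =
      (\<integral>\<^sup>+z. ennreal (k x z) * ennreal (h z y) \<partial>M)"
    using P.AE_pair[OF kernel_comp_eq[OF k h]] by simp
  then show ?thesis
    using AE_space
  proof eventually_elim
    case (elim x)
    have "nn_op M (kernel_comp M k h) f x = (\<integral>\<^sup>+y. (\<integral>\<^sup>+z. ennreal (k x z) * ennreal (h z y) \<partial>M) * f y \<partial>M)"
      unfolding nn_op_def by (rule nn_integral_cong_AE) (use elim(1) in auto)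
    then show ?case using elim(2) by (simp add: nn_op_nn_op[OF m f])
  qed
qed

lemma positive_kernel_operator_comp:
  assumes k: "positive_kernel_operator M k" and h: "positive_kernel_operator M h"
  shows "positive_kernel_operator M (kernel_comp M k h)"
proof -
  have m[measurable]: "case_prod k \<in> borel_measurable (M \<Otimes>\<^sub>M M)" "case_prod h \<in> borel_measurable (M \<Otimes>\<^sub>M M)"
    using k h by (auto simp: positive_kernel_operator_iff)
  obtain c d where cd: "L2_bound M (nn_op M k) c" "L2_bound M (nn_op M h) d"
    using k h by (auto simp: positive_kernel_operator_iff)
  have "L2_bound M (nn_op M k \<circ> nn_op M h) (c * d)"
    by (rule L2_bound_comp[OF cd]) (rule nn_op_measurable[OF m(2)])
  then have "L2_bound M (nn_op M (kernel_comp M k h)) (c * d)"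
    unfolding L2_bound_def using sq_norm_cong_AE[OF nn_op_kernel_comp[OF k h]] by simp
  moreover have "case_prod (kernel_comp M k h) \<in> borel_measurable (M \<Otimes>\<^sub>M M)"
    unfolding kernel_comp_def[abs_def] by measurable
  moreover have "AE (x, y) in M \<Otimes>\<^sub>M M. 0 \<le> kernel_comp M k h x y"
    using kernel_comp_eq[OF k h] by eventually_elim auto
  ultimately show ?thesis by (auto simp: positive_kernel_operator_iff)
qed

lemma kernel_comp_mono:
  assumes k: "positive_kernel_operator M k" "positive_kernel_operator M k'"
    and h: "positive_kernel_operator M h" "positive_kernel_operator M h'"
    and le: "AE (x, y) in M \<Otimes>\<^sub>M M. k x y \<le> k' x y" "AE (x, y) in M \<Otimes>\<^sub>M M. h x y \<le> h' x y"
  shows "AE (x, y) in M \<Otimes>\<^sub>M M. kernel_comp M k h x y \<le> kernel_comp M k' h' x y"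
proof -
  have nn: "AE (x, y) in M \<Otimes>\<^sub>M M. 0 \<le> k x y" "AE (x, y) in M \<Otimes>\<^sub>M M. 0 \<le> h x y"
    using k h by (auto simp: positive_kernel_operator_iff)
  from kernel_comp_eq[OF k(1) h(1)] kernel_comp_eq[OF k(2) h(2)]
    AE_pair_rows[OF nn(1)] AE_pair_rows[OF le(1)] AE_pair_columns[OF nn(2)] AE_pair_columns[OF le(2)]
  show ?thesis
  proof eventually_elim
    case (elim p)
    obtain x y where p: "p = (x, y)" by force
    have "kernel_comp M k h x y \<le> kernel_comp M k' h' x y"
      unfolding kernel_comp_def
    proof (rule integral_mono_AE)
      have "AE z in M. 0 \<le> k x z" "AE z in M. k x z \<le> k' x z"
          "AE z in M. 0 \<le> h z y" "AE z in M. h z y \<le> h' z y"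
        using elim by (auto simp: p)
      then show "AE z in M. k x z * h z y \<le> k' x z * h' z y"
        by eventually_elim (auto intro: mult_mono)
    qed (use elim in \<open>auto simp: p\<close>)
    then show ?case by (simp add: p)
  qed
qed

text \<open>
  The function \<open>v\<close> is the limit of the increasing square integrable functions \<open>min v (n \<phi>)\<close>, where
  \<open>\<phi>\<close> is strictly positive and square integrable.
\<close>

lemma sq_norm_le_if_truncations_le:
  assumes [measurable]: "v \<in> borel_measurable M"
    and le: "\<And>w. w \<in> borel_measurable M \<Longrightarrow> (\<And>x. w x \<le> v x) \<Longrightarrow> sq_norm M w < \<infinity> \<Longrightarrow> sq_norm M w \<le> D"
  shows "sq_norm M v \<le> D"
proof -
  obtain \<phi> :: "'a \<Rightarrow> real" where p[measurable]: "\<phi> \<in> borel_measurable M" and pos: "\<And>x. 0 < \<phi> x"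
    and fin: "sq_norm M (\<lambda>x. ennreal (\<phi> x)) < \<infinity>"
    by (rule obtain_positive_L2_function) blast
  define w where "w n x = min (v x) (ennreal (real n) * ennreal (\<phi> x))" for n x
  have [measurable]: "w n \<in> borel_measurable M" for n unfolding w_def[abs_def] by measurable
  have inc: "incseq (\<lambda>n. w n x)" for x
    unfolding w_def by (intro monoI min.mono mult_right_mono ennreal_leI) auto
  have sup: "(SUP n. w n x) = v x" for x
  proof (rule antisym)
    show "(SUP n. w n x) \<le> v x" by (intro SUP_least) (simp add: w_def)
    show "v x \<le> (SUP n. w n x)"
    proof (rule dense_le)
      fix y assume y: "y < v x"
      define r where "r = enn2real y"
      have "y < top" using less_le_trans[OF y top_greatest] .
      then have r: "y = ennreal r" "0 \<le> r" by (auto simp: r_def)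
      obtain n :: nat where "r / \<phi> x < real n" using reals_Archimedean2 by blast
      then have "r \<le> real n * \<phi> x" using pos[of x] by (simp add: field_simps)
      then have "y \<le> w n x"
        using y r pos[of x] by (auto simp: w_def ennreal_mult[symmetric] less_imp_le intro!: ennreal_leI)
      then show "y \<le> (SUP n. w n x)" by (rule order_trans) (rule SUP_upper, simp)
    qed
  qed
  have sq: "(v x)\<^sup>2 \<le> (SUP n. (w n x)\<^sup>2)" for x
  proof -
    have "(v x)\<^sup>2 = (SUP n. SUP l. w l x * w n x)"
      unfolding sup[symmetric] power2_eq_square
      by (simp add: SUP_mult_left_ennreal SUP_mult_right_ennreal)
    also have "\<dots> \<le> (SUP n. (w n x)\<^sup>2)"
    proof (intro SUP_least)
      fix n l
      have "w l x * w n x \<le> w (max l n) x * w (max l n) x"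
        using inc[of x] by (intro mult_mono) (auto simp: incseq_def)
      then show "w l x * w n x \<le> (SUP n. (w n x)\<^sup>2)"
        by (intro SUP_upper2[of "max l n"]) (auto simp: power2_eq_square)
    qed
    finally show ?thesis .
  qed
  have "sq_norm M v \<le> (\<integral>\<^sup>+x. (SUP n. (w n x)\<^sup>2) \<partial>M)"
    unfolding sq_norm_def by (intro nn_integral_mono sq)
  also have "\<dots> = (SUP n. sq_norm M (w n))"
    unfolding sq_norm_def
  proof (rule nn_integral_monotone_convergence_SUP)
    show "incseq (\<lambda>n x. (w n x)\<^sup>2)"
      using inc unfolding incseq_def le_fun_def by (blast intro: power_mono zero_le)
  qed measurable
  also have "\<dots> \<le> D"
  proof (rule SUP_least)
    fix n
    have "sq_norm M (w n) \<le> sq_norm M (\<lambda>x. ennreal (real n) * ennreal (\<phi> x))"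
      by (intro sq_norm_mono_AE AE_I2) (simp add: w_def)
    also have "\<dots> = (ennreal (real n))\<^sup>2 * sq_norm M (\<lambda>x. ennreal (\<phi> x))"
      by (rule sq_norm_cmult) measurable
    also have "\<dots> < \<infinity>" using fin by (simp add: ennreal_mult_less_top power_less_top_ennreal)
    finally show "sq_norm M (w n) \<le> D" by (intro le) (auto simp: w_def)
  qed
  finally show ?thesis .
qed

text \<open>
  Duality: \<open>\<langle>w, K\<^sup>* u\<rangle> = \<langle>K w, u\<rangle> \<le> \<bar>c\<bar> \<parallel>w\<parallel> \<parallel>u\<parallel>\<close>. The choice \<open>w = K\<^sup>* u\<close> would give the bound at once if
  its norm were known to be finite; truncations \<open>w \<le> K\<^sup>* u\<close> of finite norm serve instead.
\<close>

lemma L2_bound_adjoint: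
  assumes m: "case_prod k \<in> borel_measurable (M \<Otimes>\<^sub>M M)" and c: "L2_bound M (nn_op M k) c"
  shows "L2_bound M (nn_op M (kernel_adjoint k)) c"
  unfolding L2_bound_def
proof
  fix u :: "'a \<Rightarrow> ennreal" assume u[measurable]: "u \<in> borel_measurable M"
  have m'[measurable]: "case_prod (kernel_adjoint k) \<in> borel_measurable (M \<Otimes>\<^sub>M M)"
    unfolding kernel_adjoint_def[abs_def] using m by measurable
  note [measurable] = m
  show "sq_norm M (nn_op M (kernel_adjoint k) u) \<le> ennreal (c\<^sup>2) * sq_norm M u"
  proof (rule sq_norm_le_if_truncations_le)
    show "nn_op M (kernel_adjoint k) u \<in> borel_measurable M" by measurable
    fix w :: "'a \<Rightarrow> ennreal" assume w[measurable]: "w \<in> borel_measurable M"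
      and le: "\<And>x. w x \<le> nn_op M (kernel_adjoint k) u x" and fin: "sq_norm M w < \<infinity>"
    show "sq_norm M w \<le> ennreal (c\<^sup>2) * sq_norm M u"
    proof (cases "sq_norm M w = 0")
      case False
      have "sq_norm M w \<le> (\<integral>\<^sup>+x. w x * nn_op M (kernel_adjoint k) u x \<partial>M)"
        unfolding sq_norm_def power2_eq_square by (intro nn_integral_mono mult_left_mono le) auto
      also have "\<dots> = (\<integral>\<^sup>+x. nn_op M k w x * u x \<partial>M)"
        by (rule nn_op_adjoint[symmetric]) measurable
      finally have "(sq_norm M w)\<^sup>2 \<le> (\<integral>\<^sup>+x. nn_op M k w x * u x \<partial>M)\<^sup>2"
        by (intro power_mono) auto
      also have "\<dots> \<le> sq_norm M (nn_op M k w) * sq_norm M u"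
        unfolding sq_norm_def by (rule Cauchy_Schwarz_nn_integral) measurable
      also have "\<dots> \<le> ennreal (c\<^sup>2) * sq_norm M w * sq_norm M u"
        by (intro mult_right_mono L2_boundD[OF c w]) auto
      finally have "sq_norm M w * sq_norm M w \<le> sq_norm M w * (ennreal (c\<^sup>2) * sq_norm M u)"
        by (simp add: power2_eq_square mult_ac)
      then show ?thesis using False fin by (subst (asm) ennreal_mult_le_mult_iff) auto
    qed simp
  qed
qed

lemma positive_kernel_operator_adjoint:
  assumes k: "positive_kernel_operator M k"
  shows "positive_kernel_operator M (kernel_adjoint k)"
proof -
  have m[measurable]: "case_prod k \<in> borel_measurable (M \<Otimes>\<^sub>M M)"
    using k by (simp add: positive_kernel_operator_iff)
  have "case_prod (kernel_adjoint k) \<in> borel_measurable (M \<Otimes>\<^sub>M M)"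
    unfolding kernel_adjoint_def[abs_def] by measurable
  moreover have "AE (x, y) in M \<Otimes>\<^sub>M M. 0 \<le> kernel_adjoint k x y"
    using k AE_pair_swap[of "\<lambda>(x, y). 0 \<le> k x y"]
    by (simp add: positive_kernel_operator_iff kernel_adjoint_def)
  ultimately show ?thesis
    using L2_bound_adjoint[OF m] k by (auto simp: positive_kernel_operator_iff)
qed

end

section \<open>Hadamard geometric means and composition\<close>

lemma prod_powr_le_mean:
  fixes a :: "'i \<Rightarrow> real"
  assumes I: "finite I" "I \<noteq> {}" and a: "\<And>i. i \<in> I \<Longrightarrow> 0 \<le> a i"
  shows "(\<Prod>i\<in>I. a i powr (1 / card I)) \<le> (\<Sum>i\<in>I. a i) / card I"
proof -
  have "(\<Prod>i\<in>I. a i powr (1 / card I)) = (\<Prod>i\<in>I. a i) powr (1 / card I)"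
    using a by (simp add: prod_powr_distrib)
  also have "\<dots> \<le> (\<Sum>i\<in>I. a i) / card I"
    using arith_geom_mean[OF I a] by (simp add: sum_divide_distrib)
  finally show ?thesis .
qed

text \<open>
  Hoelder's inequality for several functions with equal exponents. After division of each function
  by its integral it follows from the inequality of the means.
\<close>

lemma integral_prod_powr_le:
  fixes f :: "'i \<Rightarrow> 'a \<Rightarrow> real"
  assumes I: "finite I" "I \<noteq> {}" and int: "\<And>i. i \<in> I \<Longrightarrow> integrable M (f i)"
    and nn: "\<And>i. i \<in> I \<Longrightarrow> AE z in M. 0 \<le> f i z"
  shows "(\<integral>z. (\<Prod>i\<in>I. f i z powr (1 / card I)) \<partial>M) \<le> (\<Prod>i\<in>I. (\<integral>z. f i z \<partial>M) powr (1 / card I))"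
proof -
  let ?t = "1 / real (card I)"
  have AE_nn: "AE z in M. \<forall>i\<in>I. 0 \<le> f i z"
    using nn I by (simp add: AE_finite_all)
  have [measurable]: "f i \<in> borel_measurable M" if "i \<in> I" for i using int that by auto
  define s where "s i = (\<integral>z. f i z \<partial>M)" for i
  have s0: "0 \<le> s i" if "i \<in> I" for i unfolding s_def by (intro integral_nonneg_AE nn that)
  show ?thesis
  proof (cases "\<exists>i\<in>I. s i = 0")
    case True
    then obtain j where j: "j \<in> I" "s j = 0" by blast
    have "AE z in M. f j z = 0"
      using j integral_nonneg_eq_0_iff_AE[OF int nn] by (simp add: s_def)
    then have "AE z in M. (\<Prod>i\<in>I. f i z powr ?t) = 0"
      by eventually_elim (use I j in auto)
    then have "(\<integral>z. (\<Prod>i\<in>I. f i z powr ?t) \<partial>M) = (\<integral>z. 0 \<partial>M)"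
      by (intro integral_cong_AE) measurable
    then show ?thesis by (simp add: prod_nonneg)
  next
    case False
    then have s: "0 < s i" if "i \<in> I" for i using s0[OF that] that by force
    let ?P = "\<Prod>i\<in>I. s i powr ?t"
    let ?g = "\<lambda>z. ?P * ((\<Sum>i\<in>I. f i z / s i) / card I)"
    have le: "AE z in M. (\<Prod>i\<in>I. f i z powr ?t) \<le> ?g z"
      using AE_nn
    proof eventually_elim
      case (elim z)
      have "(\<Prod>i\<in>I. f i z powr ?t) = (\<Prod>i\<in>I. s i powr ?t * (f i z / s i) powr ?t)"
        using s by (intro prod.cong refl) (simp add: less_imp_neq[symmetric] flip: powr_mult)
      also have "\<dots> = ?P * (\<Prod>i\<in>I. (f i z / s i) powr ?t)" by (rule prod.distrib)
      also have "\<dots> \<le> ?g z"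
        using s elim by (intro mult_left_mono prod_powr_le_mean I prod_nonneg divide_nonneg_pos) auto
      finally show ?case .
    qed
    have "(\<integral>z. (\<Prod>i\<in>I. f i z powr ?t) \<partial>M) \<le> (\<integral>z. ?g z \<partial>M)"
    proof (rule integral_mono_AE'[OF _ le])
      show "integrable M ?g" using int by auto
      have P0: "0 \<le> (\<Prod>i\<in>I. f i z powr ?t)" for z by (simp add: prod_nonneg)
      from le show "AE z in M. 0 \<le> ?g z" by eventually_elim (rule order_trans[OF P0])
    qed
    also have "\<dots> = ?P * ((\<Sum>i\<in>I. s i / s i) / card I)"
      using int by (simp add: Bochner_Integration.integral_sum s_def)
    also have "(\<Sum>i\<in>I. s i / s i) = card I" using s by (simp add: less_imp_neq[symmetric])
    also have "?P * (real (card I) / real (card I)) = ?P" using I by (simp add: card_gt_0_iff)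
    finally show ?thesis by (simp add: s_def)
  qed
qed

definition hadamard_mean :: "nat \<Rightarrow> (nat \<Rightarrow> 'a \<Rightarrow> 'a \<Rightarrow> real) \<Rightarrow> 'a \<Rightarrow> 'a \<Rightarrow> real" where
  "hadamard_mean m K = hadamard_prod m (\<lambda>i. hadamard_power (K i) (1 / real m))"

lemma hadamard_mean_apply: "hadamard_mean m K x y = (\<Prod>i=1..m. K i x y powr (1 / real m))"
  by (simp add: hadamard_mean_def hadamard_prod_def hadamard_power_def)

lemma hadamard_mean_nonneg: "0 \<le> hadamard_mean m K x y"
  by (simp add: hadamard_mean_apply prod_nonneg)

lemma hadamard_mean_cong: "(\<And>i. i \<in> {1..m} \<Longrightarrow> K i = L i) \<Longrightarrow> hadamard_mean m K = hadamard_mean m L"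
  by (intro ext) (simp add: hadamard_mean_apply)

lemma hadamard_mean_permute:
  assumes "bij_betw p {1..m} {1..m}"
  shows "hadamard_mean m (\<lambda>i. K (p i)) = hadamard_mean m K"
  using prod.reindex_bij_betw[OF assms] by (intro ext) (simp add: hadamard_mean_apply)

lemma kernel_adjoint_hadamard_mean:
  "kernel_adjoint (hadamard_mean m K) = hadamard_mean m (\<lambda>i. kernel_adjoint (K i))"
  by (intro ext) (simp add: hadamard_mean_apply kernel_adjoint_def)

context sigma_finite_measure
begin

interpretation P: pair_sigma_finite M M ..

text \<open>
  The factor \<open>card I\<close> is harmless in estimates of growth rates. This crude bound therefore replaces
  the sharp estimate of the norm of a Hadamard geometric mean by the geometric mean of the norms.
\<close>

lemma L2_bound_dominated_sum:
  assumes I: "finite I" and m[measurable]: "\<And>i. i \<in> I \<Longrightarrow> case_prod (K i) \<in> borel_measurable (M \<Otimes>\<^sub>M M)"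
    and nn: "\<And>i. i \<in> I \<Longrightarrow> AE (x, y) in M \<Otimes>\<^sub>M M. 0 \<le> K i x y"
    and le: "AE (x, y) in M \<Otimes>\<^sub>M M. k x y \<le> (\<Sum>i\<in>I. K i x y)"
    and c: "\<And>i. i \<in> I \<Longrightarrow> L2_bound M (nn_op M (K i)) c"
  shows "L2_bound M (nn_op M k) (real (card I) * c)"
  unfolding L2_bound_def
proof
  fix f :: "'a \<Rightarrow> ennreal" assume f[measurable]: "f \<in> borel_measurable M"
  have "AE x in M. AE y in M. \<forall>i\<in>I. 0 \<le> K i x y"
    using I AE_kernel_slice[OF nn] by (simp add: AE_finite_all)
  moreover have "AE x in M. AE y in M. k x y \<le> (\<Sum>i\<in>I. K i x y)"
    using P.AE_pair[OF le] by simp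
  ultimately have "AE x in M. nn_op M k f x \<le> (\<Sum>i\<in>I. nn_op M (K i) f x)"
    using AE_space
  proof eventually_elim
    case (elim x)
    have [measurable]: "K i x \<in> borel_measurable M" if "i \<in> I" for i
      using measurable_Pair2[OF m[OF that] elim(3)] by simp
    have "nn_op M k f x \<le> (\<integral>\<^sup>+y. (\<Sum>i\<in>I. ennreal (K i x y) * f y) \<partial>M)"
      unfolding nn_op_def
    proof (rule nn_integral_mono_AE)
      show "AE y in M. ennreal (k x y) * f y \<le> (\<Sum>i\<in>I. ennreal (K i x y) * f y)"
        using elim(1,2)
      proof eventually_elim
        case (elim y)
        have "ennreal (k x y) \<le> ennreal (\<Sum>i\<in>I. K i x y)" using elim by (intro ennreal_leI) simp
        also have "\<dots> = (\<Sum>i\<in>I. ennreal (K i x y))" using elim by (intro sum_ennreal[symmetric]) auto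
        finally show ?case unfolding sum_distrib_right[symmetric] by (intro mult_right_mono) auto
      qed
    qed
    also have "\<dots> = (\<Sum>i\<in>I. nn_op M (K i) f x)" unfolding nn_op_def by (rule nn_integral_sum) measurable
    finally show ?case .
  qed
  then have "sq_norm M (nn_op M k f) \<le> sq_norm M (\<lambda>x. \<Sum>i\<in>I. nn_op M (K i) f x)"
    by (rule sq_norm_mono_AE)
  also have "\<dots> \<le> of_nat (card I) * (\<Sum>i\<in>I. sq_norm M (nn_op M (K i) f))"
    by (rule sq_norm_sum_le[OF I]) measurable
  also have "\<dots> \<le> of_nat (card I) * (\<Sum>i\<in>I. ennreal (c\<^sup>2) * sq_norm M f)"
    by (intro mult_left_mono sum_mono L2_boundD[OF c f]) auto
  also have "\<dots> = ennreal (real (card I)) * (ennreal (real (card I)) * (ennreal (c\<^sup>2) * sq_norm M f))"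
    by (simp add: ennreal_of_nat_eq_real_of_nat)
  also have "\<dots> = ennreal ((real (card I) * c)\<^sup>2) * sq_norm M f"
  proof -
    have "(real (card I) * c)\<^sup>2 = real (card I) * (real (card I) * c\<^sup>2)"
      by (simp add: power2_eq_square)
    then have "ennreal ((real (card I) * c)\<^sup>2) =
        ennreal (real (card I)) * (ennreal (real (card I)) * ennreal (c\<^sup>2))"
      by (simp only: ennreal_mult of_nat_0_le_iff zero_le_power2 mult_nonneg_nonneg)
    then show ?thesis by (simp only: mult.assoc)
  qed
  finally show "sq_norm M (nn_op M k f) \<le> ennreal ((real (card I) * c)\<^sup>2) * sq_norm M f" .
qed

lemma kernels_AE_nonneg:
  assumes "\<And>i. i \<in> {1..m} \<Longrightarrow> positive_kernel_operator M (K i)"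
  shows "AE p in M \<Otimes>\<^sub>M M. \<forall>i\<in>{1..m::nat}. 0 \<le> K i (fst p) (snd p)"
  using assms by (simp add: AE_finite_all positive_kernel_operator_iff case_prod_beta')

lemma hadamard_mean_le_sum:
  assumes m: "0 < m" and K: "\<And>i. i \<in> {1..m} \<Longrightarrow> positive_kernel_operator M (K i)"
  shows "AE (x, y) in M \<Otimes>\<^sub>M M. hadamard_mean m K x y \<le> (\<Sum>i=1..m. K i x y)"
proof -
  have "AE p in M \<Otimes>\<^sub>M M. \<forall>i\<in>{1..m}. 0 \<le> K i (fst p) (snd p)"
    by (rule kernels_AE_nonneg) (rule K)
  then show ?thesis
  proof eventually_elim
    case (elim p)
    obtain x y where p: "p = (x, y)" by force
    have nn: "0 \<le> K i x y" if "i \<in> {1..m}" for i using elim that by (auto simp: p)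
    have "hadamard_mean m K x y \<le> (\<Sum>i=1..m. K i x y) / real m"
      using prod_powr_le_mean[of "{1..m}" "\<lambda>i. K i x y"] nn m by (simp add: hadamard_mean_apply)
    also have "\<dots> \<le> (\<Sum>i=1..m. K i x y)"
    proof -
      have S: "0 \<le> (\<Sum>i=1..m. K i x y)" by (intro sum_nonneg nn)
      have "(\<Sum>i=1..m. K i x y) * 1 \<le> (\<Sum>i=1..m. K i x y) * real m"
        using S m by (intro mult_left_mono) auto
      then show ?thesis using m by (simp add: divide_le_eq)
    qed
    finally show ?case by (simp add: p)
  qed
qed

lemma positive_kernel_operator_hadamard_mean:
  assumes m: "0 < m" and K: "\<And>i. i \<in> {1..m} \<Longrightarrow> positive_kernel_operator M (K i)"
  shows "positive_kernel_operator M (hadamard_mean m K)"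
proof -
  have [measurable]: "case_prod (K i) \<in> borel_measurable (M \<Otimes>\<^sub>M M)" if "i \<in> {1..m}" for i
    using K[OF that] by (simp add: positive_kernel_operator_iff)
  have "case_prod (hadamard_mean m K) \<in> borel_measurable (M \<Otimes>\<^sub>M M)"
    unfolding hadamard_mean_apply[abs_def] by measurable
  moreover have "\<forall>i\<in>{1..m}. \<exists>c. L2_bound M (nn_op M (K i)) c"
    using K by (simp add: positive_kernel_operator_iff)
  then obtain c where c: "\<And>i. i \<in> {1..m} \<Longrightarrow> L2_bound M (nn_op M (K i)) (c i)" by metis
  have "L2_bound M (nn_op M (hadamard_mean m K)) (real (card {1..m}) * (\<Sum>i=1..m. \<bar>c i\<bar>))"
  proof (rule L2_bound_dominated_sum[where K = K])
    show "L2_bound M (nn_op M (K i)) (\<Sum>i=1..m. \<bar>c i\<bar>)" if "i \<in> {1..m}" for i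
      using member_le_sum[of i "{1..m}" "\<lambda>i. \<bar>c i\<bar>"] that
      by (intro L2_bound_mono[OF c[OF that]]) auto
  qed (use K hadamard_mean_le_sum[OF m K] in \<open>auto simp: positive_kernel_operator_iff\<close>)
  ultimately show ?thesis by (auto simp: positive_kernel_operator_iff hadamard_mean_nonneg)
qed

lemma hadamard_mean_mono:
  assumes K: "\<And>i. i \<in> {1..m} \<Longrightarrow> positive_kernel_operator M (K i)"
    and le: "\<And>i. i \<in> {1..m} \<Longrightarrow> AE (x, y) in M \<Otimes>\<^sub>M M. K i x y \<le> L i x y"
  shows "AE (x, y) in M \<Otimes>\<^sub>M M. hadamard_mean m K x y \<le> hadamard_mean m L x y"
proof -
  have "AE p in M \<Otimes>\<^sub>M M. \<forall>i\<in>{1..m}. K i (fst p) (snd p) \<le> L i (fst p) (snd p)"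
    using le by (simp add: AE_finite_all case_prod_beta')
  moreover have "AE p in M \<Otimes>\<^sub>M M. \<forall>i\<in>{1..m}. 0 \<le> K i (fst p) (snd p)"
    by (rule kernels_AE_nonneg) (rule K)
  ultimately show ?thesis
    by eventually_elim (auto simp: hadamard_mean_apply intro!: prod_mono powr_mono2)
qed

text \<open>
  Hoelder's inequality in the variable of integration, since
  \<open>hm K x z hm L z y = \<Prod>\<^sub>i (K i x z L i z y)\<^bsup>1/m\<^esup>\<close>.
\<close>

lemma kernel_comp_hadamard_mean_le:
  assumes m: "0 < m" and K: "\<And>i. i \<in> {1..m} \<Longrightarrow> positive_kernel_operator M (K i)"
    and L: "\<And>i. i \<in> {1..m} \<Longrightarrow> positive_kernel_operator M (L i)"
  shows "AE (x, y) in M \<Otimes>\<^sub>M M. kernel_comp M (hadamard_mean m K) (hadamard_mean m L) x y \<le>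
    hadamard_mean m (\<lambda>i. kernel_comp M (K i) (L i)) x y"
proof -
  have nn: "AE (x, y) in M \<Otimes>\<^sub>M M. 0 \<le> K i x y" "AE (x, y) in M \<Otimes>\<^sub>M M. 0 \<le> L i x y"
    if "i \<in> {1..m}" for i
    using K[OF that] L[OF that] by (auto simp: positive_kernel_operator_iff)
  have "AE p in M \<Otimes>\<^sub>M M. \<forall>i\<in>{1..m}. integrable M (\<lambda>z. K i (fst p) z * L i z (snd p))"
  proof (subst AE_finite_all; safe?)
    fix i assume i: "i \<in> {1..m}"
    show "AE p in M \<Otimes>\<^sub>M M. integrable M (\<lambda>z. K i (fst p) z * L i z (snd p))"
      using kernel_comp_eq[OF K[OF i] L[OF i]] by eventually_elim auto
  qed
  moreover have "AE p in M \<Otimes>\<^sub>M M. \<forall>i\<in>{1..m}. AE z in M. 0 \<le> K i (fst p) z"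
    using AE_pair_rows[OF nn(1)] by (simp add: AE_finite_all case_prod_beta')
  moreover have "AE p in M \<Otimes>\<^sub>M M. \<forall>i\<in>{1..m}. AE z in M. 0 \<le> L i z (snd p)"
    using AE_pair_columns[OF nn(2)] by (simp add: AE_finite_all case_prod_beta')
  ultimately show ?thesis
  proof eventually_elim
    case (elim p)
    obtain x y where p: "p = (x, y)" by force
    have pos: "AE z in M. 0 \<le> K i x z * L i z y" if "i \<in> {1..m}" for i
    proof -
      have "AE z in M. 0 \<le> K i x z" "AE z in M. 0 \<le> L i z y" using elim that by (auto simp: p)
      then show ?thesis by eventually_elim simp
    qed
    have "kernel_comp M (hadamard_mean m K) (hadamard_mean m L) x y =
        (\<integral>z. (\<Prod>i=1..m. (K i x z * L i z y) powr (1 / real (card {1..m}))) \<partial>M)"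
      by (simp add: kernel_comp_def hadamard_mean_apply powr_mult prod.distrib)
    also have "\<dots> \<le> (\<Prod>i=1..m. (\<integral>z. K i x z * L i z y \<partial>M) powr (1 / real (card {1..m})))"
      using m elim pos by (intro integral_prod_powr_le) (auto simp: p)
    also have "\<dots> = hadamard_mean m (\<lambda>i. kernel_comp M (K i) (L i)) x y"
      by (simp add: hadamard_mean_apply kernel_comp_def)
    finally show ?case by (simp add: p)
  qed
qed

lemma positive_kernel_operator_comp_list:
  assumes "ks \<noteq> []" "\<And>k. k \<in> set ks \<Longrightarrow> positive_kernel_operator M k"
  shows "positive_kernel_operator M (kernel_comp_list M ks)"
  using assms
proof (induction ks)
  case (Cons k ks)
  then show ?case by (cases ks) (auto intro: positive_kernel_operator_comp)
qed simp

text \<open>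
  The list \<open>Ks\<close> contains the factors of the product; each of them is a whole family indexed by
  \<open>{1..m}\<close>.
\<close>

lemma kernel_comp_list_hadamard_mean_le:
  assumes m: "0 < m" and "Ks \<noteq> []"
    and "\<And>K i. K \<in> set Ks \<Longrightarrow> i \<in> {1..m} \<Longrightarrow> positive_kernel_operator M (K i)"
  shows "AE (x, y) in M \<Otimes>\<^sub>M M. kernel_comp_list M (map (hadamard_mean m) Ks) x y \<le>
    hadamard_mean m (\<lambda>i. kernel_comp_list M (map (\<lambda>K. K i) Ks)) x y"
  using assms(2,3)
proof (induction Ks)
  case (Cons K Ks)
  show ?case
  proof (cases Ks)
    case Nil
    then show ?thesis by simp
  next
    case (Cons L Ls)
    have ne: "Ks \<noteq> []" using Cons by simp
    have K: "positive_kernel_operator M (K i)" if "i \<in> {1..m}" for i using Cons.prems that by simp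
    have Q: "positive_kernel_operator M (kernel_comp_list M (map (\<lambda>K. K i) Ks))" if "i \<in> {1..m}" for i
      using Cons.prems that ne by (intro positive_kernel_operator_comp_list) auto
    have R: "positive_kernel_operator M (kernel_comp_list M (map (hadamard_mean m) Ks))"
      using Cons.prems ne by (intro positive_kernel_operator_comp_list)
        (auto intro!: positive_kernel_operator_hadamard_mean[OF m])
    have IH: "AE (x, y) in M \<Otimes>\<^sub>M M. kernel_comp_list M (map (hadamard_mean m) Ks) x y \<le>
        hadamard_mean m (\<lambda>i. kernel_comp_list M (map (\<lambda>K. K i) Ks)) x y"
      using Cons.IH Cons.prems ne by simp
    have "AE (x, y) in M \<Otimes>\<^sub>M M.
        kernel_comp M (hadamard_mean m K) (kernel_comp_list M (map (hadamard_mean m) Ks)) x y \<le>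
        kernel_comp M (hadamard_mean m K) (hadamard_mean m (\<lambda>i. kernel_comp_list M (map (\<lambda>K. K i) Ks))) x y"
      by (intro kernel_comp_mono positive_kernel_operator_hadamard_mean m K Q R IH) auto
    moreover have "AE (x, y) in M \<Otimes>\<^sub>M M.
        kernel_comp M (hadamard_mean m K) (hadamard_mean m (\<lambda>i. kernel_comp_list M (map (\<lambda>K. K i) Ks))) x y \<le>
        hadamard_mean m (\<lambda>i. kernel_comp M (K i) (kernel_comp_list M (map (\<lambda>K. K i) Ks))) x y"
      by (rule kernel_comp_hadamard_mean_le[OF m K Q])
    ultimately show ?thesis unfolding Cons by eventually_elim auto
  qed
qed simp

lemma foldr_nn_op_measurable:
  assumes "\<And>k. k \<in> set ks \<Longrightarrow> positive_kernel_operator M k" "f \<in> borel_measurable M"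
  shows "foldr (nn_op M) ks f \<in> borel_measurable M"
  using assms by (induction ks) (auto intro!: nn_op_measurable simp: positive_kernel_operator_iff)

lemma nn_op_kernel_comp_list:
  assumes "ks \<noteq> []" "\<And>k. k \<in> set ks \<Longrightarrow> positive_kernel_operator M k" and f: "f \<in> borel_measurable M"
  shows "AE x in M. nn_op M (kernel_comp_list M ks) f x = foldr (nn_op M) ks f x"
  using assms(1,2)
proof (induction ks)
  case (Cons k ks)
  show ?case
  proof (cases ks)
    case Nil
    then show ?thesis by simp
  next
    case (Cons h hs)
    have ne: "ks \<noteq> []" using Cons by simp
    have "AE x in M. nn_op M (kernel_comp M k (kernel_comp_list M ks)) f x =
        nn_op M k (nn_op M (kernel_comp_list M ks) f) x"
      using Cons.prems ne by (intro nn_op_kernel_comp f positive_kernel_operator_comp_list) auto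
    moreover have "nn_op M k (nn_op M (kernel_comp_list M ks) f) x = nn_op M k (foldr (nn_op M) ks f) x" for x
      using Cons.IH Cons.prems ne by (intro nn_op_cong_AE) auto
    ultimately show ?thesis unfolding Cons by simp
  qed
qed simp

end

section \<open>Norm and spectral radius of Hadamard geometric means\<close>

lemma power_two_power_Suc: "x ^ (2 ^ Suc j) = (x ^ (2 ^ j))\<^sup>2" for x :: real
  by (simp add: power_mult[symmetric] mult.commute)

text \<open>
  Iteration gives \<open>\<beta> 1 ^ (2 ^ j) \<le> s ^ (2 ^ j - 1) * \<beta> (2 ^ j)\<close>, and roots of order \<open>2 ^ j\<close> remove the
  constant \<open>D\<close> in the limit.
\<close>

lemma first_le_of_doubling:
  fixes \<beta> :: "nat \<Rightarrow> real"
  assumes "0 < s" "0 < c" and nn: "\<And>n. 0 \<le> \<beta> n" and dbl: "\<And>n. (\<beta> n)\<^sup>2 \<le> s * \<beta> (2 * n)"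
    and gr: "\<And>n. \<beta> n \<le> D * c ^ n"
  shows "\<beta> 1 \<le> s * c"
proof (rule ccontr)
  assume neg: "\<not> \<beta> 1 \<le> s * c"
  define \<gamma> where "\<gamma> n = \<beta> n / (s * c ^ n)" for n
  have g0: "0 \<le> \<gamma> n" for n using assms by (simp add: \<gamma>_def)
  have g2: "(\<gamma> n)\<^sup>2 \<le> \<gamma> (2 * n)" for n
  proof -
    have "(\<gamma> n)\<^sup>2 = (\<beta> n)\<^sup>2 / (s * c ^ n)\<^sup>2" by (simp add: \<gamma>_def power_divide)
    also have "\<dots> \<le> (s * \<beta> (2 * n)) / (s * c ^ n)\<^sup>2" by (intro divide_right_mono dbl) auto
    also have "\<dots> = \<gamma> (2 * n)"
      using assms(1,2) by (simp add: \<gamma>_def power2_eq_square mult_2 power_add)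
    finally show ?thesis .
  qed
  have "\<gamma> 1 ^ (2 ^ j) \<le> \<gamma> (2 ^ j)" for j
  proof (induction j)
    case (Suc j)
    have "\<gamma> 1 ^ (2 ^ Suc j) = (\<gamma> 1 ^ (2 ^ j))\<^sup>2" by (rule power_two_power_Suc)
    also have "\<dots> \<le> (\<gamma> (2 ^ j))\<^sup>2" using Suc.IH g0 by (intro power_mono) auto
    also have "\<dots> \<le> \<gamma> (2 ^ Suc j)" using g2[of "2 ^ j"] by simp
    finally show ?case .
  qed simp
  moreover have "\<gamma> n \<le> D / s" for n
  proof -
    have "\<gamma> n \<le> (D * c ^ n) / (s * c ^ n)"
      unfolding \<gamma>_def using assms by (intro divide_right_mono) auto
    then show ?thesis using assms by simp
  qed
  ultimately have bd: "\<gamma> 1 ^ (2 ^ j) \<le> D / s" for j using order_trans by blast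
  have g1: "1 < \<gamma> 1" using neg assms by (simp add: \<gamma>_def field_simps)
  obtain j where "D / s < \<gamma> 1 ^ j" using real_arch_pow[OF g1] by blast
  also have "\<gamma> 1 ^ j \<le> \<gamma> 1 ^ (2 ^ j)" using g1 by (intro power_increasing) (auto intro: less_imp_le)
  finally show False using bd[of j] by simp
qed

lemma bij_betw_endo:
  assumes "finite A" "inj_on f A" "f ` A \<subseteq> A"
  shows "bij_betw f A A"
  using assms by (simp add: bij_betw_def endo_inj_surj)

lemma bij_betw_cyclic_shift:
  fixes m l :: nat
  assumes "l < m"
  shows "bij_betw (\<lambda>i. if i + l \<le> m then i + l else i + l - m) {1..m} {1..m}"
proof (rule bij_betw_endo)
  show "inj_on (\<lambda>i. if i + l \<le> m then i + l else i + l - m) {1..m}"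
    by (rule inj_onI) (auto split: if_splits)
qed (use assms in auto)

text \<open>
  The \<open>m\<close> products \<open>H (p i)\<^sup>* H (q i)\<close> contain every kernel exactly once on the left and exactly
  once on the right. This is why Hoelder's inequality can be applied to \<open>K\<^sup>*K\<close> for a Hadamard mean \<open>K\<close>
  of the \<open>H i\<close>.
\<close>

lemma A_ops_reindex:
  assumes m: "even m" and \<tau>: "\<tau> permutes {1..m}"
  obtains p q where "bij_betw p {1..m} {1..m}" "bij_betw q {1..m} {1..m}"
    "\<And>H. A_ops M m \<tau> H = (\<lambda>i. kernel_comp M (kernel_adjoint (H (p i))) (H (q i)))"
proof -
  obtain h where h: "m = 2 * h" using m by blast
  define p where "p i = \<tau> (if i \<le> h then 2 * i - 1 else 2 * (i - h))" for i
  define q where "q i = \<tau> (if i \<le> h then 2 * i else 2 * (i - h) - 1)" for i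
  have "bij_betw (\<lambda>i. if i \<le> h then 2 * i - 1 else 2 * (i - h)) {1..m} {1..m}"
    unfolding h by (rule bij_betw_endo) (auto intro!: inj_onI split: if_splits; presburger)+
  then have p: "bij_betw p {1..m} {1..m}"
    unfolding p_def[abs_def]
    using bij_betw_trans[OF _ permutes_imp_bij[OF \<tau>]] by (simp add: o_def)
  have "bij_betw (\<lambda>i. if i \<le> h then 2 * i else 2 * (i - h) - 1) {1..m} {1..m}"
    unfolding h by (rule bij_betw_endo) (auto intro!: inj_onI split: if_splits; presburger)+
  then have q: "bij_betw q {1..m} {1..m}"
    unfolding q_def[abs_def]
    using bij_betw_trans[OF _ permutes_imp_bij[OF \<tau>]] by (simp add: o_def)
  have A: "A_ops M m \<tau> H = (\<lambda>i. kernel_comp M (kernel_adjoint (H (p i))) (H (q i)))" for H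
    by (intro ext) (simp add: A_ops_def h p_def q_def Let_def)
  show ?thesis using that[OF p q A] .
qed

context sigma_finite_measure
begin

interpretation P: pair_sigma_finite M M ..

text \<open>
  By Gelfand's formula radii are compared by comparing the growth of powers.
\<close>

lemma kernel_radius_le_if_growth_transfers:
  assumes k: "positive_kernel_operator M k" and h: "positive_kernel_operator M h"
    and "\<And>c. 0 < c \<Longrightarrow> growth M (nn_op M h) c \<Longrightarrow> growth M (nn_op M k) c"
  shows "kernel_radius M k \<le> kernel_radius M h"
proof (rule dense_ge)
  fix c assume "kernel_radius M h < c"
  then show "kernel_radius M k \<le> c"
    using growth_above_kernel_radius[OF h] assms(3) kernel_radius_le_growth_rate[OF k] by blast
qed

lemma kernel_radius_mono:
  assumes "positive_kernel_operator M k" "positive_kernel_operator M h"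
    and "AE (x, y) in M \<Otimes>\<^sub>M M. k x y \<le> h x y"
  shows "kernel_radius M k \<le> kernel_radius M h"
  using growth_kernel_mono[OF assms(3)] by (intro kernel_radius_le_if_growth_transfers assms)

text \<open>
  With \<open>F = K\<^sup>*K\<close> one has \<open>\<parallel>K f\<parallel>\<^sup>2 = \<langle>f, F f\<rangle>\<close>. The numbers \<open>\<beta> n = \<langle>f, F\<^sup>n f\<rangle>\<close> satisfy
  \<open>(\<beta> n)\<^sup>2 \<le> \<parallel>f\<parallel>\<^sup>2 \<parallel>F\<^sup>n f\<parallel>\<^sup>2 = \<parallel>f\<parallel>\<^sup>2 \<beta> (2 n)\<close> because \<open>F\<close> is symmetric, so their first value is bounded
  by their growth rate.
\<close>

lemma L2_bound_sqrt_of_growth: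
  assumes k: "positive_kernel_operator M k" and c: "0 < c"
    and gr: "growth M (nn_op M (kernel_adjoint k) \<circ> nn_op M k) c"
  shows "L2_bound M (nn_op M k) (sqrt c)"
  unfolding L2_bound_def
proof
  fix f :: "'a \<Rightarrow> ennreal" assume f[measurable]: "f \<in> borel_measurable M"
  have m[measurable]: "case_prod k \<in> borel_measurable (M \<Otimes>\<^sub>M M)"
    using k by (simp add: positive_kernel_operator_iff)
  have m'[measurable]: "case_prod (kernel_adjoint k) \<in> borel_measurable (M \<Otimes>\<^sub>M M)"
    unfolding kernel_adjoint_def[abs_def] by measurable
  define F where "F = nn_op M (kernel_adjoint k) \<circ> nn_op M k"
  have F: "F g x = nn_op M (kernel_adjoint k) (nn_op M k g) x" for g x by (simp add: F_def)
  have Fm: "F g \<in> borel_measurable M" if [measurable]: "g \<in> borel_measurable M" for g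
    unfolding F_def by simp
  have Fn[measurable]: "(F ^^ n) g \<in> borel_measurable M" if "g \<in> borel_measurable M" for g n
    by (rule funpow_measurable[OF Fm that])
  have sym1: "(\<integral>\<^sup>+x. F g x * h x \<partial>M) = (\<integral>\<^sup>+x. g x * F h x \<partial>M)"
    if [measurable]: "g \<in> borel_measurable M" "h \<in> borel_measurable M" for g h
  proof -
    have [simp]: "kernel_adjoint (kernel_adjoint k) = k" by (intro ext) (simp add: kernel_adjoint_def)
    show ?thesis by (simp add: nn_op_adjoint F)
  qed
  have sym: "(\<integral>\<^sup>+x. (F ^^ n) g x * h x \<partial>M) = (\<integral>\<^sup>+x. g x * (F ^^ n) h x \<partial>M)"
    if [measurable]: "g \<in> borel_measurable M" "h \<in> borel_measurable M" for g h n
    using that(2)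
  proof (induction n arbitrary: h)
    case (Suc n)
    note [measurable] = Suc.prems
    have "(\<integral>\<^sup>+x. (F ^^ Suc n) g x * h x \<partial>M) = (\<integral>\<^sup>+x. (F ^^ n) g x * F h x \<partial>M)"
      using sym1[OF Fn[OF that(1)] Suc.prems] by simp
    also have "\<dots> = (\<integral>\<^sup>+x. g x * (F ^^ n) (F h) x \<partial>M)" by (rule Suc.IH[OF Fm[OF Suc.prems]])
    finally show ?case by (simp only: funpow_Suc_right o_apply)
  qed simp
  obtain C where C: "\<And>n. L2_bound M (F ^^ n) (C * c ^ n)" using gr by (auto simp: growth_def F_def)
  show "sq_norm M (nn_op M k f) \<le> ennreal ((sqrt c)\<^sup>2) * sq_norm M f"
  proof (cases "sq_norm M f = 0 \<or> sq_norm M f = \<infinity>")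
    case True
    then show ?thesis
    proof
      assume "sq_norm M f = 0"
      then show ?thesis
        using k L2_boundD[of M "nn_op M k" _ f] f by (auto simp: positive_kernel_operator_iff)
    qed (use c in \<open>simp add: ennreal_mult_top\<close>)
  next
    case False
    define s where "s = enn2real (sq_norm M f)"
    have s: "sq_norm M f = ennreal s" "0 < s"
      using False by (auto simp: s_def enn2real_positive_iff less_top zero_less_iff_neq_zero)
    define b where "b n = (\<integral>\<^sup>+x. f x * (F ^^ n) f x \<partial>M)" for n
    have CS: "(b n)\<^sup>2 \<le> sq_norm M f * sq_norm M ((F ^^ n) f)" for n
      unfolding b_def sq_norm_def by (rule Cauchy_Schwarz_nn_integral) (simp_all add: Fn)
    have sqF: "sq_norm M ((F ^^ n) f) = b (2 * n)" for n
    proof -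
      have "sq_norm M ((F ^^ n) f) = (\<integral>\<^sup>+x. f x * (F ^^ n) ((F ^^ n) f) x \<partial>M)"
        unfolding sq_norm_def power2_eq_square by (rule sym) (simp_all add: Fn)
      then show ?thesis by (simp add: b_def mult_2 funpow_add)
    qed
    have bnd: "(b n)\<^sup>2 \<le> ennreal ((s * (\<bar>C\<bar> * c ^ n))\<^sup>2)" for n
    proof -
      have "(b n)\<^sup>2 \<le> sq_norm M f * (ennreal ((C * c ^ n)\<^sup>2) * sq_norm M f)"
        using order_trans[OF CS[of n] mult_left_mono[OF L2_boundD[OF C f]]] by simp
      also have "\<dots> = ennreal ((s * (\<bar>C\<bar> * c ^ n))\<^sup>2)"
        using s by (simp add: ennreal_mult[symmetric] power_mult_distrib)
          (simp add: power2_eq_square mult_ac)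
      finally show ?thesis .
    qed
    define \<beta> where "\<beta> n = enn2real (b n)" for n
    have \<beta>: "b n = ennreal (\<beta> n)" "0 \<le> \<beta> n" for n
    proof -
      have "b n \<noteq> top"
      proof
        assume "b n = top"
        then show False using bnd[of n] by (simp add: power2_eq_square top_unique)
      qed
      then show "b n = ennreal (\<beta> n)" "0 \<le> \<beta> n" by (auto simp: \<beta>_def less_top)
    qed
    have "\<beta> 1 \<le> s * c"
    proof (rule first_le_of_doubling[OF s(2) c, where D = "s * \<bar>C\<bar>"])
      fix n
      show "0 \<le> \<beta> n" by (rule \<beta>)
      have "ennreal ((\<beta> n)\<^sup>2) \<le> ennreal (s * \<beta> (2 * n))"
        using CS[of n] s \<beta> by (simp add: sqF ennreal_power ennreal_mult)
      then show "(\<beta> n)\<^sup>2 \<le> s * \<beta> (2 * n)" using s \<beta>(2) by (subst (asm) ennreal_le_iff) auto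
      have "(\<beta> n)\<^sup>2 \<le> (s * (\<bar>C\<bar> * c ^ n))\<^sup>2"
        using bnd[of n] \<beta> by (simp add: ennreal_power ennreal_le_iff)
      then have "\<beta> n \<le> s * (\<bar>C\<bar> * c ^ n)"
        by (rule power2_le_imp_le) (use s c in simp)
      then show "\<beta> n \<le> s * \<bar>C\<bar> * c ^ n" by (simp only: mult.assoc)
    qed
    moreover have "sq_norm M (nn_op M k f) = b 1"
    proof -
      have "sq_norm M (nn_op M k f) = (\<integral>\<^sup>+x. f x * nn_op M (kernel_adjoint k) (nn_op M k f) x \<partial>M)"
        unfolding sq_norm_def power2_eq_square by (rule nn_op_adjoint) measurable
      then show ?thesis by (simp add: b_def F)
    qed
    ultimately show ?thesis
      using s c \<beta>[of 1] by (simp add: ennreal_mult[symmetric] ennreal_leI mult.commute)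
  qed
qed

text \<open>
  \<open>\<parallel>K\<parallel>\<^sup>2 = r(K\<^sup>*K) \<le> r(h)\<close>.
\<close>

lemma kernel_norm_le_sqrt_radius:
  assumes k: "positive_kernel_operator M k" and h: "positive_kernel_operator M h"
    and le: "AE (x, y) in M \<Otimes>\<^sub>M M. kernel_comp M (kernel_adjoint k) k x y \<le> h x y"
  shows "kernel_norm M k \<le> sqrt (kernel_radius M h)"
proof (rule dense_ge)
  fix d assume d: "sqrt (kernel_radius M h) < d"
  then have d0: "0 \<le> d" using kernel_radius_nonneg[OF h] by (meson le_less_trans less_imp_le real_sqrt_ge_zero)
  have "kernel_radius M h = (sqrt (kernel_radius M h))\<^sup>2" using kernel_radius_nonneg[OF h] by simp
  also have "\<dots> < d\<^sup>2" using d kernel_radius_nonneg[OF h] by (intro power_strict_mono) auto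
  finally have rd: "kernel_radius M h < d\<^sup>2" .
  note c = growth_above_kernel_radius[OF h rd]
  have m: "case_prod k \<in> borel_measurable (M \<Otimes>\<^sub>M M)"
      "case_prod (kernel_adjoint k) \<in> borel_measurable (M \<Otimes>\<^sub>M M)"
    using k positive_kernel_operator_adjoint[OF k] by (auto simp: positive_kernel_operator_iff)
  define F where "F = nn_op M (kernel_adjoint k) \<circ> nn_op M k"
  have F: "F g x = nn_op M (kernel_adjoint k) (nn_op M k g) x" for g x by (simp add: F_def)
  have iter: "AE x in M. (F ^^ n) f x \<le> (nn_op M h ^^ n) f x" if f: "f \<in> borel_measurable M" for f n
  proof (induction n)
    case (Suc n)
    let ?g = "(F ^^ n) f"
    have g: "?g \<in> borel_measurable M"
      by (rule funpow_measurable[OF _ f]) (simp add: F_def nn_op_measurable m)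
    have "AE x in M. F ?g x \<le> nn_op M h ?g x"
      using nn_op_kernel_comp[OF positive_kernel_operator_adjoint[OF k] k g] nn_op_kernel_mono_AE[OF le, of ?g]
      by eventually_elim (simp add: F)
    then show ?case
      by eventually_elim (auto intro: order_trans nn_op_mono_AE[OF Suc.IH])
  qed simp
  obtain C where C: "\<And>n. L2_bound M (nn_op M h ^^ n) (C * (d\<^sup>2) ^ n)"
    using c by (auto simp: growth_def)
  have "L2_bound M (F ^^ n) (C * (d\<^sup>2) ^ n)" for n
    unfolding L2_bound_def
    using sq_norm_mono_AE[OF iter] L2_boundD[OF C] order_trans by blast
  then have "growth M F (d\<^sup>2)" unfolding growth_def by blast
  then have "growth M (nn_op M (kernel_adjoint k) \<circ> nn_op M k) (d\<^sup>2)" by (simp only: F_def)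
  then have "L2_bound M (nn_op M k) (sqrt (d\<^sup>2))" by (rule L2_bound_sqrt_of_growth[OF k c(1)])
  then show "kernel_norm M k \<le> d" using d0 by (intro kernel_norm_le k) auto
qed

lemma A_ops_positive:
  assumes "even m" "\<tau> permutes {1..m}" and i: "i \<in> {1..m}"
    and H: "\<And>i. i \<in> {1..m} \<Longrightarrow> positive_kernel_operator M (H i)"
  shows "positive_kernel_operator M (A_ops M m \<tau> H i)"
proof -
  obtain p q where pq: "bij_betw p {1..m} {1..m}" "bij_betw q {1..m} {1..m}"
    and A: "\<And>H. A_ops M m \<tau> H = (\<lambda>i. kernel_comp M (kernel_adjoint (H (p i))) (H (q i)))"
    using A_ops_reindex[OF assms(1,2), of M] by metis
  have "p i \<in> {1..m}" "q i \<in> {1..m}" using pq i by (auto dest: bij_betwE)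
  then show ?thesis
    unfolding A by (intro positive_kernel_operator_comp positive_kernel_operator_adjoint H)
qed

text \<open>
  A Hadamard mean does not depend on the order of the kernels. So in \<open>K\<^sup>*K\<close> the left factor can be
  written with the order \<open>p\<close> and the right factor with the order \<open>q\<close>, and Hoelder's inequality
  produces the mean of the \<open>A i\<close>.
\<close>

lemma kernel_norm_hadamard_mean_le_A_ops:
  assumes m: "0 < m" "even m" and \<tau>: "\<tau> permutes {1..m}"
    and H: "\<And>i. i \<in> {1..m} \<Longrightarrow> positive_kernel_operator M (H i)"
  shows "kernel_norm M (hadamard_mean m H) \<le> sqrt (kernel_radius M (hadamard_mean m (A_ops M m \<tau> H)))"
proof -
  obtain p q where p: "bij_betw p {1..m} {1..m}" and q: "bij_betw q {1..m} {1..m}"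
    and A: "\<And>H. A_ops M m \<tau> H = (\<lambda>i. kernel_comp M (kernel_adjoint (H (p i))) (H (q i)))"
    using A_ops_reindex[OF m(2) \<tau>, of M] by metis
  have Hp: "positive_kernel_operator M (H (p i))" and Hq: "positive_kernel_operator M (H (q i))"
    if "i \<in> {1..m}" for i
    using bij_betwE[OF p] bij_betwE[OF q] that by (simp_all add: H)
  have HA: "positive_kernel_operator M (A_ops M m \<tau> H i)" if "i \<in> {1..m}" for i
    by (rule A_ops_positive[OF m(2) \<tau> that H])
  have "AE (x, y) in M \<Otimes>\<^sub>M M. kernel_comp M (hadamard_mean m (\<lambda>i. kernel_adjoint (H (p i))))
      (hadamard_mean m (\<lambda>i. H (q i))) x y \<le>
      hadamard_mean m (\<lambda>i. kernel_comp M (kernel_adjoint (H (p i))) (H (q i))) x y"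
    by (intro kernel_comp_hadamard_mean_le m positive_kernel_operator_adjoint Hp Hq)
  moreover have "hadamard_mean m (\<lambda>i. kernel_adjoint (H (p i))) = kernel_adjoint (hadamard_mean m H)"
    using hadamard_mean_permute[OF p, of H] kernel_adjoint_hadamard_mean[of m "\<lambda>i. H (p i)"] by simp
  moreover have "hadamard_mean m (\<lambda>i. H (q i)) = hadamard_mean m H" by (rule hadamard_mean_permute[OF q])
  ultimately have "AE (x, y) in M \<Otimes>\<^sub>M M.
      kernel_comp M (kernel_adjoint (hadamard_mean m H)) (hadamard_mean m H) x y \<le>
      hadamard_mean m (A_ops M m \<tau> H) x y"
    unfolding A by simp
  then show ?thesis
    by (intro kernel_norm_le_sqrt_radius positive_kernel_operator_hadamard_mean m H HA)
qed

lemma foldr_replicate_nn_op: "foldr (nn_op M) (replicate n k) = nn_op M k ^^ n"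
  by (induction n) auto

text \<open>
  The powers of the mean are at most the means of the powers of the \<open>L i\<close>, which are at most the sums of
  these powers.
\<close>

lemma kernel_radius_hadamard_mean_le:
  assumes m: "0 < m" and L: "\<And>i. i \<in> {1..m} \<Longrightarrow> positive_kernel_operator M (L i)"
    and r: "\<And>i. i \<in> {1..m} \<Longrightarrow> kernel_radius M (L i) \<le> r"
  shows "kernel_radius M (hadamard_mean m L) \<le> r"
proof (rule dense_ge)
  fix c assume rc: "r < c"
  have gr: "growth M (nn_op M (L i)) c" if "i \<in> {1..m}" for i
    using growth_above_kernel_radius[OF L[OF that], of c] r[OF that] rc by auto
  have c: "0 < c" using growth_above_kernel_radius(1)[OF L, of 1 c] r[of 1] m rc by auto
  have "\<forall>i\<in>{1..m}. \<exists>C. \<forall>n. L2_bound M (nn_op M (L i) ^^ n) (C * c ^ n)"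
    using gr by (simp add: growth_def)
  then obtain C where C: "\<And>i n. i \<in> {1..m} \<Longrightarrow> L2_bound M (nn_op M (L i) ^^ n) (C i * c ^ n)" by metis
  \<comment> \<open>A common constant for all \<open>L i\<close>; it is at least \<open>1\<close> so that it also covers the power \<open>0\<close>.\<close>
  define D where "D = 1 + (\<Sum>i=1..m. \<bar>C i\<bar>)"
  have D1: "1 \<le> D" by (simp add: D_def sum_nonneg)
  have CD: "\<bar>C i\<bar> \<le> D" if "i \<in> {1..m}" for i
    using member_le_sum[of i "{1..m}" "\<lambda>i. \<bar>C i\<bar>"] that by (simp add: D_def)
  let ?Q = "hadamard_mean m L"
  have Q: "positive_kernel_operator M ?Q" by (rule positive_kernel_operator_hadamard_mean[OF m L])
  have "L2_bound M (nn_op M ?Q ^^ n) ((real m * D) * c ^ n)" for n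
  proof (cases "n = 0")
    case True
    have "1 * 1 \<le> real m * D" using m D1 by (intro mult_mono) auto
    moreover have "L2_bound M (nn_op M ?Q ^^ n) 1" using True by (simp add: L2_bound_def)
    ultimately show ?thesis using True by (auto intro: L2_bound_mono)
  next
    case False
    let ?R = "\<lambda>k. kernel_comp_list M (replicate n k)"
    have ne: "replicate n k \<noteq> []" for k :: "'a \<Rightarrow> 'a \<Rightarrow> real" using False by simp
    have RL: "positive_kernel_operator M (?R (L i))" if "i \<in> {1..m}" for i
      using L[OF that] by (intro positive_kernel_operator_comp_list ne) auto
    have it: "AE x in M. nn_op M (?R k) f x = (nn_op M k ^^ n) f x"
      if "positive_kernel_operator M k" "f \<in> borel_measurable M" for k f
      using nn_op_kernel_comp_list[OF ne[of k] _ that(2)] that(1) by (simp add: foldr_replicate_nn_op)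
    have RQ: "AE (x, y) in M \<Otimes>\<^sub>M M. ?R ?Q x y \<le> hadamard_mean m (\<lambda>i. ?R (L i)) x y"
      using kernel_comp_list_hadamard_mean_le[OF m, of "replicate n L"] False L by simp
    have le: "AE (x, y) in M \<Otimes>\<^sub>M M. ?R ?Q x y \<le> (\<Sum>i=1..m. ?R (L i) x y)"
    proof -
      have "AE (x, y) in M \<Otimes>\<^sub>M M. hadamard_mean m (\<lambda>i. ?R (L i)) x y \<le> (\<Sum>i=1..m. ?R (L i) x y)"
        by (rule hadamard_mean_le_sum[OF m]) (rule RL)
      with RQ show ?thesis by eventually_elim auto
    qed
    have "L2_bound M (nn_op M (?R ?Q)) (real (card {1..m}) * (D * c ^ n))"
    proof (rule L2_bound_dominated_sum[OF _ _ _ le])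
      fix i assume i: "i \<in> {1..m}"
      have "L2_bound M (nn_op M (?R (L i))) (C i * c ^ n)"
        unfolding L2_bound_def using L2_boundD[OF C[OF i]] sq_norm_cong_AE[OF it[OF L[OF i]]] by simp
      then show "L2_bound M (nn_op M (?R (L i))) (D * c ^ n)"
        using CD[OF i] D1 c by (elim L2_bound_mono) (auto simp: abs_mult intro!: mult_right_mono)
    qed (use RL in \<open>auto simp: positive_kernel_operator_iff\<close>)
    then show ?thesis
      unfolding L2_bound_def using sq_norm_cong_AE[OF it[OF Q]] by (simp add: mult.assoc)
  qed
  then have "growth M (nn_op M ?Q) c" unfolding growth_def by blast
  then show "kernel_radius M ?Q \<le> c" by (rule kernel_radius_le_growth_rate[OF Q _ c])
qed

lemma foldr_nn_op_cong_AE: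
  "AE x in M. f x = g x \<Longrightarrow> AE x in M. foldr (nn_op M) ks f x = foldr (nn_op M) ks g x"
  by (induction ks) (auto intro!: AE_I2 nn_op_cong_AE)

lemma growth_kernel_comp_list:
  assumes ne: "ks \<noteq> []" and ks: "\<And>k. k \<in> set ks \<Longrightarrow> positive_kernel_operator M k"
  shows "growth M (nn_op M (kernel_comp_list M ks)) c \<longleftrightarrow> growth M (foldr (nn_op M) ks) c"
proof -
  let ?K = "nn_op M (kernel_comp_list M ks)" and ?F = "foldr (nn_op M) ks"
  have K: "positive_kernel_operator M (kernel_comp_list M ks)"
    by (rule positive_kernel_operator_comp_list[OF ne ks])
  have "AE x in M. (?K ^^ n) f x = (?F ^^ n) f x" if f: "f \<in> borel_measurable M" for f n
  proof (induction n)
    case (Suc n)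
    have "(?K ^^ n) f \<in> borel_measurable M"
      using K f by (intro nn_op_funpow_measurable) (auto simp: positive_kernel_operator_iff)
    then have "AE x in M. ?K ((?K ^^ n) f) x = ?F ((?K ^^ n) f) x"
      by (intro nn_op_kernel_comp_list ne ks)
    with foldr_nn_op_cong_AE[OF Suc.IH, of ks]
    show ?case by eventually_elim simp
  qed simp
  then have "sq_norm M ((?K ^^ n) f) = sq_norm M ((?F ^^ n) f)" if "f \<in> borel_measurable M" for f n
    using that by (intro sq_norm_cong_AE)
  then show ?thesis unfolding growth_def L2_bound_def by simp
qed

text \<open>
  \<open>(U V)\<^bsup>k+1\<^esup> = U (V U)\<^sup>k V\<close>.
\<close>

lemma growth_cyclic:
  assumes U: "L2_bound M U u" "\<And>f. f \<in> borel_measurable M \<Longrightarrow> U f \<in> borel_measurable M"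
    and V: "L2_bound M V v" "\<And>f. f \<in> borel_measurable M \<Longrightarrow> V f \<in> borel_measurable M"
    and c: "0 < c" and gr: "growth M (V \<circ> U) c"
  shows "growth M (U \<circ> V) c"
proof -
  obtain C where C: "\<And>n. L2_bound M ((V \<circ> U) ^^ n) (C * c ^ n)" using gr by (auto simp: growth_def)
  \<comment> \<open>The summand \<open>1\<close> in the constant is for the power \<open>0\<close>.\<close>
  have "L2_bound M ((U \<circ> V) ^^ n) ((1 + \<bar>u * C * v\<bar> / c) * c ^ n)" for n
  proof (cases n)
    case 0
    have "L2_bound M ((U \<circ> V) ^^ n) 1" using 0 by (simp add: L2_bound_def)
    then show ?thesis using 0 c by (auto intro: L2_bound_mono)
  next
    case (Suc k)
    have shift: "((U \<circ> V) ^^ Suc k) f = U (((V \<circ> U) ^^ k) (V f))" for f k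
    proof -
      define S T where "S = U \<circ> V" and "T = V \<circ> U"
      have S: "S g = U (V g)" and T: "T g = V (U g)" for g by (simp_all add: S_def T_def)
      have "(S ^^ Suc k) f = U ((T ^^ k) (V f))" by (induction k) (simp_all add: S T)
      then show ?thesis by (simp only: S_def T_def)
    qed
    have "(U \<circ> V) ^^ Suc k = (U \<circ> (V \<circ> U) ^^ k) \<circ> V"
      by (intro ext) (simp only: shift o_apply)
    moreover have "L2_bound M ((U \<circ> (V \<circ> U) ^^ k) \<circ> V) (u * (C * c ^ k) * v)"
      using U V by (intro L2_bound_comp C funpow_measurable) auto
    ultimately have "L2_bound M ((U \<circ> V) ^^ n) (u * (C * c ^ k) * v)" by (simp only: Suc)
    moreover have "\<bar>u * (C * c ^ k) * v\<bar> = \<bar>u * C * v\<bar> / c * c ^ n"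
      using c Suc by (simp add: abs_mult)
    moreover have "\<dots> \<le> (1 + \<bar>u * C * v\<bar> / c) * c ^ n"
      using c by (intro mult_right_mono) auto
    ultimately show ?thesis by (auto elim!: L2_bound_mono)
  qed
  then show ?thesis unfolding growth_def by blast
qed

lemma kernel_radius_comp_list_cyclic:
  assumes ne: "us @ vs \<noteq> []" and pos: "\<And>k. k \<in> set us \<union> set vs \<Longrightarrow> positive_kernel_operator M k"
  shows "kernel_radius M (kernel_comp_list M (us @ vs)) \<le> kernel_radius M (kernel_comp_list M (vs @ us))"
proof -
  have bd: "\<exists>c. L2_bound M (foldr (nn_op M) ks) c"
    if pk: "\<And>k. k \<in> set ks \<Longrightarrow> positive_kernel_operator M k" for ks
  proof (cases "ks = []")
    case True
    have "L2_bound M (foldr (nn_op M) ks) 1" using True by (simp add: L2_bound_def)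
    then show ?thesis by blast
  next
    case False
    obtain c where "L2_bound M (nn_op M (kernel_comp_list M ks)) c"
      using positive_kernel_operator_comp_list[OF False pk] by (auto simp: positive_kernel_operator_iff)
    then have "L2_bound M (foldr (nn_op M) ks) c"
      unfolding L2_bound_def using sq_norm_cong_AE[OF nn_op_kernel_comp_list[OF False pk]] by simp
    then show ?thesis by blast
  qed
  obtain u v where uv: "L2_bound M (foldr (nn_op M) us) u" "L2_bound M (foldr (nn_op M) vs) v"
    using bd[of us] bd[of vs] pos by auto
  have gr: "growth M (nn_op M (kernel_comp_list M (us @ vs))) c"
    if c: "0 < c" and "growth M (nn_op M (kernel_comp_list M (vs @ us))) c" for c
  proof -
    have "growth M (foldr (nn_op M) vs \<circ> foldr (nn_op M) us) c"
      using that(2) ne pos by (subst (asm) growth_kernel_comp_list) (auto simp: foldr_append[abs_def] o_def)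
    then have "growth M (foldr (nn_op M) us \<circ> foldr (nn_op M) vs) c"
      using pos by (intro growth_cyclic[OF uv(1) _ uv(2) _ c] foldr_nn_op_measurable) auto
    then show ?thesis
      using ne pos by (subst growth_kernel_comp_list) (auto simp: foldr_append[abs_def] o_def)
  qed
  show ?thesis
    using ne pos by (intro kernel_radius_le_if_growth_transfers positive_kernel_operator_comp_list gr) auto
qed

lemma upt_cyclic_nth:
  assumes "i \<in> {1..m}"
  shows "[i..<m + 1] @ [1..<i] = map (\<lambda>l. if i + l \<le> m then i + l else i + l - m) [0..<m]"
  using assms by (intro nth_equalityI) (auto simp: nth_append)

lemma P_ops_positive:
  assumes "\<nu> permutes {1..m}" "i \<in> {1..m}" "\<And>i. i \<in> {1..m} \<Longrightarrow> positive_kernel_operator M (A i)"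
  shows "positive_kernel_operator M (P_ops M m \<nu> A i)"
  unfolding P_ops_def
proof (rule positive_kernel_operator_comp_list)
  fix k assume "k \<in> set (map (\<lambda>l. A (\<nu> l)) ([i..<m + 1] @ [1..<i]))"
  then obtain l where l: "k = A (\<nu> l)" "l \<in> {1..m}" using assms(2) by auto
  then have "\<nu> l \<in> {1..m}" by (simp only: permutes_in_image[OF assms(1)])
  then show "positive_kernel_operator M k" unfolding l(1) by (rule assms(3))
qed (use assms in auto)

text \<open>
  The power \<open>(hm A)\<^sup>m\<close> is a product of means in which the factor with number \<open>l\<close> lists the \<open>A i\<close> in the
  order of \<open>\<nu>\<close> shifted cyclically by \<open>l\<close>. In position \<open>i\<close> the composition of these lists is \<open>P i\<close>, so
  Hoelder's inequality gives \<open>(hm A)\<^sup>m \<le> hm P\<close>.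
\<close>

lemma kernel_radius_hadamard_mean_power_le_P_ops:
  assumes m: "0 < m" and \<nu>: "\<nu> permutes {1..m}"
    and A: "\<And>i. i \<in> {1..m} \<Longrightarrow> positive_kernel_operator M (A i)"
  shows "kernel_radius M (hadamard_mean m A) ^ m \<le> kernel_radius M (hadamard_mean m (P_ops M m \<nu> A))"
proof -
  let ?B = "hadamard_mean m A" and ?Q = "hadamard_mean m (P_ops M m \<nu> A)"
  define cyc where "cyc l i = (if i + l \<le> m then i + l else i + l - m)" for l i
  have B: "positive_kernel_operator M ?B" by (rule positive_kernel_operator_hadamard_mean[OF m A])
  have Q: "positive_kernel_operator M ?Q"
    by (rule positive_kernel_operator_hadamard_mean[OF m P_ops_positive[OF \<nu> _ A]])
  have cyc: "bij_betw (\<lambda>i. \<nu> (cyc l i)) {1..m} {1..m}" if "l < m" for l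
    using bij_betw_trans[OF bij_betw_cyclic_shift[OF that] permutes_imp_bij[OF \<nu>]]
    by (simp add: o_def cyc_def)
  let ?Ks = "map (\<lambda>l i. A (\<nu> (cyc l i))) [0..<m]"
  have "AE (x, y) in M \<Otimes>\<^sub>M M. kernel_comp_list M (map (hadamard_mean m) ?Ks) x y \<le>
      hadamard_mean m (\<lambda>i. kernel_comp_list M (map (\<lambda>K. K i) ?Ks)) x y"
  proof (rule kernel_comp_list_hadamard_mean_le[OF m])
    fix K i assume "K \<in> set ?Ks" "i \<in> {1..m}"
    then obtain l where "l < m" "K i = A (\<nu> (cyc l i))" by auto
    then show "positive_kernel_operator M (K i)"
      using cyc[of l] \<open>i \<in> {1..m}\<close> by (auto intro!: A simp: bij_betw_def)
  qed (use m in simp)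
  moreover have "map (hadamard_mean m) ?Ks = replicate m ?B"
    using hadamard_mean_permute[OF cyc] by (intro nth_equalityI) auto
  moreover have "hadamard_mean m (\<lambda>i. kernel_comp_list M (map (\<lambda>K. K i) ?Ks)) = ?Q"
  proof (rule hadamard_mean_cong)
    fix i assume "i \<in> {1..m}"
    then show "kernel_comp_list M (map (\<lambda>K. K i) ?Ks) = P_ops M m \<nu> A i"
      unfolding P_ops_def by (simp only: upt_cyclic_nth) (simp add: cyc_def o_def)
  qed
  ultimately have le: "AE (x, y) in M \<Otimes>\<^sub>M M. kernel_comp_list M (replicate m ?B) x y \<le> ?Q x y"
    by simp
  have step: "AE x in M. (nn_op M ?B ^^ m) f x \<le> nn_op M ?Q f x" if f: "f \<in> borel_measurable M" for f
  proof -
    have "AE x in M. nn_op M (kernel_comp_list M (replicate m ?B)) f x = foldr (nn_op M) (replicate m ?B) f x"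
      using m B by (intro nn_op_kernel_comp_list f) auto
    then show ?thesis
      using nn_op_kernel_mono_AE[OF le, of f] by eventually_elim (simp add: foldr_replicate_nn_op)
  qed
  have mB: "case_prod ?B \<in> borel_measurable (M \<Otimes>\<^sub>M M)" using B by (simp add: positive_kernel_operator_iff)
  have iter: "AE x in M. (nn_op M ?B ^^ (m * q)) f x \<le> (nn_op M ?Q ^^ q) f x"
    if f: "f \<in> borel_measurable M" for f q
  proof (induction q)
    case (Suc q)
    have "AE x in M. (nn_op M ?B ^^ m) ((nn_op M ?B ^^ (m * q)) f) x \<le>
        nn_op M ?Q ((nn_op M ?B ^^ (m * q)) f) x"
      by (intro step nn_op_funpow_measurable mB f)
    then show ?case
      by eventually_elim (auto simp: funpow_add intro: order_trans nn_op_mono_AE[OF Suc.IH])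
  qed simp
  show ?thesis
  proof (rule dense_ge)
    fix c assume "kernel_radius M ?Q < c"
    note c = growth_above_kernel_radius[OF Q this]
    define e where "e = root m c"
    have e: "0 < e" "e ^ m = c" using c(1) m by (auto simp: e_def real_root_pow_pos2)
    obtain C where C: "\<And>n. L2_bound M (nn_op M ?Q ^^ n) (C * c ^ n)" using c by (auto simp: growth_def)
    obtain b where b: "L2_bound M (nn_op M ?B) b" using B by (auto simp: positive_kernel_operator_iff)
    have "growth M (nn_op M ?B) e"
    proof (rule growth_of_subsequence[OF nn_op_measurable[OF mB] b m e(1)])
      fix q
      show "L2_bound M (nn_op M ?B ^^ (m * q)) (C * (e ^ m) ^ q)"
        unfolding e(2) L2_bound_def
        using sq_norm_mono_AE[OF iter] L2_boundD[OF C] order_trans by blast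
    qed
    then have "kernel_radius M ?B \<le> e" by (rule kernel_radius_le_growth_rate[OF B _ e(1)])
    then have "kernel_radius M ?B ^ m \<le> e ^ m" using kernel_radius_nonneg[OF B] by (intro power_mono)
    then show "kernel_radius M ?B ^ m \<le> c" by (simp add: e(2))
  qed
qed

lemma kernel_radius_P_ops_le:
  assumes \<nu>: "\<nu> permutes {1..m}" and i: "i \<in> {1..m}"
    and A: "\<And>i. i \<in> {1..m} \<Longrightarrow> positive_kernel_operator M (A i)"
  shows "kernel_radius M (P_ops M m \<nu> A i) \<le>
    kernel_radius M (kernel_comp_list M (map (\<lambda>l. A (\<nu> l)) [1..<m + 1]))"
proof -
  let ?f = "\<lambda>l. A (\<nu> l)"
  have "[1..<i] @ [i..<m + 1] = [1..<m + 1]" using i upt_add_eq_append[of 1 i "m + 1 - i"] by simp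
  moreover have "kernel_radius M (kernel_comp_list M (map ?f [i..<m + 1] @ map ?f [1..<i])) \<le>
      kernel_radius M (kernel_comp_list M (map ?f [1..<i] @ map ?f [i..<m + 1]))"
  proof (rule kernel_radius_comp_list_cyclic)
    fix k assume "k \<in> set (map ?f [i..<m + 1]) \<union> set (map ?f [1..<i])"
    then obtain l where l: "k = A (\<nu> l)" "l \<in> {1..m}" using i by auto
    then have "\<nu> l \<in> {1..m}" by (simp only: permutes_in_image[OF \<nu>])
    then show "positive_kernel_operator M k" unfolding l(1) by (rule A)
  qed (use i in simp)
  ultimately show ?thesis unfolding P_ops_def map_append[symmetric] by simp
qed

end

section \<open>Hadamard powers of nonnegative matrices\<close>

lemma powr_split_one: "1 \<le> s \<Longrightarrow> 0 \<le> a \<Longrightarrow> a powr s = a powr (s - 1) * a" for a s :: real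
  using powr_add[of a "s - 1" 1] by simp

lemma hadamard_prod_power_eq_mean:
  assumes "0 < m"
  shows "hadamard_prod m (\<lambda>i. hadamard_power (K i) \<alpha>) =
    hadamard_mean m (\<lambda>i. hadamard_power (K i) (\<alpha> * real m))"
  using assms by (intro ext) (simp add: hadamard_mean_apply hadamard_prod_def hadamard_power_def powr_powr)

lemma kernel_adjoint_hadamard_power:
  "kernel_adjoint (hadamard_power k s) = hadamard_power (kernel_adjoint k) s"
  by (intro ext) (simp add: kernel_adjoint_def hadamard_power_def)

context sigma_finite_measure
begin

interpretation P: pair_sigma_finite M M ..

lemma L2_bound_scaled:
  assumes h[measurable]: "case_prod h \<in> borel_measurable (M \<Otimes>\<^sub>M M)" and c: "L2_bound M (nn_op M h) c"
    and a: "0 \<le> a" and nn: "AE (x, y) in M \<Otimes>\<^sub>M M. 0 \<le> h x y"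
    and le: "AE (x, y) in M \<Otimes>\<^sub>M M. k x y \<le> a * h x y"
  shows "L2_bound M (nn_op M k) (a * c)"
  unfolding L2_bound_def
proof
  fix f :: "'a \<Rightarrow> ennreal" assume f[measurable]: "f \<in> borel_measurable M"
  have "AE x in M. nn_op M (\<lambda>x y. a * h x y) f x = ennreal a * nn_op M h f x"
    using AE_kernel_slice[OF nn] AE_space
  proof eventually_elim
    case (elim x)
    have [measurable]: "h x \<in> borel_measurable M" using measurable_Pair2[OF h elim(2)] by simp
    have "nn_op M (\<lambda>x y. a * h x y) f x = (\<integral>\<^sup>+y. ennreal a * (ennreal (h x y) * f y) \<partial>M)"
      unfolding nn_op_def using elim(1)
      by (intro nn_integral_cong_AE, elim eventually_mono) (simp add: a ennreal_mult mult.assoc)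
    then show ?case by (simp add: nn_op_def nn_integral_cmult)
  qed
  then have "AE x in M. nn_op M k f x \<le> ennreal a * nn_op M h f x"
    using nn_op_kernel_mono_AE[OF le, of f] by eventually_elim simp
  then have "sq_norm M (nn_op M k f) \<le> sq_norm M (\<lambda>x. ennreal a * nn_op M h f x)"
    by (rule sq_norm_mono_AE)
  also have "\<dots> = ennreal (a\<^sup>2) * sq_norm M (nn_op M h f)" using a by (simp add: sq_norm_cmult ennreal_power)
  also have "\<dots> \<le> ennreal (a\<^sup>2) * (ennreal (c\<^sup>2) * sq_norm M f)"
    by (intro mult_left_mono L2_boundD[OF c f]) auto
  also have "\<dots> = ennreal ((a * c)\<^sup>2) * sq_norm M f"
    by (simp only: power_mult_distrib ennreal_mult zero_le_power2 mult.assoc)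
  finally show "sq_norm M (nn_op M k f) \<le> ennreal ((a * c)\<^sup>2) * sq_norm M f" .
qed

end

context
  fixes R :: "nat set"
begin

interpretation sigma_finite_measure "count_space R"
  by (rule sigma_finite_measure_count_space_countable) simp

abbreviation (input) "MR \<equiv> count_space R"

lemma AE_matrix_iff: "(AE (x, y) in MR \<Otimes>\<^sub>M MR. Q x y) \<longleftrightarrow> (\<forall>x\<in>R. \<forall>y\<in>R. Q x y)"
  by (subst pair_measure_countable) (auto simp: AE_count_space)

lemma matrix_entry_nonneg:
  "positive_kernel_operator MR k \<Longrightarrow> x \<in> R \<Longrightarrow> y \<in> R \<Longrightarrow> 0 \<le> k x y"
  by (simp add: positive_kernel_operator_iff AE_matrix_iff)

lemma matrix_measurable: "case_prod k \<in> borel_measurable (MR \<Otimes>\<^sub>M MR)" for k :: "nat \<Rightarrow> nat \<Rightarrow> real"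
  by (subst pair_measure_countable) auto

text \<open>
  Entries are coefficients of the images of unit vectors.
\<close>

lemma matrix_entry_le:
  assumes k: "positive_kernel_operator MR k" and c: "L2_bound MR (nn_op MR k) c" and xy: "x \<in> R" "y \<in> R"
  shows "k x y \<le> \<bar>c\<bar>"
proof -
  let ?f = "indicator {y} :: nat \<Rightarrow> ennreal"
  have "nn_op MR k ?f x = ennreal (k x y) * emeasure MR {y}"
    unfolding nn_op_def using xy by (subst nn_integral_cmult_indicator[symmetric])
      (auto intro!: nn_integral_cong split: split_indicator)
  then have kf: "nn_op MR k ?f x = ennreal (k x y)" using xy by simp
  have "sq_norm MR ?f = (\<integral>\<^sup>+z. indicator {y} z \<partial>MR)"
    unfolding sq_norm_def by (intro nn_integral_cong) (auto split: split_indicator)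
  then have f1: "sq_norm MR ?f = 1" using xy by simp
  have "ennreal ((k x y)\<^sup>2) = (nn_op MR k ?f x)\<^sup>2"
    using matrix_entry_nonneg[OF k xy] by (simp add: kf ennreal_power)
  also have "\<dots> \<le> sq_norm MR (nn_op MR k ?f)"
    unfolding sq_norm_def by (rule nn_integral_ge_point[OF xy(1)])
  also have "\<dots> \<le> ennreal (c\<^sup>2) * sq_norm MR ?f" by (rule L2_boundD[OF c]) simp
  finally have "(k x y)\<^sup>2 \<le> c\<^sup>2" by (simp add: f1)
  then show ?thesis by (simp add: abs_le_square_iff[symmetric])
qed

text \<open>
  All entries are at most \<open>\<bar>c\<bar>\<close>, hence \<open>k\<^sup>s \<le> \<bar>c\<bar>\<^bsup>s-1\<^esup> k\<close> entrywise.
\<close>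

lemma matrix_hadamard_power_bound:
  assumes k: "positive_kernel_operator MR k" and c: "L2_bound MR (nn_op MR k) c" and s: "1 \<le> s"
  shows "L2_bound MR (nn_op MR (hadamard_power k s)) (\<bar>c\<bar> powr s)"
proof -
  have "\<bar>c\<bar> powr s = \<bar>c\<bar> powr (s - 1) * \<bar>c\<bar>" using s by (intro powr_split_one) auto
  moreover have "L2_bound MR (nn_op MR (hadamard_power k s)) (\<bar>c\<bar> powr (s - 1) * c)"
  proof (rule L2_bound_scaled[OF matrix_measurable c])
    show "AE (x, y) in MR \<Otimes>\<^sub>M MR. 0 \<le> k x y" using k by (simp add: positive_kernel_operator_iff)
    show "AE (x, y) in MR \<Otimes>\<^sub>M MR. hadamard_power k s x y \<le> \<bar>c\<bar> powr (s - 1) * k x y"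
      unfolding AE_matrix_iff
    proof (intro ballI)
      fix x y assume xy: "x \<in> R" "y \<in> R"
      note k0 = matrix_entry_nonneg[OF k xy]
      have "k x y powr (s - 1) \<le> \<bar>c\<bar> powr (s - 1)"
        using s k0 matrix_entry_le[OF k c xy] by (intro powr_mono2) auto
      then show "hadamard_power k s x y \<le> \<bar>c\<bar> powr (s - 1) * k x y"
        unfolding hadamard_power_def powr_split_one[OF s k0] using k0 by (rule mult_right_mono)
    qed
  qed simp
  ultimately show ?thesis by (auto simp: abs_mult intro: L2_bound_mono)
qed

lemma positive_matrix_hadamard_power:
  assumes k: "positive_kernel_operator MR k" and s: "1 \<le> s"
  shows "positive_kernel_operator MR (hadamard_power k s)"
proof -
  obtain c where "L2_bound MR (nn_op MR k) c" using k by (auto simp: positive_kernel_operator_iff)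
  from matrix_hadamard_power_bound[OF k this s] show ?thesis
    by (auto simp: positive_kernel_operator_iff matrix_measurable AE_matrix_iff hadamard_power_def)
qed

text \<open>
  On a counting measure each value is at most the sum \<open>S\<close> of all values, hence \<open>a\<^sup>s \<le> S\<^bsup>s-1\<^esup> a\<close>.
\<close>

lemma integral_count_space_powr_le:
  fixes a :: "nat \<Rightarrow> real"
  assumes int: "integrable MR a" and nn: "\<And>z. z \<in> R \<Longrightarrow> 0 \<le> a z" and s: "1 \<le> s"
  shows "(\<integral>z. a z powr s \<partial>MR) \<le> (\<integral>z. a z \<partial>MR) powr s"
proof -
  let ?S = "\<integral>z. a z \<partial>MR"
  have S0: "0 \<le> ?S" using nn by (intro integral_nonneg_AE AE_I2) auto
  have le: "a z \<le> ?S" if "z \<in> R" for z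
  proof -
    have "ennreal (a z) \<le> (\<integral>\<^sup>+z. ennreal (a z) \<partial>MR)" by (rule nn_integral_ge_point[OF that])
    also have "\<dots> = ennreal ?S" using nn by (intro nn_integral_eq_integral int AE_I2) auto
    finally show ?thesis using S0 by (simp add: ennreal_le_iff)
  qed
  have "(\<integral>z. a z powr s \<partial>MR) \<le> (\<integral>z. ?S powr (s - 1) * a z \<partial>MR)"
  proof (rule integral_mono')
    fix z assume "z \<in> space MR"
    then have z: "z \<in> R" by simp
    have "a z powr (s - 1) \<le> ?S powr (s - 1)" using s nn[OF z] le[OF z] by (intro powr_mono2) auto
    then show "a z powr s \<le> ?S powr (s - 1) * a z"
      unfolding powr_split_one[OF s nn[OF z]] using nn[OF z] by (rule mult_right_mono)
    show "0 \<le> ?S powr (s - 1) * a z" using nn[OF z] by simp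
  qed (use int in simp)
  also have "\<dots> = ?S powr s" by (simp add: powr_split_one[OF s S0])
  finally show ?thesis .
qed

lemma kernel_comp_hadamard_power_le:
  assumes k: "positive_kernel_operator MR k" and h: "positive_kernel_operator MR h" and s: "1 \<le> s"
  shows "AE (x, y) in MR \<Otimes>\<^sub>M MR. kernel_comp MR (hadamard_power k s) (hadamard_power h s) x y \<le>
    hadamard_power (kernel_comp MR k h) s x y"
  unfolding AE_matrix_iff
proof (intro ballI)
  fix x y assume xy: "x \<in> R" "y \<in> R"
  have "integrable MR (\<lambda>z. k x z * h z y)"
    using kernel_comp_eq[OF k h] xy by (simp add: AE_matrix_iff)
  then have "(\<integral>z. (k x z * h z y) powr s \<partial>MR) \<le> (\<integral>z. k x z * h z y \<partial>MR) powr s"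
    using xy s by (intro integral_count_space_powr_le) (auto intro!: mult_nonneg_nonneg matrix_entry_nonneg k h)
  then show "kernel_comp MR (hadamard_power k s) (hadamard_power h s) x y \<le>
      hadamard_power (kernel_comp MR k h) s x y"
    by (simp add: kernel_comp_def hadamard_power_def powr_mult)
qed

lemma kernel_comp_list_hadamard_power_le:
  assumes "ks \<noteq> []" "\<And>k. k \<in> set ks \<Longrightarrow> positive_kernel_operator MR k" and s: "1 \<le> s"
  shows "AE (x, y) in MR \<Otimes>\<^sub>M MR. kernel_comp_list MR (map (\<lambda>k. hadamard_power k s) ks) x y \<le>
    hadamard_power (kernel_comp_list MR ks) s x y"
  using assms(1,2)
proof (induction ks)
  case (Cons k ks)
  show ?case
  proof (cases ks)
    case Nil
    then show ?thesis by simp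
  next
    case (Cons h hs)
    have ne: "ks \<noteq> []" using Cons by simp
    have k: "positive_kernel_operator MR k" using Cons.prems by simp
    have L: "positive_kernel_operator MR (kernel_comp_list MR ks)"
      using Cons.prems ne by (intro positive_kernel_operator_comp_list) auto
    have L': "positive_kernel_operator MR (kernel_comp_list MR (map (\<lambda>k. hadamard_power k s) ks))"
      using Cons.prems ne s by (intro positive_kernel_operator_comp_list)
        (auto intro: positive_matrix_hadamard_power)
    have IH: "AE (x, y) in MR \<Otimes>\<^sub>M MR. kernel_comp_list MR (map (\<lambda>k. hadamard_power k s) ks) x y \<le>
        hadamard_power (kernel_comp_list MR ks) s x y"
      using Cons.IH Cons.prems ne by simp
    have "AE (x, y) in MR \<Otimes>\<^sub>M MR.
        kernel_comp MR (hadamard_power k s) (kernel_comp_list MR (map (\<lambda>k. hadamard_power k s) ks)) x y \<le>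
        kernel_comp MR (hadamard_power k s) (hadamard_power (kernel_comp_list MR ks) s) x y"
      by (intro kernel_comp_mono positive_matrix_hadamard_power k s L L' IH) auto
    moreover have "AE (x, y) in MR \<Otimes>\<^sub>M MR.
        kernel_comp MR (hadamard_power k s) (hadamard_power (kernel_comp_list MR ks) s) x y \<le>
        hadamard_power (kernel_comp MR k (kernel_comp_list MR ks)) s x y"
      by (rule kernel_comp_hadamard_power_le[OF k L s])
    ultimately show ?thesis unfolding Cons by eventually_elim auto
  qed
qed simp

text \<open>
  The powers of \<open>k\<^bsup>(s)\<^esup>\<close> are entrywise at most the Hadamard powers of the powers of \<open>k\<close>.
\<close>

lemma kernel_radius_hadamard_power_le:
  assumes k: "positive_kernel_operator MR k" and s: "1 \<le> s"
  shows "kernel_radius MR (hadamard_power k s) \<le> kernel_radius MR k powr s"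
proof (rule dense_ge)
  fix d assume d: "kernel_radius MR k powr s < d"
  let ?p = "hadamard_power k s"
  have p: "positive_kernel_operator MR ?p" by (rule positive_matrix_hadamard_power[OF k s])
  have d0: "0 < d" using d powr_ge_zero le_less_trans by blast
  define c where "c = d powr (1 / s)"
  have cs: "c powr s = d" using s d0 by (simp add: c_def powr_powr)
  have "(kernel_radius MR k powr s) powr (1 / s) < d powr (1 / s)"
    using d s by (intro powr_less_mono2) auto
  then have "kernel_radius MR k < c"
    using s kernel_radius_nonneg[OF k] by (simp add: c_def powr_powr)
  note c = growth_above_kernel_radius[OF k this]
  obtain C where C: "\<And>n. L2_bound MR (nn_op MR k ^^ n) (C * c ^ n)" using c by (auto simp: growth_def)
  \<comment> \<open>The summand \<open>1\<close> in the constant is for the power \<open>0\<close>.\<close>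
  have "L2_bound MR (nn_op MR ?p ^^ n) ((1 + \<bar>C\<bar> powr s) * d ^ n)" for n
  proof (cases "n = 0")
    case True
    have "L2_bound MR (nn_op MR ?p ^^ n) 1" using True by (simp add: L2_bound_def)
    then show ?thesis using True by (auto intro: L2_bound_mono)
  next
    case False
    let ?R = "\<lambda>k. kernel_comp_list MR (replicate n k)"
    have ne: "replicate n k \<noteq> []" for k :: "nat \<Rightarrow> nat \<Rightarrow> real" using False by simp
    have it: "AE x in MR. nn_op MR (?R k) f x = (nn_op MR k ^^ n) f x"
      if "positive_kernel_operator MR k" "f \<in> borel_measurable MR" for k f
      using nn_op_kernel_comp_list[OF ne[of k] _ that(2)] that(1) by (simp add: foldr_replicate_nn_op)
    have Rk: "positive_kernel_operator MR (?R k)"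
      using k by (intro positive_kernel_operator_comp_list ne) auto
    have "L2_bound MR (nn_op MR (?R k)) (C * c ^ n)"
      unfolding L2_bound_def using L2_boundD[OF C] sq_norm_cong_AE[OF it[OF k]] by simp
    from matrix_hadamard_power_bound[OF Rk this s]
    have Rks: "L2_bound MR (nn_op MR (hadamard_power (?R k) s)) (\<bar>C * c ^ n\<bar> powr s)" .
    have "\<bar>C * c ^ n\<bar> powr s = \<bar>C\<bar> powr s * d ^ n"
    proof -
      have "(c ^ n) powr s = (c powr s) ^ n"
        using c(1) by (simp add: powr_realpow[symmetric] powr_powr mult.commute)
      then show ?thesis using c(1) by (simp add: abs_mult powr_mult cs)
    qed
    then have Rks': "L2_bound MR (nn_op MR (hadamard_power (?R k) s)) (\<bar>C\<bar> powr s * d ^ n)"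
      using Rks by simp
    have le: "AE (x, y) in MR \<Otimes>\<^sub>M MR. ?R ?p x y \<le> hadamard_power (?R k) s x y"
      using kernel_comp_list_hadamard_power_le[OF ne[of k] _ s] k by simp
    have "sq_norm MR ((nn_op MR ?p ^^ n) f) \<le> ennreal ((\<bar>C\<bar> powr s * d ^ n)\<^sup>2) * sq_norm MR f"
      if f: "f \<in> borel_measurable MR" for f
      using sq_norm_mono_AE[OF nn_op_kernel_mono_AE[OF le, of f]] L2_boundD[OF Rks' f]
      by (simp add: sq_norm_cong_AE[OF it[OF p f]])
    then have "L2_bound MR (nn_op MR ?p ^^ n) (\<bar>C\<bar> powr s * d ^ n)" unfolding L2_bound_def by blast
    then show ?thesis
      using d0 by (elim L2_bound_mono) (auto simp: abs_mult intro!: mult_right_mono)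
  qed
  then have "growth MR (nn_op MR ?p) d" unfolding growth_def by blast
  then show "kernel_radius MR ?p \<le> d" by (rule kernel_radius_le_growth_rate[OF p _ d0])
qed

text \<open>
  The inequalities for means, applied to the matrices \<open>G i\<^bsup>(s)\<^esup>\<close> with \<open>s = \<alpha> m\<close>. The operators that
  this produces from the \<open>G i\<^bsup>(s)\<^esup>\<close> are at most the \<open>s\<close>-th Hadamard powers of those produced from
  the \<open>G i\<close>.
\<close>

lemma matrix_hadamard_power_chain:
  fixes G :: "nat \<Rightarrow> nat \<Rightarrow> nat \<Rightarrow> real"
  assumes m: "0 < m" "even m" and \<tau>: "\<tau> permutes {1..m}" and \<nu>: "\<nu> permutes {1..m}"
    and pos: "\<forall>i\<in>{1..m}. positive_kernel_operator MR (G i)" and \<alpha>: "1 / real m \<le> \<alpha>"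
  defines "A \<equiv> A_ops MR m \<tau> G"
  defines "P \<equiv> P_ops MR m \<nu> A"
  shows "kernel_norm MR (hadamard_prod m (\<lambda>i. hadamard_power (G i) \<alpha>))
      \<le> sqrt (kernel_radius MR (hadamard_prod m (\<lambda>i. hadamard_power (A i) \<alpha>)))"
    and "kernel_radius MR (hadamard_prod m (\<lambda>i. hadamard_power (A i) \<alpha>)) ^ m
      \<le> kernel_radius MR (hadamard_prod m (\<lambda>i. hadamard_power (P i) \<alpha>))"
    and "kernel_radius MR (hadamard_prod m (\<lambda>i. hadamard_power (P i) \<alpha>))
      \<le> kernel_radius MR (kernel_comp_list MR (map (\<lambda>l. A (\<nu> l)) [1..<m + 1])) powr (\<alpha> * real m)"
    and "0 \<le> kernel_radius MR (hadamard_prod m (\<lambda>i. hadamard_power (A i) \<alpha>))"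
    and "0 \<le> kernel_radius MR (hadamard_prod m (\<lambda>i. hadamard_power (P i) \<alpha>))"
proof -
  have G: "positive_kernel_operator MR (G i)" if "i \<in> {1..m}" for i using pos that by blast
  define s where "s = \<alpha> * real m"
  have s: "1 \<le> s" using m \<alpha> by (simp add: s_def field_simps)
  define hp where "hp K i = hadamard_power (K i) s" for K :: "nat \<Rightarrow> nat \<Rightarrow> nat \<Rightarrow> real" and i :: nat
  have mean: "hadamard_prod m (\<lambda>i. hadamard_power (K i) \<alpha>) = hadamard_mean m (hp K)" for K
    using hadamard_prod_power_eq_mean[OF m(1), of K \<alpha>] by (simp add: hp_def[abs_def] s_def)
  have hp: "positive_kernel_operator MR (hp K i)" if "positive_kernel_operator MR (K i)" for K i
    unfolding hp_def by (rule positive_matrix_hadamard_power[OF that s])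
  have hG: "positive_kernel_operator MR (hp G i)" if "i \<in> {1..m}" for i using hp G that by blast
  have A: "positive_kernel_operator MR (A i)" if "i \<in> {1..m}" for i
    unfolding A_def by (rule A_ops_positive[OF m(2) \<tau> that G])
  have hA: "positive_kernel_operator MR (hp A i)" if "i \<in> {1..m}" for i using hp A that by blast
  have P: "positive_kernel_operator MR (P i)" if "i \<in> {1..m}" for i
    unfolding P_def by (rule P_ops_positive[OF \<nu> that A])
  have hP: "positive_kernel_operator MR (hp P i)" if "i \<in> {1..m}" for i using hp P that by blast
  note hm = positive_kernel_operator_hadamard_mean[OF m(1)]
  show "0 \<le> kernel_radius MR (hadamard_prod m (\<lambda>i. hadamard_power (A i) \<alpha>))"
    and "0 \<le> kernel_radius MR (hadamard_prod m (\<lambda>i. hadamard_power (P i) \<alpha>))"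
    unfolding mean by (intro kernel_radius_nonneg hm hA hP; assumption)+
  show "kernel_norm MR (hadamard_prod m (\<lambda>i. hadamard_power (G i) \<alpha>))
      \<le> sqrt (kernel_radius MR (hadamard_prod m (\<lambda>i. hadamard_power (A i) \<alpha>)))"
  proof -
    have A': "positive_kernel_operator MR (A_ops MR m \<tau> (hp G) i)" if "i \<in> {1..m}" for i
      by (rule A_ops_positive[OF m(2) \<tau> that hG])
    have "kernel_radius MR (hadamard_mean m (A_ops MR m \<tau> (hp G))) \<le> kernel_radius MR (hadamard_mean m (hp A))"
    proof (intro kernel_radius_mono hm hadamard_mean_mono A' hA)
      fix i assume i: "i \<in> {1..m}"
      obtain p q where pq: "bij_betw p {1..m} {1..m}" "bij_betw q {1..m} {1..m}"
        and eq: "\<And>K. A_ops MR m \<tau> K = (\<lambda>i. kernel_comp MR (kernel_adjoint (K (p i))) (K (q i)))"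
        using A_ops_reindex[OF m(2) \<tau>, of MR] by metis
      have jl: "p i \<in> {1..m}" "q i \<in> {1..m}" using bij_betwE[OF pq(1)] bij_betwE[OF pq(2)] i by auto
      show "AE (x, y) in MR \<Otimes>\<^sub>M MR. A_ops MR m \<tau> (hp G) i x y \<le> hp A i x y"
        using kernel_comp_hadamard_power_le[OF positive_kernel_operator_adjoint[OF G[OF jl(1)]] G[OF jl(2)] s]
        by (simp add: hp_def A_def eq kernel_adjoint_hadamard_power)
    qed
    then show ?thesis
      unfolding mean using kernel_norm_hadamard_mean_le_A_ops[OF m \<tau>, of "hp G"] hG
      by (meson order_trans real_sqrt_le_mono)
  qed
  show "kernel_radius MR (hadamard_prod m (\<lambda>i. hadamard_power (A i) \<alpha>)) ^ m
      \<le> kernel_radius MR (hadamard_prod m (\<lambda>i. hadamard_power (P i) \<alpha>))"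
  proof -
    have "kernel_radius MR (hadamard_mean m (P_ops MR m \<nu> (hp A))) \<le> kernel_radius MR (hadamard_mean m (hp P))"
    proof (intro kernel_radius_mono hm hadamard_mean_mono P_ops_positive \<nu> hA hP)
      fix i assume i: "i \<in> {1..m}"
      let ?ls = "[i..<m + 1] @ [1..<i]"
      have "\<nu> l \<in> {1..m}" if "l \<in> set ?ls" for l
        using that i by (subst permutes_in_image[OF \<nu>]) auto
      then have "AE (x, y) in MR \<Otimes>\<^sub>M MR.
          kernel_comp_list MR (map (\<lambda>k. hadamard_power k s) (map (\<lambda>l. A (\<nu> l)) ?ls)) x y \<le>
          hadamard_power (kernel_comp_list MR (map (\<lambda>l. A (\<nu> l)) ?ls)) s x y"
        using i A by (intro kernel_comp_list_hadamard_power_le s) auto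
      then show "AE (x, y) in MR \<Otimes>\<^sub>M MR. P_ops MR m \<nu> (hp A) i x y \<le> hp P i x y"
        unfolding P_ops_def P_def hp_def map_map o_def .
    qed
    then show ?thesis
      unfolding mean using kernel_radius_hadamard_mean_power_le_P_ops[OF m(1) \<nu>, of "hp A"] hA
      by (meson order_trans)
  qed
  show "kernel_radius MR (hadamard_prod m (\<lambda>i. hadamard_power (P i) \<alpha>))
      \<le> kernel_radius MR (kernel_comp_list MR (map (\<lambda>l. A (\<nu> l)) [1..<m + 1])) powr (\<alpha> * real m)"
    unfolding mean s_def[symmetric]
  proof (rule kernel_radius_hadamard_mean_le[OF m(1) hP])
    fix i assume i: "i \<in> {1..m}"
    have "kernel_radius MR (hp P i) \<le> kernel_radius MR (P i) powr s"
      unfolding hp_def by (rule kernel_radius_hadamard_power_le[OF P[OF i] s])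
    also have "\<dots> \<le> kernel_radius MR (kernel_comp_list MR (map (\<lambda>l. A (\<nu> l)) [1..<m + 1])) powr s"
      using s kernel_radius_nonneg[OF P[OF i]] kernel_radius_P_ops_le[OF \<nu> i, of A] A
      unfolding P_def[symmetric] by (intro powr_mono2) auto
    finally show "kernel_radius MR (hp P i) \<le>
        kernel_radius MR (kernel_comp_list MR (map (\<lambda>l. A (\<nu> l)) [1..<m + 1])) powr s" .
  qed
qed

end

section \<open>The chain of inequalities\<close>

lemma powr_half_le_of_power_le:
  fixes a b :: real
  assumes "0 < m" "0 \<le> a" "0 \<le> b" "a ^ m \<le> b"
  shows "a powr (1 / 2) \<le> b powr (1 / (2 * real m))"
proof -
  have "a powr (1 / 2) = (a powr real m) powr (1 / (2 * real m))"
    using assms(1) by (simp add: powr_powr)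
  also have "a powr real m = a ^ m" using assms by (cases "a = 0") (auto simp: powr_realpow)
  also have "(a ^ m) powr (1 / (2 * real m)) \<le> b powr (1 / (2 * real m))"
    using assms by (intro powr_mono2) auto
  finally show ?thesis .
qed

theorem theorem3p5:
  fixes M :: "'a measure" and m :: nat and \<tau> \<nu> :: "nat \<Rightarrow> nat"
    and H :: "nat \<Rightarrow> 'a \<Rightarrow> 'a \<Rightarrow> real"
    and R :: "nat set" and G :: "nat \<Rightarrow> nat \<Rightarrow> nat \<Rightarrow> real" and \<alpha> :: real
  assumes "sigma_finite_measure M" and "space M \<noteq> {}"
    and "0 < m" and "even m"
    and "\<tau> permutes {1..m}" and "\<nu> permutes {1..m}"
  shows
    "((\<forall>i\<in>{1..m}. positive_kernel_operator M (H i)) \<longrightarrow>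
      (let t = 1 / real m;
           A = A_ops M m \<tau> H;
           P = P_ops M m \<nu> A
       in kernel_norm M (hadamard_prod m (\<lambda>i. hadamard_power (H i) t))
            \<le> kernel_radius M (hadamard_prod m (\<lambda>i. hadamard_power (A i) t)) powr (1 / 2) \<and>
          kernel_radius M (hadamard_prod m (\<lambda>i. hadamard_power (A i) t)) powr (1 / 2)
            \<le> kernel_radius M (hadamard_prod m (\<lambda>i. hadamard_power (P i) t)) powr (1 / (2 * real m)) \<and>
          kernel_radius M (hadamard_prod m (\<lambda>i. hadamard_power (P i) t)) powr (1 / (2 * real m))
            \<le> kernel_radius M (kernel_comp_list M (map (\<lambda>l. A (\<nu> l)) [1..<m+1])) powr (1 / (2 * real m))))
     \<and>
     (((\<exists>N\<ge>1. R = {1..N}) \<or> R = {1..}) \<and>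
      (\<forall>i\<in>{1..m}. nonneg_matrix_operator R (G i)) \<and> 1 / real m \<le> \<alpha> \<longrightarrow>
      (let M' = count_space R;
           A = A_ops M' m \<tau> G;
           P = P_ops M' m \<nu> A
       in kernel_norm M' (hadamard_prod m (\<lambda>i. hadamard_power (G i) \<alpha>))
            \<le> kernel_radius M' (hadamard_prod m (\<lambda>i. hadamard_power (A i) \<alpha>)) powr (1 / 2) \<and>
          kernel_radius M' (hadamard_prod m (\<lambda>i. hadamard_power (A i) \<alpha>)) powr (1 / 2)
            \<le> kernel_radius M' (hadamard_prod m (\<lambda>i. hadamard_power (P i) \<alpha>)) powr (1 / (2 * real m)) \<and>
          kernel_radius M' (hadamard_prod m (\<lambda>i. hadamard_power (P i) \<alpha>)) powr (1 / (2 * real m))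
            \<le> kernel_radius M' (kernel_comp_list M' (map (\<lambda>l. A (\<nu> l)) [1..<m+1])) powr (\<alpha> / 2)))"
    (is "(?hyp1 \<longrightarrow> ?concl1) \<and> (?hyp2 \<longrightarrow> ?concl2)")
proof (intro conjI impI)
  note m = assms(3,4) and \<tau> = assms(5) and \<nu> = assms(6)
  assume ?hyp1
  then have H: "positive_kernel_operator M (H i)" if "i \<in> {1..m}" for i using that by blast
  interpret sigma_finite_measure M by fact
  define A where "A = A_ops M m \<tau> H"
  define P where "P = P_ops M m \<nu> A"
  have A: "positive_kernel_operator M (A i)" if "i \<in> {1..m}" for i
    unfolding A_def by (rule A_ops_positive[OF m(2) \<tau> that H])
  have P: "positive_kernel_operator M (P i)" if "i \<in> {1..m}" for i
    unfolding P_def by (rule P_ops_positive[OF \<nu> that A])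
  have rA: "0 \<le> kernel_radius M (hadamard_mean m A)" and rP: "0 \<le> kernel_radius M (hadamard_mean m P)"
    by (intro kernel_radius_nonneg positive_kernel_operator_hadamard_mean m A P; assumption)+
  have "kernel_norm M (hadamard_mean m H) \<le> kernel_radius M (hadamard_mean m A) powr (1 / 2)"
    using kernel_norm_hadamard_mean_le_A_ops[OF m \<tau> H] rA by (simp add: powr_half_sqrt A_def)
  moreover have "kernel_radius M (hadamard_mean m A) powr (1 / 2) \<le>
      kernel_radius M (hadamard_mean m P) powr (1 / (2 * real m))"
    using kernel_radius_hadamard_mean_power_le_P_ops[OF m(1) \<nu> A]
    by (intro powr_half_le_of_power_le m rA rP) (simp add: P_def)
  moreover have "kernel_radius M (hadamard_mean m P) powr (1 / (2 * real m)) \<le>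
      kernel_radius M (kernel_comp_list M (map (\<lambda>l. A (\<nu> l)) [1..<m + 1])) powr (1 / (2 * real m))"
  proof (rule powr_mono2)
    show "kernel_radius M (hadamard_mean m P) \<le>
        kernel_radius M (kernel_comp_list M (map (\<lambda>l. A (\<nu> l)) [1..<m + 1]))"
      using P kernel_radius_P_ops_le[OF \<nu> _ A]
      by (intro kernel_radius_hadamard_mean_le m) (simp_all add: P_def)
  qed (use rP in auto)
  ultimately show ?concl1
    unfolding Let_def hadamard_mean_def[symmetric] A_def[symmetric] P_def[symmetric] by blast
next
  note m = assms(3,4)
  assume hyp: ?hyp2
  define A where "A = A_ops (count_space R) m \<tau> G"
  define P where "P = P_ops (count_space R) m \<nu> A"
  have G: "\<forall>i\<in>{1..m}. positive_kernel_operator (count_space R) (G i)"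
    using hyp by (simp add: nonneg_matrix_operator_def positive_kernel_operator_def AE_matrix_iff)
  have \<alpha>: "1 / real m \<le> \<alpha>" using hyp by simp
  note chain = matrix_hadamard_power_chain[OF m assms(5,6) G \<alpha>, folded A_def, folded P_def]
  have "kernel_radius (count_space R) (hadamard_prod m (\<lambda>i. hadamard_power (P i) \<alpha>)) powr (1 / (2 * real m)) \<le>
      (kernel_radius (count_space R) (kernel_comp_list (count_space R) (map (\<lambda>l. A (\<nu> l)) [1..<m + 1]))
        powr (\<alpha> * real m)) powr (1 / (2 * real m))"
    by (rule powr_mono2[OF _ chain(5) chain(3)]) simp
  also have "\<dots> = kernel_radius (count_space R)
      (kernel_comp_list (count_space R) (map (\<lambda>l. A (\<nu> l)) [1..<m + 1])) powr (\<alpha> / 2)"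
    using m(1) by (simp add: powr_powr)
  finally show ?concl2
    unfolding Let_def A_def[symmetric] P_def[symmetric]
    using chain(1) chain(4) powr_half_le_of_power_le[OF m(1) chain(4,5,2)] by (simp add: powr_half_sqrt)
qed

end
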